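(* Let $(\mathfrak g,\diamond)$ be a pre-Lie algebra over $\mathbb K$ and write $\omega(x\otimes y)=x\diamond y$. Then the family of maps $\Omega=\{\Omega_n\}_{n\ge1}$, $$\Omega_n:\mathrm{CE}^n(Perm\otimes_{\mathrm H}\mathrm{End}_{\mathfrak g})\to \mathfrak C^n_{\mathrm{pLie}}(\mathfrak g),\qquad \sum_{\sigma\in \mathrm{Sh}^{-1}(n-1,1)}\xi_n^{\sigma}\otimes f_\sigma\longmapsto f_{\mathrm{id}},$$ is an isomorphism of cochain complexes from $(\mathrm{CE}^\bullet(Perm\otimes_{\mathrm H}\mathrm{End}_{\mathfrak g}),d_{\mathrm{CE}})$ to $(\mathfrak C^\bullet_{\mathrm{pLie}}(\mathfrak g),d_{\mathrm{pLie}})$. Equivalently, $d^n_{\mathrm{pLie}}=\Omega_{n+1}\circ d^n_{\mathrm{CE}}\circ\Omega_n^{-1}$ for all $n\ge1$.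
   Context: $\mathbb K$ is a field of characteristic $0$; all vector spaces are over $\mathbb K$. A (left) pre-Lie algebra is a vector space $\mathfrak g$ with a bilinear operation $\diamond$ satisfying $(x\diamond y)\diamond z-x\diamond(y\diamond z)=(y\diamond x)\diamond z-y\diamond(x\diamond z)$. Pre-Lie complex: $\mathfrak C^n_{\mathrm{pLie}}(\mathfrak g)=\mathrm{Hom}(\wedge^{n-1}\mathfrak g\otimes\mathfrak g,\mathfrak g)$ for $n\ge 1$, and $$\begin{aligned}(d^n_{\mathrm{pLie}}f)(x_1,\dots,x_n;x_{n+1})={}&\sum_{i=1}^n(-1)^{i+1}x_i\diamond f(x_1,\dots,\hat{x_i},\dots,x_n;x_{n+1})+\sum_{i=1}^n(-1)^{i+1}f(x_1,\dots,\hat{x_i},\dots,x_n;x_i)\diamond x_{n+1}\\&+\sum_{i=1}^n(-1)^if(x_1,\dots,\hat{x_i},\dots,x_n;x_i\diamond x_{n+1})\\&+\sum_{1\le i<j\le n}(-1)^{i+j}f(x_i\diamond x_j-x_j\diamond x_i,x_1,\dots,\hat{x_i},\dots,\hat{x_j},\dots,x_n;x_{n+1}).\end{aligned}$$ Conventions: for an $n$-linear map (or operation) $f$ and $\sigma\in S_n$, $f^\sigma(x_1,\dots,x_n)=f(x_{\sigma^{-1}(1)},\dots,x_{\sigma^{-1}(n)})$; $(-1)^\sigma$ is the sign. $\mathrm{Sh}^{-1}(i,j)$ ($i+j=m$) is the set of $\sigma\in S_m$ with $\sigma^{-1}(1)<\dots<\sigma^{-1}(i)$ and $\sigma^{-1}(i+1)<\dots<\sigma^{-1}(m)$.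 $\mathrm{End}_{\mathfrak g}$ is the endomorphism operad, $\mathrm{End}_{\mathfrak g}(n)=\mathrm{Hom}(\mathfrak g^{\otimes n},\mathfrak g)$, with $f\circ(g_1,\dots,g_n)=f(g_1\otimes\dots\otimes g_n)$. A perm algebra is a vector space with a bilinear product satisfying $(a_1a_2)a_3=(a_2a_1)a_3=a_1(a_2a_3)$; $Perm$ is the operad of perm algebras. $\xi_n\in Perm(n)$ is the operation $\xi_n(x_1,\dots,x_n)=x_1x_2\cdots x_n$; it is invariant under $S_{n-1}\times S_1$, and $\{\xi_n^\sigma\mid\sigma\in\mathrm{Sh}^{-1}(n-1,1)\}$ is a basis of $Perm(n)$ (corresponding to the monomials $x_1\cdots\widehat{x_i}\cdots x_n\,x_i$). $\mathcal O=Perm\otimes_{\mathrm H}\mathrm{End}_{\mathfrak g}$ is the Hadamard product: $\mathcal O(n)=Perm(n)\otimes\mathrm{End}_{\mathfrak g}(n)$ with diagonal $S_n$-action and componentwise composition. Put $\alpha(\nu)=\xi_2\otimes\omega-\xi_2^{(1\,2)}\otimes\omega^{(1\,2)}\in\mathcal O(2)$ (the image of the generator $\nu$ under an operad morphism $\alpha: Lie\to\mathcal O$). Then $\mathrm{CE}^n(\mathcal O)=\{F\in\mathcal O(n)\mid F^\sigma=(-1)^\sigma F\ \forall\sigma\in S_n\}$ and, for $F\in \mathrm{CE}^n(\mathcal O)$, $$d^n_{\mathrm{CE}}(F)=\sum_{\sigma\in\mathrm{Sh}^{-1}(1,n)}(-1)^\sigma\big(\alpha(\nu)\circ(\mathrm{id},F)\big)^\sigma-\sum_{\sigma\in\mathrm{Sh}^{-1}(2,n-1)}(-1)^\sigma\big(F\circ(\alpha(\nu),\mathrm{id},\dots,\mathrm{id})\big)^\sigma,$$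 where $\mathrm{id}$ is the operadic unit of $\mathcal O$; this makes $\mathrm{CE}^\bullet(\mathcal O)$ a cochain complex. *)

theory Defs
  imports
    Complex_Main
    "HOL-Library.Poly_Mapping"
    "HOL-Library.Function_Algebras"
    "HOL-Combinatorics.Permutations"
begin

text \<open>
  Vector spaces are subspaces of an ambient type of class \<open>ab_group_add\<close> with an explicit scalar
  multiplication. The inputs of an \<open>n\<close>-ary operation are numbered \<open>0, \<dots>, n - 1\<close>, and \<open>S\<^sub>n\<close> consists
  of the \<open>\<sigma>\<close> with \<open>\<sigma> permutes {..<n}\<close>. Shifting all indices from \<open>1..n\<close> to \<open>0..n-1\<close> changes a sign
  \<open>(-1)^(i+1)\<close> into \<open>(-1)^i\<close> and leaves \<open>(-1)^(i+j)\<close> unchanged.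
\<close>

definition linear_on ::
    "('k \<Rightarrow> 'a \<Rightarrow> 'a) \<Rightarrow> ('k \<Rightarrow> 'b \<Rightarrow> 'b) \<Rightarrow> 'a::ab_group_add set \<Rightarrow> ('a \<Rightarrow> 'b::ab_group_add) \<Rightarrow> bool" where
  "linear_on s t V f \<longleftrightarrow>
     (\<forall>u\<in>V. \<forall>v\<in>V. f (u + v) = f u + f v) \<and> (\<forall>c. \<forall>v\<in>V. f (s c v) = t c (f v))"


section \<open>Cochain complexes\<close>

text \<open>Complexes are indexed by \<open>n \<ge> 1\<close>; \<open>d n\<close> maps \<open>C n\<close> to \<open>C (n + 1)\<close>.\<close>

definition cochain_complex ::
    "('k::field \<Rightarrow> 'a \<Rightarrow> 'a) \<Rightarrow> (nat \<Rightarrow> 'a::ab_group_add set) \<Rightarrow> (nat \<Rightarrow> 'a \<Rightarrow> 'a) \<Rightarrow> bool" where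
  "cochain_complex s C d \<longleftrightarrow> vector_space s \<and>
     (\<forall>n\<ge>1. module.subspace s (C n) \<and> linear_on s s (C n) (d n) \<and>
       (\<forall>x\<in>C n. d n x \<in> C (n + 1)) \<and> (\<forall>x\<in>C n. d (n + 1) (d n x) = 0))"

definition cochain_isomorphism ::
    "('k::field \<Rightarrow> 'a \<Rightarrow> 'a) \<Rightarrow> (nat \<Rightarrow> 'a::ab_group_add set) \<Rightarrow> (nat \<Rightarrow> 'a \<Rightarrow> 'a) \<Rightarrow>
     ('k \<Rightarrow> 'b \<Rightarrow> 'b) \<Rightarrow> (nat \<Rightarrow> 'b::ab_group_add set) \<Rightarrow> (nat \<Rightarrow> 'b \<Rightarrow> 'b) \<Rightarrow>
     (nat \<Rightarrow> 'a \<Rightarrow> 'b) \<Rightarrow> bool" where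
  "cochain_isomorphism s C d t D e \<Phi> \<longleftrightarrow> cochain_complex s C d \<and> cochain_complex t D e \<and>
     (\<forall>n\<ge>1. linear_on s t (C n) (\<Phi> n) \<and> bij_betw (\<Phi> n) (C n) (D n) \<and>
       (\<forall>x\<in>C n. \<Phi> (n + 1) (d n x) = e n (\<Phi> n x)))"


section \<open>Tensor products\<close>

definition bilinear_forms ::
    "('k::field \<Rightarrow> 'a \<Rightarrow> 'a) \<Rightarrow> ('k \<Rightarrow> 'b \<Rightarrow> 'b) \<Rightarrow> 'a::ab_group_add set \<Rightarrow> 'b::ab_group_add set \<Rightarrow>
     ('a \<Rightarrow> 'b \<Rightarrow> 'k) set" where
  "bilinear_forms s t V W =
     {\<beta>. (\<forall>w\<in>W. linear_on s (*) V (\<lambda>v. \<beta> v w)) \<and> (\<forall>v\<in>V. linear_on t (*) W (\<beta> v))}"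

text \<open>
  The tensor product \<open>V \<otimes> W\<close> is realised inside the dual of the space of bilinear forms on
  \<open>V \<times> W\<close>: \<open>v \<otimes> w\<close> is evaluation at \<open>(v, w)\<close>, and \<open>V \<otimes> W\<close> is the span of these functionals.
  That this has the universal property of the tensor product is proved below.
\<close>

definition tensor ::
    "('k::field \<Rightarrow> 'a \<Rightarrow> 'a) \<Rightarrow> ('k \<Rightarrow> 'b \<Rightarrow> 'b) \<Rightarrow> 'a::ab_group_add set \<Rightarrow> 'b::ab_group_add set \<Rightarrow>
     'a \<Rightarrow> 'b \<Rightarrow> ('a \<Rightarrow> 'b \<Rightarrow> 'k) \<Rightarrow> 'k" where
  "tensor s t V W v w = (\<lambda>\<beta>. if \<beta> \<in> bilinear_forms s t V W then \<beta> v w else 0)"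

definition scale_fun :: "('k \<Rightarrow> 'a \<Rightarrow> 'a) \<Rightarrow> 'k \<Rightarrow> ('x \<Rightarrow> 'a) \<Rightarrow> 'x \<Rightarrow> 'a" where
  "scale_fun s c F = (\<lambda>x. s c (F x))"

definition tensor_product ::
    "('k::field \<Rightarrow> 'a \<Rightarrow> 'a) \<Rightarrow> ('k \<Rightarrow> 'b \<Rightarrow> 'b) \<Rightarrow> 'a::ab_group_add set \<Rightarrow> 'b::ab_group_add set \<Rightarrow>
     (('a \<Rightarrow> 'b \<Rightarrow> 'k) \<Rightarrow> 'k) set" where
  "tensor_product s t V W =
     module.span (scale_fun (*)) {tensor s t V W v w | v w. v \<in> V \<and> w \<in> W}"

lemma vector_space_scale_fun:
  assumes "vector_space s"
  shows "vector_space (scale_fun s)"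
proof -
  interpret vector_space s by fact
  show ?thesis
    by unfold_locales (simp_all add: scale_fun_def fun_eq_iff scale_right_distrib scale_left_distrib)
qed

lemma vector_space_times: "vector_space ((*) :: 'k::field \<Rightarrow> 'k \<Rightarrow> 'k)"
  by unfold_locales (simp_all add: algebra_simps)

lemma linear_on_tensor:
  "w \<in> W \<Longrightarrow> linear_on s (scale_fun (*)) V (\<lambda>v. tensor s t V W v w)"
  "v \<in> V \<Longrightarrow> linear_on t (scale_fun (*)) W (tensor s t V W v)"
  by (auto simp: linear_on_def tensor_def bilinear_forms_def scale_fun_def fun_eq_iff)

theorem tensor_product_universal:
  fixes s :: "'k::field \<Rightarrow> 'a::ab_group_add \<Rightarrow> 'a" and t :: "'k \<Rightarrow> 'b::ab_group_add \<Rightarrow> 'b"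
    and u :: "'k \<Rightarrow> 'c::ab_group_add \<Rightarrow> 'c"
  assumes u: "vector_space u"
    and h: "\<And>w. w \<in> W \<Longrightarrow> linear_on s u V (\<lambda>v. h v w)" "\<And>v. v \<in> V \<Longrightarrow> linear_on t u W (h v)"
  shows "\<exists>L. linear_on (scale_fun (*)) u (tensor_product s t V W) L \<and>
     (\<forall>v\<in>V. \<forall>w\<in>W. L (tensor s t V W v w) = h v w)"
proof -
  interpret T: vector_space "scale_fun (*) :: 'k \<Rightarrow> (('a \<Rightarrow> 'b \<Rightarrow> 'k) \<Rightarrow> 'k) \<Rightarrow> _"
    by (intro vector_space_scale_fun vector_space_times)
  interpret U: vector_space u by fact
  interpret UK: vector_space_pair u "(*) :: 'k \<Rightarrow> 'k \<Rightarrow> 'k"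
    by (intro vector_space_pair.intro u vector_space_times)
  interpret TU: vector_space_pair "scale_fun (*) :: 'k \<Rightarrow> (('a \<Rightarrow> 'b \<Rightarrow> 'k) \<Rightarrow> 'k) \<Rightarrow> _" u
    by unfold_locales
  have separate: "x = 0" if "\<And>f. Vector_Spaces.linear u (*) f \<Longrightarrow> f x = (0::'k)" for x
  proof (rule ccontr)
    assume "x \<noteq> 0"
    then have ind: "U.independent {x}" by simp
    have "UK.construct {x} (\<lambda>_. 1) x = 0"
      by (rule that) (rule UK.linear_construct[OF ind])
    then show False by (simp add: UK.construct_basis[OF ind])
  qed
  let ?t = "tensor s t V W"
  let ?G = "{?t v w | v w. v \<in> V \<and> w \<in> W}"
  obtain B where B: "B \<subseteq> ?G" "T.independent B" "?G \<subseteq> T.span B"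
    using T.maximal_independent_subset[of ?G] by blast
  then have "\<forall>b\<in>B. \<exists>x. fst x \<in> V \<and> snd x \<in> W \<and> b = ?t (fst x) (snd x)"
    by fastforce
  then obtain r where r: "\<And>b. b \<in> B \<Longrightarrow> fst (r b) \<in> V \<and> snd (r b) \<in> W \<and> b = ?t (fst (r b)) (snd (r b))"
    by metis
  define L where "L = TU.construct B (\<lambda>b. h (fst (r b)) (snd (r b)))"
  have lin: "Vector_Spaces.linear (scale_fun (*)) u L"
    unfolding L_def by (rule TU.linear_construct[OF B(2)])
  then interpret L: Vector_Spaces.linear "scale_fun (*) :: 'k \<Rightarrow> (('a \<Rightarrow> 'b \<Rightarrow> 'k) \<Rightarrow> 'k) \<Rightarrow> _" u L .
  have "L (?t v w) = h v w" if vw: "v \<in> V" "w \<in> W" for v w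
  proof -
    have "L (?t v w) - h v w = 0"
    proof (rule separate)
      fix f :: "'c \<Rightarrow> 'k"
      assume f: "Vector_Spaces.linear u (*) f"
      then interpret f: Vector_Spaces.linear u "(*) :: 'k \<Rightarrow> 'k \<Rightarrow> 'k" f .
      let ?b = "\<lambda>v w. f (h v w)"
      have fb: "?b \<in> bilinear_forms s t V W"
        using h by (auto simp: bilinear_forms_def linear_on_def f.add f.scale)
      have "f (L x) = x ?b" if "x \<in> T.span B" for x
        using that
      proof (induction rule: T.span_induct_alt)
        case base
        then show ?case unfolding L.zero f.zero by (simp add: zero_fun_def)
      next
        case (step c b y)
        have "f (L b) = b ?b"
          using r[OF step(1)] fb TU.construct_basis[OF B(2) step(1)]
          unfolding L_def by (metis (mono_tags, lifting) tensor_def)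
        moreover have "f (L (scale_fun (*) c b + y)) = c * f (L b) + f (L y)"
          by (simp add: L.add L.scale f.add f.scale)
        ultimately show ?case
          using step by (simp add: scale_fun_def plus_fun_def)
      qed
      from this[of "?t v w"] have "f (L (?t v w)) = ?t v w ?b"
        using B(3) vw by blast
      also have "\<dots> = f (h v w)" using fb by (simp add: tensor_def)
      finally show "f (L (?t v w) - h v w) = 0" by (simp add: f.diff)
    qed
    then show ?thesis by simp
  qed
  moreover have "linear_on (scale_fun (*)) u (tensor_product s t V W) L"
    by (simp add: linear_on_def L.add L.scale)
  ultimately show ?thesis by blast
qed


section \<open>Operads\<close>

text \<open>
  The data of a linear operad \<open>P\<close>: the space \<open>ops P n\<close> of \<open>n\<close>-ary operations, its scalar
  multiplication, the action \<open>act P n \<sigma> f = f\<^sup>\<sigma>\<close>, the unit, and the composition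
  \<open>ocomp P [k\<^sub>1, \<dots>, k\<^sub>m] f [g\<^sub>1, \<dots>, g\<^sub>m] = f \<circ> (g\<^sub>1, \<dots>, g\<^sub>m)\<close>, where \<open>g\<^sub>i\<close> has arity \<open>k\<^sub>i\<close>.
\<close>

record ('k, 'a) operad =
  ops :: "nat \<Rightarrow> 'a set"
  smul :: "'k \<Rightarrow> 'a \<Rightarrow> 'a"
  act :: "nat \<Rightarrow> (nat \<Rightarrow> nat) \<Rightarrow> 'a \<Rightarrow> 'a"
  idop :: 'a
  ocomp :: "nat list \<Rightarrow> 'a \<Rightarrow> 'a list \<Rightarrow> 'a"

text \<open>\<open>offset ks i\<close> is the number of inputs in the blocks before the \<open>i\<close>-th one.\<close>

definition offset :: "nat list \<Rightarrow> nat \<Rightarrow> nat" where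
  "offset ks i = sum_list (take i ks)"


subsection \<open>The endomorphism operad\<close>

text \<open>
  \<open>Hom(\<gg>\<^sup>\<otimes>\<^sup>n, \<gg>)\<close> is the space of \<open>n\<close>-linear maps; their arguments are collected in a list, and they
  are extended by 0 to lists of other lengths.
\<close>

definition multilinear_maps :: "('k::field \<Rightarrow> 'v \<Rightarrow> 'v) \<Rightarrow> nat \<Rightarrow> ('v list \<Rightarrow> 'v::ab_group_add) set" where
  "multilinear_maps scale n = {f.
     (\<forall>xs. length xs \<noteq> n \<longrightarrow> f xs = 0) \<and>
     (\<forall>xs i. length xs = n \<longrightarrow> i < n \<longrightarrow> Vector_Spaces.linear scale scale (\<lambda>v. f (xs[i := v])))}"

definition end_operad :: "('k::field \<Rightarrow> 'v \<Rightarrow> 'v) \<Rightarrow> ('k, 'v list \<Rightarrow> 'v::ab_group_add) operad" where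
  "end_operad scale = \<lparr>
     ops = multilinear_maps scale,
     smul = scale_fun scale,
     act = (\<lambda>n \<sigma> f xs. f (permute_list (inv \<sigma>) xs)),
     idop = (\<lambda>xs. if length xs = 1 then hd xs else 0),
     ocomp = (\<lambda>ks f gs xs. if length xs = sum_list ks
       then f (map (\<lambda>i. (gs ! i) (take (ks ! i) (drop (offset ks i) xs))) [0..<length ks]) else 0)\<rparr>"


subsection \<open>The free perm algebra\<close>

text \<open>
  The free nonassociative algebra on \<open>x\<^sub>0, x\<^sub>1, \<dots>\<close> has as basis the bracketed words, \<open>Var i\<close>
  being \<open>x\<^sub>i\<close>; the free perm algebra is its quotient by the ideal generated by the perm relations.
\<close>

datatype word = Var nat | Mul word word

primrec letters :: "word \<Rightarrow> nat list" where
  "letters (Var i) = [i]"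
| "letters (Mul s t) = letters s @ letters t"

definition lin_ext :: "('k \<Rightarrow> 'a \<Rightarrow> 'a) \<Rightarrow> ('m \<Rightarrow> 'a) \<Rightarrow> ('m \<Rightarrow>\<^sub>0 'k::zero) \<Rightarrow> 'a::comm_monoid_add" where
  "lin_ext s g p = (\<Sum>m\<in>Poly_Mapping.keys p. s (Poly_Mapping.lookup p m) (g m))"

definition pm_scale :: "'k::field \<Rightarrow> ('m \<Rightarrow>\<^sub>0 'k) \<Rightarrow> ('m \<Rightarrow>\<^sub>0 'k)" where
  "pm_scale c p = Poly_Mapping.map ((*) c) p"

definition na_mult :: "(word \<Rightarrow>\<^sub>0 'k::field) \<Rightarrow> (word \<Rightarrow>\<^sub>0 'k) \<Rightarrow> (word \<Rightarrow>\<^sub>0 'k)" where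
  "na_mult p q =
     lin_ext pm_scale (\<lambda>s. lin_ext pm_scale (\<lambda>t. Poly_Mapping.single (Mul s t) 1) q) p"

inductive_set perm_ideal :: "(word \<Rightarrow>\<^sub>0 'k::field) set" where
  left_commutative: "na_mult (na_mult a b) c - na_mult (na_mult b a) c \<in> perm_ideal"
| associative: "na_mult (na_mult a b) c - na_mult a (na_mult b c) \<in> perm_ideal"
| zero: "0 \<in> perm_ideal"
| add: "p \<in> perm_ideal \<Longrightarrow> q \<in> perm_ideal \<Longrightarrow> p + q \<in> perm_ideal"
| scale: "p \<in> perm_ideal \<Longrightarrow> pm_scale c p \<in> perm_ideal"
| mult_left: "p \<in> perm_ideal \<Longrightarrow> na_mult a p \<in> perm_ideal"
| mult_right: "p \<in> perm_ideal \<Longrightarrow> na_mult p a \<in> perm_ideal"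

lemma lookup_pm_scale [simp]: "Poly_Mapping.lookup (pm_scale c p) m = c * Poly_Mapping.lookup p m"
  by (simp add: pm_scale_def Poly_Mapping.map.rep_eq when_def)

lemma vector_space_pm_scale: "vector_space (pm_scale :: 'k::field \<Rightarrow> ('m \<Rightarrow>\<^sub>0 'k) \<Rightarrow> _)"
  by unfold_locales (auto intro!: poly_mapping_eqI simp: lookup_add algebra_simps)

lemma lin_ext_superset:
  assumes "vector_space s" "finite A" "Poly_Mapping.keys p \<subseteq> A"
  shows "lin_ext s g p = (\<Sum>m\<in>A. s (Poly_Mapping.lookup p m) (g m))"
proof -
  interpret vector_space s by fact
  show ?thesis
    unfolding lin_ext_def
    by (rule sum.mono_neutral_left) (use assms in \<open>auto simp: in_keys_iff\<close>)
qed

lemma lin_ext_add: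
  assumes "vector_space s"
  shows "lin_ext s g (p + q) = lin_ext s g p + lin_ext s g q"
proof -
  interpret vector_space s by fact
  let ?A = "Poly_Mapping.keys p \<union> Poly_Mapping.keys q"
  have "Poly_Mapping.keys (p + q) \<subseteq> ?A" by (rule Poly_Mapping.keys_add)
  then show ?thesis
    by (simp add: lin_ext_superset[OF assms, of ?A] lookup_add scale_left_distrib sum.distrib)
qed

lemma lin_ext_scale:
  assumes "vector_space s"
  shows "lin_ext s g (pm_scale c p) = s c (lin_ext s g p)"
proof -
  interpret vector_space s by fact
  have "Poly_Mapping.keys (pm_scale c p) \<subseteq> Poly_Mapping.keys p" by (auto simp: in_keys_iff)
  then show ?thesis
    by (simp add: lin_ext_superset[OF assms, of "Poly_Mapping.keys p"] scale_sum_right)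
qed

lemma lin_ext_zero [simp]: "lin_ext s g 0 = 0"
  by (simp add: lin_ext_def)

lemma lin_ext_diff:
  assumes "vector_space s"
  shows "lin_ext s g (p - q) = lin_ext s g p - lin_ext s g q"
  using lin_ext_add[OF assms, of g "p - q" q] by (simp add: algebra_simps)

lemma lin_ext_single [simp]:
  assumes "vector_space s"
  shows "lin_ext s g (Poly_Mapping.single m c) = s c (g m)"
proof -
  interpret vector_space s by fact
  show ?thesis by (simp add: lin_ext_superset[OF assms, of "{m}"])
qed

lemma lin_ext_fun_add:
  assumes "vector_space s"
  shows "lin_ext s (\<lambda>m. g m + h m) p = lin_ext s g p + lin_ext s h p"
proof -
  interpret vector_space s by fact
  show ?thesis by (simp add: lin_ext_def scale_right_distrib sum.distrib)
qed

lemma lin_ext_fun_scale: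
  assumes "vector_space s"
  shows "lin_ext s (\<lambda>m. s c (g m)) p = s c (lin_ext s g p)"
proof -
  interpret vector_space s by fact
  show ?thesis by (simp add: lin_ext_def scale_sum_right mult.commute)
qed

lemmas pm_lin_ext = lin_ext_add[OF vector_space_pm_scale] lin_ext_diff[OF vector_space_pm_scale]
  lin_ext_scale[OF vector_space_pm_scale] lin_ext_fun_add[OF vector_space_pm_scale]
  lin_ext_fun_scale[OF vector_space_pm_scale]

lemma na_mult_add:
  "na_mult (p + q) r = na_mult p r + na_mult q r"
  "na_mult r (p + q) = na_mult r p + na_mult r q"
  by (simp_all add: na_mult_def pm_lin_ext)

lemma na_mult_scale:
  "na_mult (pm_scale c p) q = pm_scale c (na_mult p q)"
  "na_mult p (pm_scale c q) = pm_scale c (na_mult p q)"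
  by (simp_all add: na_mult_def pm_lin_ext)

lemma na_mult_diff:
  "na_mult (p - q) r = na_mult p r - na_mult q r"
  "na_mult r (p - q) = na_mult r p - na_mult r q"
  using na_mult_add(1)[of "p - q" q r] na_mult_add(2)[of r "p - q" q] by (simp_all add: algebra_simps)

lemma perm_ideal_uminus: "p \<in> perm_ideal \<Longrightarrow> - p \<in> perm_ideal"
proof -
  assume "p \<in> perm_ideal"
  then have "pm_scale (- 1) p \<in> perm_ideal" by (rule perm_ideal.scale)
  also have "pm_scale (- 1) p = - p"
    by (intro poly_mapping_eqI) simp
  finally show ?thesis .
qed

lemma perm_ideal_diff: "p \<in> perm_ideal \<Longrightarrow> q \<in> perm_ideal \<Longrightarrow> p - q \<in> perm_ideal"
  using perm_ideal.add[OF _ perm_ideal_uminus, of p q] by simp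

quotient_type (overloaded) 'k free_perm =
  "word \<Rightarrow>\<^sub>0 'k::field" / "\<lambda>p q. p - q \<in> perm_ideal"
proof (rule equivpI)
  show "reflp (\<lambda>p q :: word \<Rightarrow>\<^sub>0 'k. p - q \<in> perm_ideal)"
    by (rule reflpI) (simp add: perm_ideal.zero)
  show "symp (\<lambda>p q :: word \<Rightarrow>\<^sub>0 'k. p - q \<in> perm_ideal)"
    by (rule sympI) (metis minus_diff_eq perm_ideal_uminus)
  show "transp (\<lambda>p q :: word \<Rightarrow>\<^sub>0 'k. p - q \<in> perm_ideal)"
    by (rule transpI) (metis diff_add_cancel add_diff_eq perm_ideal.add)
qed

instantiation free_perm :: (field) ab_group_add
begin

lift_definition zero_free_perm :: "'a free_perm" is 0 .

lift_definition plus_free_perm :: "'a free_perm \<Rightarrow> 'a free_perm \<Rightarrow> 'a free_perm" is "(+)"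
  by (metis add_diff_add perm_ideal.add)

lift_definition uminus_free_perm :: "'a free_perm \<Rightarrow> 'a free_perm" is uminus
  by (metis minus_diff_minus perm_ideal_uminus)

lift_definition minus_free_perm :: "'a free_perm \<Rightarrow> 'a free_perm \<Rightarrow> 'a free_perm" is "(-)"
proof -
  fix a b c d :: "word \<Rightarrow>\<^sub>0 'a"
  assume "a - b \<in> perm_ideal" "c - d \<in> perm_ideal"
  then have "(a - b) - (c - d) \<in> perm_ideal" by (rule perm_ideal_diff)
  then show "a - c - (b - d) \<in> perm_ideal" by (simp add: algebra_simps)
qed

instance
  by standard (transfer; simp add: algebra_simps perm_ideal.zero)+

end

lemma pm_scale_diff: "pm_scale c (p - q) = pm_scale c p - pm_scale c q"
  by (intro poly_mapping_eqI) (simp add: lookup_minus algebra_simps)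

lift_definition perm_scale :: "'k::field \<Rightarrow> 'k free_perm \<Rightarrow> 'k free_perm" is pm_scale
  by (simp flip: pm_scale_diff add: perm_ideal.scale)

lift_definition perm_mult :: "'k::field free_perm \<Rightarrow> 'k free_perm \<Rightarrow> 'k free_perm" is na_mult
proof -
  fix a b c d :: "word \<Rightarrow>\<^sub>0 'k"
  assume "a - b \<in> perm_ideal" "c - d \<in> perm_ideal"
  then have "na_mult (a - b) c + na_mult b (c - d) \<in> perm_ideal"
    by (intro perm_ideal.intros)
  then show "na_mult a c - na_mult b d \<in> perm_ideal"
    by (simp add: na_mult_diff)
qed

lift_definition perm_word :: "word \<Rightarrow> 'k::field free_perm" is "\<lambda>t. Poly_Mapping.single t 1" .

abbreviation perm_var :: "nat \<Rightarrow> 'k::field free_perm" where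
  "perm_var i \<equiv> perm_word (Var i)"

lemma vector_space_perm_scale: "vector_space (perm_scale :: 'k::field \<Rightarrow> _)"
proof -
  interpret vector_space "pm_scale :: 'k \<Rightarrow> (word \<Rightarrow>\<^sub>0 'k) \<Rightarrow> _" by (rule vector_space_pm_scale)
  show ?thesis
    by unfold_locales (transfer; simp add: scale_right_distrib scale_left_distrib perm_ideal.zero)+
qed

lemma perm_mult_linear:
  "perm_mult (p + q) r = perm_mult p r + perm_mult q r"
  "perm_mult r (p + q) = perm_mult r p + perm_mult r q"
  "perm_mult (perm_scale c p) r = perm_scale c (perm_mult p r)"
  "perm_mult r (perm_scale c p) = perm_scale c (perm_mult r p)"
  by (transfer; simp add: na_mult_add na_mult_scale perm_ideal.zero)+

lemma perm_mult_perm: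
  "perm_mult (perm_mult a b) c = perm_mult (perm_mult b a) c"
  "perm_mult (perm_mult a b) c = perm_mult a (perm_mult b c)"
  by (transfer; rule perm_ideal.intros)+

text \<open>
  \<open>perm_eval \<phi>\<close> is the endomorphism of the free perm algebra that sends each \<open>x\<^sub>i\<close> to \<open>\<phi> i\<close>, that is,
  substitution for the variables.
\<close>

primrec word_eval :: "(nat \<Rightarrow> 'k::field free_perm) \<Rightarrow> word \<Rightarrow> 'k free_perm" where
  "word_eval \<phi> (Var i) = \<phi> i"
| "word_eval \<phi> (Mul s t) = perm_mult (word_eval \<phi> s) (word_eval \<phi> t)"

lemmas perm_lin_ext = lin_ext_add[OF vector_space_perm_scale] lin_ext_diff[OF vector_space_perm_scale]
  lin_ext_scale[OF vector_space_perm_scale] lin_ext_single[OF vector_space_perm_scale]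

lemma lin_ext_compose:
  assumes "\<And>x y. f (x + y) = f x + f y" "\<And>c x. f (s c x) = t c (f x)" "f 0 = 0"
  shows "f (lin_ext s g p) = lin_ext t (\<lambda>m. f (g m)) p"
proof -
  have "f (sum h A) = (\<Sum>m\<in>A. f (h m))" for h and A :: "'d set"
    by (induction A rule: infinite_finite_induct) (auto simp: assms)
  then show ?thesis by (simp add: lin_ext_def assms(2))
qed

lemma lin_ext_na_mult:
  "lin_ext perm_scale (word_eval \<phi>) (na_mult p q) =
    perm_mult (lin_ext perm_scale (word_eval \<phi>) p) (lin_ext perm_scale (word_eval \<phi>) q)"
proof -
  interpret vector_space "perm_scale :: 'a \<Rightarrow> _" by (rule vector_space_perm_scale)
  let ?E = "lin_ext perm_scale (word_eval \<phi>)"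
  have z: "perm_mult 0 r = 0" "perm_mult r 0 = 0" for r :: "'a free_perm"
    using perm_mult_linear(1)[of 0 0 r] perm_mult_linear(2)[of r 0 0] by simp_all
  have 1: "?E (lin_ext pm_scale g r) = lin_ext perm_scale (\<lambda>m. ?E (g m)) r"
    for g :: "word \<Rightarrow> _" and r
    by (rule lin_ext_compose) (simp_all add: perm_lin_ext)
  have 2: "perm_mult (lin_ext perm_scale g r) y = lin_ext perm_scale (\<lambda>m. perm_mult (g m) y) r"
    for g :: "word \<Rightarrow> _" and r and y :: "'a free_perm"
    by (rule lin_ext_compose) (simp_all add: perm_mult_linear z)
  have 3: "perm_mult y (lin_ext perm_scale g r) = lin_ext perm_scale (\<lambda>m. perm_mult y (g m)) r"
    for g :: "word \<Rightarrow> _" and r and y :: "'a free_perm"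
    by (rule lin_ext_compose) (simp_all add: perm_mult_linear z)
  show ?thesis
    unfolding na_mult_def by (simp add: 1 2 perm_lin_ext) (simp add: 3)
qed

lemma word_eval_perm_ideal: "p \<in> perm_ideal \<Longrightarrow> lin_ext perm_scale (word_eval \<phi>) p = 0"
proof (induction rule: perm_ideal.induct)
  case (mult_left p a)
  then show ?case
    using perm_mult_linear(2)[of "lin_ext perm_scale (word_eval \<phi>) a" 0 0] by (simp add: lin_ext_na_mult)
next
  case (mult_right p a)
  then show ?case
    using perm_mult_linear(1)[of 0 0 "lin_ext perm_scale (word_eval \<phi>) a"] by (simp add: lin_ext_na_mult)
next
  case (scale p c)
  interpret vector_space "perm_scale :: 'a \<Rightarrow> _" by (rule vector_space_perm_scale)
  from scale show ?case by (simp add: perm_lin_ext)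
next
  case (left_commutative a b c)
  then show ?case
    by (simp add: perm_lin_ext lin_ext_na_mult
        perm_mult_perm(1)[of "lin_ext perm_scale (word_eval \<phi>) a" "lin_ext perm_scale (word_eval \<phi>) b"])
next
  case (associative a b c)
  then show ?case by (simp add: perm_lin_ext lin_ext_na_mult perm_mult_perm(2))
qed (simp_all add: perm_lin_ext)

lift_definition perm_eval :: "(nat \<Rightarrow> 'k::field free_perm) \<Rightarrow> 'k free_perm \<Rightarrow> 'k free_perm"
  is "\<lambda>\<phi>. lin_ext perm_scale (word_eval \<phi>)"
proof -
  fix \<phi> :: "nat \<Rightarrow> 'k free_perm" and p q :: "word \<Rightarrow>\<^sub>0 'k"
  assume "p - q \<in> perm_ideal"
  then have "lin_ext perm_scale (word_eval \<phi>) (p - q) = 0" by (rule word_eval_perm_ideal)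
  then show "lin_ext perm_scale (word_eval \<phi>) p = lin_ext perm_scale (word_eval \<phi>) q"
    by (simp add: perm_lin_ext)
qed

lemma perm_eval_add: "perm_eval \<phi> (p + q) = perm_eval \<phi> p + perm_eval \<phi> q"
  by transfer (simp add: perm_lin_ext)

lemma perm_eval_scale: "perm_eval \<phi> (perm_scale c p) = perm_scale c (perm_eval \<phi> p)"
  by transfer (simp add: perm_lin_ext)

lemma perm_eval_mult: "perm_eval \<phi> (perm_mult p q) = perm_mult (perm_eval \<phi> p) (perm_eval \<phi> q)"
  by transfer (simp add: lin_ext_na_mult)

lemma perm_eval_word: "perm_eval \<phi> (perm_word t) = word_eval \<phi> t"
proof -
  interpret vector_space "perm_scale :: 'a \<Rightarrow> _" by (rule vector_space_perm_scale)
  show ?thesis by transfer (simp add: perm_lin_ext)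
qed


subsection \<open>The operad of perm algebras\<close>

text \<open>
  \<open>Perm(n)\<close> is the multilinear part of the free perm algebra on \<open>x\<^sub>0, \<dots>, x\<^bsub>n-1\<^esub>\<close>. An element \<open>p\<close> is
  identified with the operation \<open>p(x\<^sub>0, \<dots>, x\<^bsub>n-1\<^esub>)\<close>: the symmetric group permutes the variables, and
  composition is substitution, the variables of the \<open>i\<close>-th argument being shifted to the \<open>i\<close>-th block.
\<close>

definition perm_operad :: "('k::field, 'k free_perm) operad" where
  "perm_operad = \<lparr>
     ops = (\<lambda>n. module.span perm_scale {perm_word t | t. distinct (letters t) \<and> set (letters t) = {..<n}}),
     smul = perm_scale,
     act = (\<lambda>n \<sigma>. perm_eval (\<lambda>i. perm_var (inv \<sigma> i))),
     idop = perm_var 0,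
     ocomp = (\<lambda>ks p qs. perm_eval (\<lambda>i. perm_eval (\<lambda>j. perm_var (offset ks i + j)) (qs ! i)) p)\<rparr>"

definition xi :: "nat \<Rightarrow> 'k::field free_perm" where
  "xi n = foldl perm_mult (perm_var 0) (map perm_var [1..<n])"


subsection \<open>Hadamard products\<close>

definition pure_tensor :: "('k::field, 'a::ab_group_add) operad \<Rightarrow> ('k, 'b::ab_group_add) operad \<Rightarrow>
    nat \<Rightarrow> 'a \<Rightarrow> 'b \<Rightarrow> ('a \<Rightarrow> 'b \<Rightarrow> 'k) \<Rightarrow> 'k" where
  "pure_tensor P Q n = tensor (smul P) (smul Q) (ops P n) (ops Q n)"

text \<open>
  Given \<open>G\<^sub>i \<in> P(k\<^sub>i) \<otimes> Q(k\<^sub>i)\<close> and \<open>b\<close> bilinear in each pair \<open>(p\<^sub>i, q\<^sub>i)\<close>, \<open>feed [G\<^sub>1, \<dots>, G\<^sub>m] b\<close> is the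
  value on \<open>G\<^sub>1 \<otimes> \<dots> \<otimes> G\<^sub>m\<close> of the multilinear form with \<open>(p\<^sub>1 \<otimes> q\<^sub>1) \<otimes> \<dots> \<otimes> (p\<^sub>m \<otimes> q\<^sub>m) \<mapsto> b [p\<^sub>1, \<dots>, p\<^sub>m] [q\<^sub>1, \<dots>, q\<^sub>m]\<close>.
\<close>

primrec feed :: "(('a \<Rightarrow> 'b \<Rightarrow> 'k) \<Rightarrow> 'k) list \<Rightarrow> ('a list \<Rightarrow> 'b list \<Rightarrow> 'k) \<Rightarrow> 'k" where
  "feed [] b = b [] []"
| "feed (G # Gs) b = G (\<lambda>p q. feed Gs (\<lambda>ps qs. b (p # ps) (q # qs)))"

text \<open>
  In \<open>P \<otimes>\<^sub>H Q\<close> the action and the composition are the linear extensions of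
  \<open>(p \<otimes> q)\<^sup>\<sigma> = p\<^sup>\<sigma> \<otimes> q\<^sup>\<sigma>\<close> and
  \<open>(p \<otimes> q) \<circ> (p\<^sub>1 \<otimes> q\<^sub>1, \<dots>, p\<^sub>m \<otimes> q\<^sub>m) = p \<circ> (p\<^sub>1, \<dots>, p\<^sub>m) \<otimes> q \<circ> (q\<^sub>1, \<dots>, q\<^sub>m)\<close>.
  As elements of a tensor product are functionals on bilinear forms, these extensions can be
  written down directly.
\<close>

definition hadamard :: "('k::field, 'a::ab_group_add) operad \<Rightarrow> ('k, 'b::ab_group_add) operad \<Rightarrow>
    ('k, ('a \<Rightarrow> 'b \<Rightarrow> 'k) \<Rightarrow> 'k) operad" where
  "hadamard P Q = (let B = (\<lambda>n. bilinear_forms (smul P) (smul Q) (ops P n) (ops Q n)) in \<lparr>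
     ops = (\<lambda>n. tensor_product (smul P) (smul Q) (ops P n) (ops Q n)),
     smul = scale_fun (*),
     act = (\<lambda>n \<sigma> F \<beta>. if \<beta> \<in> B n then F (\<lambda>p q. \<beta> (act P n \<sigma> p) (act Q n \<sigma> q)) else 0),
     idop = pure_tensor P Q 1 (idop P) (idop Q),
     ocomp = (\<lambda>ks F Gs \<beta>. if \<beta> \<in> B (sum_list ks)
       then F (\<lambda>p q. feed Gs (\<lambda>ps qs. \<beta> (ocomp P ks p ps) (ocomp Q ks q qs))) else 0)\<rparr>)"


text \<open>
  The lemmas \<open>act_hadamard_pure_tensor\<close> and \<open>ocomp_hadamard_pure_tensor\<close> confirm these formulas
  whenever \<open>P\<close> and \<open>Q\<close> have linear actions and multilinear compositions.
\<close>

lemma pure_tensor_cong: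
  assumes "\<And>p q. p \<in> ops P k \<Longrightarrow> q \<in> ops Q k \<Longrightarrow> \<beta> p q = \<gamma> p q"
    and "module.subspace (smul P) (ops P k)" "module.subspace (smul Q) (ops Q k)"
    and "vector_space (smul P)" "vector_space (smul Q)" "p \<in> ops P k" "q \<in> ops Q k"
  shows "pure_tensor P Q k p q \<beta> = pure_tensor P Q k p q \<gamma>"
proof -
  interpret P: vector_space "smul P" by fact
  interpret Q: vector_space "smul Q" by fact
  have "\<beta> \<in> bilinear_forms (smul P) (smul Q) (ops P k) (ops Q k) \<longleftrightarrow>
    \<gamma> \<in> bilinear_forms (smul P) (smul Q) (ops P k) (ops Q k)"
    using assms(1-3) unfolding bilinear_forms_def linear_on_def P.subspace_def Q.subspace_def by simp
  with assms show ?thesis by (simp add: pure_tensor_def tensor_def)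
qed

lemma act_hadamard_pure_tensor:
  assumes "linear_on (smul P) (smul P) (ops P n) (act P n \<sigma>)" "act P n \<sigma> ` ops P n \<subseteq> ops P n"
    and "linear_on (smul Q) (smul Q) (ops Q n) (act Q n \<sigma>)" "act Q n \<sigma> ` ops Q n \<subseteq> ops Q n"
  shows "act (hadamard P Q) n \<sigma> (pure_tensor P Q n p q) =
    pure_tensor P Q n (act P n \<sigma> p) (act Q n \<sigma> q)"
proof -
  have "(\<lambda>p q. \<beta> (act P n \<sigma> p) (act Q n \<sigma> q)) \<in> bilinear_forms (smul P) (smul Q) (ops P n) (ops Q n)"
    if "\<beta> \<in> bilinear_forms (smul P) (smul Q) (ops P n) (ops Q n)" for \<beta>
    using that assms unfolding bilinear_forms_def linear_on_def by (simp add: image_subset_iff)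
  then show ?thesis
    by (auto simp: hadamard_def Let_def pure_tensor_def tensor_def)
qed

definition fits :: "('k, 'a) operad \<Rightarrow> nat list \<Rightarrow> 'a list \<Rightarrow> bool" where
  "fits P ks ps \<longleftrightarrow> list_all2 (\<lambda>k p. p \<in> ops P k) ks ps"

definition multilinear_ocomp :: "('k::field, 'a::ab_group_add) operad \<Rightarrow> nat list \<Rightarrow> bool" where
  "multilinear_ocomp P ks \<longleftrightarrow>
     vector_space (smul P) \<and> (\<forall>k. module.subspace (smul P) (ops P k)) \<and>
     (\<forall>p\<in>ops P (length ks). \<forall>ps. fits P ks ps \<longrightarrow>
        ocomp P ks p ps \<in> ops P (sum_list ks) \<and>
        linear_on (smul P) (smul P) (ops P (length ks)) (\<lambda>p. ocomp P ks p ps) \<and>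
        (\<forall>i<length ks. linear_on (smul P) (smul P) (ops P (ks ! i)) (\<lambda>x. ocomp P ks p (ps[i := x]))))"

lemma feed_pure_tensors:
  assumes "vector_space (smul P)" "\<And>k. module.subspace (smul P) (ops P k)"
    and "vector_space (smul Q)" "\<And>k. module.subspace (smul Q) (ops Q k)"
    and "fits P ks ps" "fits Q ks qs"
    and "\<And>ps qs i. fits P ks ps \<Longrightarrow> fits Q ks qs \<Longrightarrow> i < length ks \<Longrightarrow>
      (\<lambda>p q. b (ps[i := p]) (qs[i := q])) \<in> bilinear_forms (smul P) (smul Q) (ops P (ks ! i)) (ops Q (ks ! i))"
  shows "feed (map (\<lambda>(k, p, q). pure_tensor P Q k p q) (zip ks (zip ps qs))) b = b ps qs"
  using assms(5-7)
proof (induction ks arbitrary: ps qs b)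
  case Nil
  then show ?case by (simp add: fits_def)
next
  case (Cons k ks)
  then obtain p ps' q qs' where eqs: "ps = p # ps'" "qs = q # qs'"
    and p: "p \<in> ops P k" "fits P ks ps'" and q: "q \<in> ops Q k" "fits Q ks qs'"
    by (auto simp: fits_def list_all2_Cons1)
  let ?Gs = "map (\<lambda>(k, p, q). pure_tensor P Q k p q) (zip ks (zip ps' qs'))"
  have inner: "feed ?Gs (\<lambda>ps qs. b (x # ps) (y # qs)) = b (x # ps') (y # qs')"
    if "x \<in> ops P k" "y \<in> ops Q k" for x y
  proof (rule Cons.IH[OF p(2) q(2)])
    fix ps qs i
    assume "fits P ks ps" "fits Q ks qs" "i < length ks"
    then show "(\<lambda>p q. b (x # ps[i := p]) (y # qs[i := q]))
        \<in> bilinear_forms (smul P) (smul Q) (ops P (ks ! i)) (ops Q (ks ! i))"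
      using Cons.prems(3)[of "x # ps" "y # qs" "Suc i"] that by (simp add: fits_def)
  qed
  have "(\<lambda>x y. b (x # ps') (y # qs')) \<in> bilinear_forms (smul P) (smul Q) (ops P k) (ops Q k)"
    using Cons.prems(3)[of ps qs 0] Cons.prems(1,2) by (simp add: eqs)
  then have "pure_tensor P Q k p q (\<lambda>x y. b (x # ps') (y # qs')) = b ps qs"
    by (simp add: pure_tensor_def tensor_def eqs)
  moreover have "pure_tensor P Q k p q (\<lambda>x y. feed ?Gs (\<lambda>ps qs. b (x # ps) (y # qs))) =
    pure_tensor P Q k p q (\<lambda>x y. b (x # ps') (y # qs'))"
    by (rule pure_tensor_cong) (use inner assms p q in auto)
  ultimately show ?case by (simp add: eqs)
qed

lemma ocomp_hadamard_pure_tensor: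
  assumes P: "multilinear_ocomp P ks" and Q: "multilinear_ocomp Q ks"
    and p: "p \<in> ops P (length ks)" "fits P ks ps"
    and q: "q \<in> ops Q (length ks)" "fits Q ks qs"
  shows "ocomp (hadamard P Q) ks (pure_tensor P Q (length ks) p q)
      (map (\<lambda>(k, p, q). pure_tensor P Q k p q) (zip ks (zip ps qs))) =
    pure_tensor P Q (sum_list ks) (ocomp P ks p ps) (ocomp Q ks q qs)"
proof
  fix \<beta>
  let ?B = "\<lambda>n. bilinear_forms (smul P) (smul Q) (ops P n) (ops Q n)"
  let ?Gs = "map (\<lambda>(k, p, q). pure_tensor P Q k p q) (zip ks (zip ps qs))"
  show "ocomp (hadamard P Q) ks (pure_tensor P Q (length ks) p q) ?Gs \<beta> =
    pure_tensor P Q (sum_list ks) (ocomp P ks p ps) (ocomp Q ks q qs) \<beta>"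
  proof (cases "\<beta> \<in> ?B (sum_list ks)")
    case False
    then show ?thesis by (simp add: hadamard_def Let_def pure_tensor_def tensor_def)
  next
    case True
    have upd: "fits R ks (rs[i := x])" if "fits R ks rs" "i < length ks" "x \<in> ops R (ks ! i)"
      for R :: "('k, 'x) operad" and rs i x
      using that by (auto simp: fits_def list_all2_conv_all_nth nth_list_update)
    have feed: "feed ?Gs (\<lambda>ps qs. \<beta> (ocomp P ks x ps) (ocomp Q ks y qs)) =
        \<beta> (ocomp P ks x ps) (ocomp Q ks y qs)"
      if xy: "x \<in> ops P (length ks)" "y \<in> ops Q (length ks)" for x y
    proof (rule feed_pure_tensors[OF _ _ _ _ p(2) q(2)])
      fix ps qs i
      assume a: "fits P ks ps" "fits Q ks qs" "i < length ks"
      have "linear_on (smul P) (smul P) (ops P (ks ! i)) (\<lambda>z. ocomp P ks x (ps[i := z]))"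
        "linear_on (smul Q) (smul Q) (ops Q (ks ! i)) (\<lambda>z. ocomp Q ks y (qs[i := z]))"
        using P Q a xy unfolding multilinear_ocomp_def by blast+
      moreover have "ocomp P ks x (ps[i := z]) \<in> ops P (sum_list ks)" if "z \<in> ops P (ks ! i)" for z
        using P upd[OF a(1,3) that] xy(1) unfolding multilinear_ocomp_def by blast
      moreover have "ocomp Q ks y (qs[i := z]) \<in> ops Q (sum_list ks)" if "z \<in> ops Q (ks ! i)" for z
        using Q upd[OF a(2,3) that] xy(2) unfolding multilinear_ocomp_def by blast
      ultimately show "(\<lambda>p q. \<beta> (ocomp P ks x (ps[i := p])) (ocomp Q ks y (qs[i := q]))) \<in> ?B (ks ! i)"
        using True unfolding bilinear_forms_def linear_on_def by simp
    qed (use P Q in \<open>auto simp: multilinear_ocomp_def\<close>)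
    have "(\<lambda>x y. \<beta> (ocomp P ks x ps) (ocomp Q ks y qs)) \<in> ?B (length ks)"
    proof -
      have "linear_on (smul P) (smul P) (ops P (length ks)) (\<lambda>p. ocomp P ks p ps)"
        "linear_on (smul Q) (smul Q) (ops Q (length ks)) (\<lambda>q. ocomp Q ks q qs)"
        using P Q p q unfolding multilinear_ocomp_def by blast+
      moreover have "ocomp P ks x ps \<in> ops P (sum_list ks)" if "x \<in> ops P (length ks)" for x
        using P p that unfolding multilinear_ocomp_def by blast
      moreover have "ocomp Q ks x qs \<in> ops Q (sum_list ks)" if "x \<in> ops Q (length ks)" for x
        using Q q that unfolding multilinear_ocomp_def by blast
      ultimately show ?thesis
        using True unfolding bilinear_forms_def linear_on_def by simp
    qed
    moreover have "pure_tensor P Q (length ks) p q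
        (\<lambda>x y. feed ?Gs (\<lambda>ps qs. \<beta> (ocomp P ks x ps) (ocomp Q ks y qs))) =
      pure_tensor P Q (length ks) p q (\<lambda>x y. \<beta> (ocomp P ks x ps) (ocomp Q ks y qs))"
      by (rule pure_tensor_cong) (use feed P Q p q in \<open>auto simp: multilinear_ocomp_def\<close>)
    ultimately show ?thesis
      using True by (simp add: hadamard_def Let_def pure_tensor_def tensor_def)
  qed
qed


section \<open>The Chevalley--Eilenberg complex of an operad\<close>

definition inv_shuffles :: "nat \<Rightarrow> nat \<Rightarrow> (nat \<Rightarrow> nat) set" where
  "inv_shuffles i j = {\<sigma>. \<sigma> permutes {..<i + j} \<and>
     strict_mono_on {..<i} (inv \<sigma>) \<and> strict_mono_on {i..<i + j} (inv \<sigma>)}"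

definition CE :: "('k::field, 'a) operad \<Rightarrow> nat \<Rightarrow> 'a set" where
  "CE P n = {F \<in> ops P n. \<forall>\<sigma>. \<sigma> permutes {..<n} \<longrightarrow> act P n \<sigma> F = smul P (of_int (sign \<sigma>)) F}"

definition d_CE :: "('k::field, 'a::ab_group_add) operad \<Rightarrow> 'a \<Rightarrow> nat \<Rightarrow> 'a \<Rightarrow> 'a" where
  "d_CE P \<nu> n F =
     (\<Sum>\<sigma>\<in>inv_shuffles 1 n. smul P (of_int (sign \<sigma>))
        (act P (n + 1) \<sigma> (ocomp P [1, n] \<nu> [idop P, F]))) -
     (\<Sum>\<sigma>\<in>inv_shuffles 2 (n - 1). smul P (of_int (sign \<sigma>))
        (act P (n + 1) \<sigma> (ocomp P (2 # replicate (n - 1) 1) F (\<nu> # replicate (n - 1) (idop P)))))"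


section \<open>Pre-Lie algebras\<close>

locale pre_lie_algebra = vector_space scale
  for scale :: "'k::field \<Rightarrow> 'v::ab_group_add \<Rightarrow> 'v" +
  fixes dia :: "'v \<Rightarrow> 'v \<Rightarrow> 'v" (infixl \<open>\<diamond>\<close> 70)
  assumes linear_left: "Vector_Spaces.linear scale scale (\<lambda>x. x \<diamond> y)"
    and linear_right: "Vector_Spaces.linear scale scale (\<lambda>y. x \<diamond> y)"
    and pre_lie: "(x \<diamond> y) \<diamond> z - x \<diamond> (y \<diamond> z) = (y \<diamond> x) \<diamond> z - y \<diamond> (x \<diamond> z)"

text \<open>\<open>Hom(\<Lambda>\<^sup>n\<^sup>-\<^sup>1 \<gg> \<otimes> \<gg>, \<gg>)\<close>: the \<open>n\<close>-linear maps that are alternating in the first \<open>n - 1\<close> arguments.\<close>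

definition pLie_cochains :: "('k::field \<Rightarrow> 'v \<Rightarrow> 'v) \<Rightarrow> nat \<Rightarrow> ('v list \<Rightarrow> 'v::ab_group_add) set" where
  "pLie_cochains scale n = {f \<in> multilinear_maps scale n.
     \<forall>xs i j. length xs = n \<longrightarrow> i < j \<longrightarrow> j < n - 1 \<longrightarrow> xs ! i = xs ! j \<longrightarrow> f xs = 0}"

text \<open>
  In \<open>d_pLie dia n f xs\<close>, the arguments are \<open>x\<^sub>0, \<dots>, x\<^bsub>n-1\<^esub>; x\<^sub>n\<close>, and \<open>nths xs ({..<n} - {i})\<close> is the list
  \<open>x\<^sub>0, \<dots>, x\<^bsub>n-1\<^esub>\<close> without \<open>x\<^sub>i\<close>.
\<close>

definition d_pLie :: "('k::field \<Rightarrow> 'v \<Rightarrow> 'v) \<Rightarrow> ('v \<Rightarrow> 'v \<Rightarrow> 'v) \<Rightarrow>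
    nat \<Rightarrow> ('v list \<Rightarrow> 'v::ab_group_add) \<Rightarrow> 'v list \<Rightarrow> 'v" where
  "d_pLie scale dia n f xs = (if length xs = n + 1 then
     (\<Sum>i<n. scale ((- 1) ^ i) (dia (xs ! i) (f (nths xs ({..<n} - {i}) @ [xs ! n])))) +
     (\<Sum>i<n. scale ((- 1) ^ i) (dia (f (nths xs ({..<n} - {i}) @ [xs ! i])) (xs ! n))) +
     (\<Sum>i<n. scale ((- 1) ^ (i + 1)) (f (nths xs ({..<n} - {i}) @ [dia (xs ! i) (xs ! n)]))) +
     (\<Sum>j<n. \<Sum>i<j. scale ((- 1) ^ (i + j))
        (f ((dia (xs ! i) (xs ! j) - dia (xs ! j) (xs ! i)) # nths xs ({..<n} - {i, j}) @ [xs ! n])))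
   else 0)"


section \<open>The comparison map\<close>

abbreviation perm_end ::
    "('k::field \<Rightarrow> 'v \<Rightarrow> 'v) \<Rightarrow> ('k, ('k free_perm \<Rightarrow> ('v list \<Rightarrow> 'v::ab_group_add) \<Rightarrow> 'k) \<Rightarrow> 'k) operad" where
  "perm_end scale \<equiv> hadamard perm_operad (end_operad scale)"

definition omega :: "('v \<Rightarrow> 'v \<Rightarrow> 'v) \<Rightarrow> 'v list \<Rightarrow> 'v::zero" where
  "omega dia xs = (if length xs = 2 then dia (xs ! 0) (xs ! 1) else 0)"

definition alpha_nu :: "('k::field \<Rightarrow> 'v \<Rightarrow> 'v) \<Rightarrow> ('v \<Rightarrow> 'v \<Rightarrow> 'v) \<Rightarrow>
    ('k free_perm \<Rightarrow> ('v list \<Rightarrow> 'v::ab_group_add) \<Rightarrow> 'k) \<Rightarrow> 'k" where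
  "alpha_nu scale dia =
     pure_tensor perm_operad (end_operad scale) 2 (xi 2) (omega dia) -
     pure_tensor perm_operad (end_operad scale) 2
       (act perm_operad 2 (transpose 0 1) (xi 2)) (act (end_operad scale) 2 (transpose 0 1) (omega dia))"

text \<open>The element \<open>\<Sum>\<^sub>\<sigma> \<xi>\<^sub>n\<^sup>\<sigma> \<otimes> f\<^sub>\<sigma>\<close>, with \<open>\<sigma>\<close> ranging over \<open>Sh\<^sup>-\<^sup>1(n - 1, 1)\<close>.\<close>

definition xi_sum :: "('k::field \<Rightarrow> 'v \<Rightarrow> 'v) \<Rightarrow> nat \<Rightarrow> ((nat \<Rightarrow> nat) \<Rightarrow> 'v list \<Rightarrow> 'v) \<Rightarrow>
    ('k free_perm \<Rightarrow> ('v list \<Rightarrow> 'v::ab_group_add) \<Rightarrow> 'k) \<Rightarrow> 'k" where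
  "xi_sum scale n f = (\<Sum>\<sigma>\<in>inv_shuffles (n - 1) 1.
     pure_tensor perm_operad (end_operad scale) n (act perm_operad n \<sigma> (xi n)) (f \<sigma>))"

definition Omega :: "('k::field \<Rightarrow> 'v \<Rightarrow> 'v) \<Rightarrow> nat \<Rightarrow>
    (('k free_perm \<Rightarrow> ('v list \<Rightarrow> 'v::ab_group_add) \<Rightarrow> 'k) \<Rightarrow> 'k) \<Rightarrow> 'v list \<Rightarrow> 'v" where
  "Omega scale n F = (THE g. \<exists>f. (\<forall>\<sigma>\<in>inv_shuffles (n - 1) 1. f \<sigma> \<in> ops (end_operad scale) n) \<and>
     F = xi_sum scale n f \<and> g = f id)"

end

theory Submission
  imports Defs "HOL-Library.Multiset"
begin

text \<open>
  Write \<open>m\<^sub>i \<in> Perm(n)\<close> for the monomial \<open>x\<^sub>0 \<cdots> x\<^bsub>n-1\<^esub>\<close> with the factor \<open>x\<^sub>i\<close> moved to the end. These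
  monomials form a basis, so an element of \<open>Perm(n) \<otimes> Hom(\<gg>\<^sup>\<otimes>\<^sup>n, \<gg>)\<close> is a family \<open>(G\<^sub>i)\<close> of \<open>n\<close>-linear maps.
  Skew-symmetry of the element determines all the \<open>G\<^sub>i\<close> from the last one, which may be any map that
  alternates in its first \<open>n - 1\<close> arguments. This last map is the value of \<open>\<Omega>\<close>, so
  \<open>\<Omega>\<close> is bijective, and it intertwines the differentials because the last component of
  \<open>d\<^sub>C\<^sub>E\<close> can be read off from the shuffles, the sum over which is skew-symmetric since shuffles
  represent cosets. Finally \<open>d\<^sub>p\<^sub>L\<^sub>i\<^sub>e\<close> squares to zero because it is a Chevalley--Eilenberg differential
  of the commutator Lie algebra with coefficients in \<open>Hom(\<gg>, \<gg>)\<close>, and \<open>\<Omega>\<close> transports this to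
  \<open>d\<^sub>C\<^sub>E\<close>.
\<close>

section \<open>Multilinear maps\<close>

text \<open>Iterating the explicit formula for \<open>d_pLie\<close> would produce double sums over
  omitted positions; the recursion \<open>cobd\<close> avoids them. With i_x for insertion of x as
  first argument, the recursions read i_x d = L_x - d i_x and i_y L_x = L_x i_y - i_[x,y], and d d =
  0 follows by induction on the number of arguments from [L_x, L_y] = L_[x,y] and L_x d = d L_x.
  Unrolling the recursion recovers the explicit sum; alternation is what allows the brackets to be
  moved to the front there. On the operadic side the obstacle is that a tensor is a functional which
  returns 0 on forms that are not bilinear on the given subspaces, so each evaluation of a composite
  needs a proof of bilinearity in the slot concerned. Uniqueness of the components G_i rests on the
  linear independence of the m_i, detected by \<open>perm_coeff\<close>. Characteristic 0 enters
  where skew-symmetry is turned into vanishing on equal arguments.\<close>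

locale multilinear_operations = vector_space scale
  for scale :: "'k::field \<Rightarrow> 'v::ab_group_add \<Rightarrow> 'v"
begin

lemma linearI:
  assumes "\<And>u v. h (u + v) = h u + h v" "\<And>c u. h (scale c u) = scale c (h u)"
  shows "Vector_Spaces.linear scale scale h"
  using assms by unfold_locales

lemma linearD:
  assumes "Vector_Spaces.linear scale scale h"
  shows "h (u + v) = h u + h v" "h (u - v) = h u - h v" "h (scale c u) = scale c (h u)"
    "h 0 = 0" "h (- u) = - h u"
proof -
  interpret Vector_Spaces.linear scale scale h by fact
  show "h (u + v) = h u + h v" "h (u - v) = h u - h v" "h (scale c u) = scale c (h u)"
    "h 0 = 0" "h (- u) = - h u"
    by (fact add diff scale zero neg)+
qed

text \<open>No arity is fixed: a cochain vanishes on lists of the wrong length, so linearity can be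
  asked in every position of every list. Splitting a list as \<open>as @ u # bs\<close> suits
  recursion better than positions do.\<close>

definition multilin :: "('v list \<Rightarrow> 'v) \<Rightarrow> bool" where
  "multilin f \<longleftrightarrow> (\<forall>as bs. Vector_Spaces.linear scale scale (\<lambda>u. f (as @ u # bs)))"

text \<open>\<open>bs \<noteq> []\<close> exempts the last argument, which is the argument of the
  coefficient in Hom(g, g). Neighbouring entries suffice, by
  \<open>alternating_apart\<close>.\<close>

definition alternating :: "('v list \<Rightarrow> 'v) \<Rightarrow> bool" where
  "alternating f \<longleftrightarrow> (\<forall>as u bs. bs \<noteq> [] \<longrightarrow> f (as @ u # u # bs) = 0)"

lemma multilinD:
  assumes "multilin f"
  shows "f (as @ (u + v) # bs) = f (as @ u # bs) + f (as @ v # bs)"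
    "f (as @ (u - v) # bs) = f (as @ u # bs) - f (as @ v # bs)"
    "f (as @ scale c u # bs) = scale c (f (as @ u # bs))"
    "f (as @ 0 # bs) = 0"
  using assms linearD[of "\<lambda>u. f (as @ u # bs)"] unfolding multilin_def by blast+

lemmas multilinD_hd = multilinD[where as = "[]", simplified]

lemma multilin_Cons: "multilin f \<Longrightarrow> multilin (\<lambda>ws. f (y # ws))"
  using spec[of "\<lambda>as. \<forall>bs. Vector_Spaces.linear scale scale (\<lambda>u. f (as @ u # bs))" "y # _"]
  by (auto simp: multilin_def)

lemma alternating_Cons: "alternating f \<Longrightarrow> alternating (\<lambda>ws. f (y # ws))"
  using spec[of "\<lambda>as. \<forall>u bs. bs \<noteq> [] \<longrightarrow> f (as @ u # u # bs) = 0" "y # _"]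
  by (auto simp: alternating_def)

text \<open>Polarisation: expand the vanishing value at two neighbouring entries
  \<open>u + v\<close>.\<close>

lemma alternating_swap:
  assumes "multilin f" "alternating f" "bs \<noteq> []"
  shows "f (as @ u # v # bs) = - f (as @ v # u # bs)"
proof -
  have "f (as @ (u + v) # (u + v) # bs) = 0"
    using assms(2,3) by (simp add: alternating_def)
  moreover have "f (as @ x # (u + v) # bs) = f (as @ x # u # bs) + f (as @ x # v # bs)" for x
    using multilinD(1)[OF assms(1), of "as @ [x]"] by simp
  moreover have "f (as @ u # u # bs) = 0" "f (as @ v # v # bs) = 0"
    using assms(2,3) by (simp_all add: alternating_def)
  ultimately show ?thesis
    by (simp add: multilinD(1)[OF assms(1)] add_eq_0_iff2)
qed

lemmas alternating_swap_hd = alternating_swap[where as = "[]", simplified]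

lemma multilinear_mapsD:
  assumes "f \<in> multilinear_maps scale n"
  shows "multilin f" "length xs \<noteq> n \<Longrightarrow> f xs = 0"
proof -
  have "Vector_Spaces.linear scale scale (\<lambda>u. f (as @ u # bs))" for as bs
  proof (cases "length (as @ undefined # bs) = n")
    case True
    then have "Vector_Spaces.linear scale scale (\<lambda>v. f ((as @ undefined # bs)[length as := v]))"
      using assms unfolding multilinear_maps_def mem_Collect_eq
      by (elim conjE allE[of _ "as @ undefined # bs"] allE[of _ "length as"]) auto
    then show ?thesis by simp
  next
    case False
    with assms have "f (as @ u # bs) = 0" for u by (simp add: multilinear_maps_def)
    then show ?thesis by (intro linearI) simp_all
  qed
  then show "multilin f" by (simp add: multilin_def)
qed (use assms in \<open>simp add: multilinear_maps_def\<close>)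

lemma multilinear_mapsI:
  assumes "multilin f" "\<And>xs. length xs \<noteq> n \<Longrightarrow> f xs = 0"
  shows "f \<in> multilinear_maps scale n"
  using assms by (simp add: multilinear_maps_def multilin_def upd_conv_take_nth_drop)

text \<open>Neighbour swaps carry the first \<open>u\<close> to the right past \<open>bs\<close>,
  changing only the sign, until it meets the second one.\<close>

lemma alternating_apart:
  assumes "multilin f" "alternating f" "cs \<noteq> []"
  shows "f (as @ u # bs @ u # cs) = 0"
proof (induction bs arbitrary: as)
  case Nil
  then show ?case using assms by (simp add: alternating_def)
next
  case (Cons b bs)
  then show ?case
    using alternating_swap[OF assms(1,2), of "bs @ u # cs" as u b] Cons[of "as @ [b]"] by simp
qed

text \<open>From right to left, the list is cut at the two positions and
  \<open>alternating_apart\<close> applies; \<open>j < n - 1\<close> makes the last piece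
  nonempty.\<close>

lemma pLie_cochains_iff:
  "f \<in> pLie_cochains scale n \<longleftrightarrow> f \<in> multilinear_maps scale n \<and> alternating f"
proof (intro iffI conjI; (elim conjE)?)
  assume f: "f \<in> pLie_cochains scale n"
  then show m: "f \<in> multilinear_maps scale n" by (simp add: pLie_cochains_def)
  show "alternating f"
    unfolding alternating_def
  proof (intro allI impI)
    fix as u and bs :: "'v list"
    assume "bs \<noteq> []"
    then have "length as + 1 < length (as @ u # u # bs) - 1" by (cases bs) auto
    then have "length (as @ u # u # bs) = n \<Longrightarrow> f (as @ u # u # bs) = 0"
      using f unfolding pLie_cochains_def mem_Collect_eq
      by (elim conjE allE[of _ "as @ u # u # bs"] allE[of _ "length as"] allE[of _ "length as + 1"])
        (simp add: nth_append)
    then show "f (as @ u # u # bs) = 0" using multilinear_mapsD(2)[OF m] by blast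
  qed
next
  assume m: "f \<in> multilinear_maps scale n" and a: "alternating f"
  have "f xs = 0" if "length xs = n" "i < j" "j < n - 1" "xs ! i = xs ! j" for xs i j
  proof -
    have "xs = take i xs @ xs ! i # take (j - Suc i) (drop (Suc i) xs) @ xs ! j # drop (Suc j) xs"
      (is "xs = ?r")
    proof -
      have "xs = take i xs @ xs ! i # drop (Suc i) xs" using that by (intro id_take_nth_drop) simp
      moreover have "drop (Suc i) xs = take (j - Suc i) (drop (Suc i) xs) @ xs ! j # drop (Suc j) xs"
        using that id_take_nth_drop[of "j - Suc i" "drop (Suc i) xs"] by simp
      ultimately show ?thesis by simp
    qed
    moreover have "f ?r = 0"
      using alternating_apart[OF multilinear_mapsD(1)[OF m] a, of "drop (Suc j) xs" "take i xs" "xs ! j"] that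
      by simp
    ultimately show ?thesis by simp
  qed
  with m show "f \<in> pLie_cochains scale n" by (simp add: pLie_cochains_def)
qed

lemma vector_space_fun: "vector_space (scale_fun scale :: _ \<Rightarrow> ('x \<Rightarrow> 'v) \<Rightarrow> _)"
  by (rule vector_space_scale_fun) unfold_locales

lemma subspace_multilinear_maps: "module.subspace (scale_fun scale) (multilinear_maps scale n)"
proof -
  interpret F: vector_space "scale_fun scale :: _ \<Rightarrow> ('v list \<Rightarrow> 'v) \<Rightarrow> _" by (rule vector_space_fun)
  show ?thesis
    unfolding F.subspace_def
    by (auto intro!: multilinear_mapsI linearI
        simp: multilinear_mapsD(2) multilin_def scale_fun_def linearD[OF multilinear_mapsD(1)[unfolded multilin_def, rule_format]]
        scale_right_distrib algebra_simps)
qed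

lemma subspace_pLie_cochains: "module.subspace (scale_fun scale) (pLie_cochains scale n)"
proof -
  interpret F: vector_space "scale_fun scale :: _ \<Rightarrow> ('v list \<Rightarrow> 'v) \<Rightarrow> _" by (rule vector_space_fun)
  show ?thesis
    using subspace_multilinear_maps[of n] unfolding F.subspace_def
    by (auto simp: pLie_cochains_iff alternating_def scale_fun_def)
qed

end

sublocale pre_lie_algebra \<subseteq> multilinear_operations
  by unfold_locales

section \<open>The pre-Lie complex\<close>

text \<open>The omission of x_i as an operation that recurses on the list, so that sums over omitted
  positions can be split at the head.\<close>

definition del :: "nat \<Rightarrow> 'a list \<Rightarrow> 'a list" where
  "del i xs = take i xs @ drop (Suc i) xs"

lemma del_simps [simp]:
  "del 0 (x # xs) = xs" "del (Suc i) (x # xs) = x # del i xs" "del i [] = []"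
  by (simp_all add: del_def)

lemma length_del [simp]: "i < length xs \<Longrightarrow> length (del i xs) = length xs - 1"
  by (simp add: del_def)

lemma nths_remove1: "nths xs ({..<length xs} - {i}) = del i xs"
proof (induction xs arbitrary: i)
  case (Cons x xs)
  show ?case
  proof (cases i)
    case 0
    have "{j. Suc j \<in> {..<length (x # xs)} - {i}} = {..<length xs}"
      using 0 by auto
    then show ?thesis using 0 by (simp add: nths_Cons nths_all)
  next
    case (Suc k)
    have "{j. Suc j \<in> {..<length (x # xs)} - {i}} = {..<length xs} - {k}"
      using Suc by auto
    then show ?thesis using Suc Cons by (simp add: nths_Cons)
  qed
qed simp

text \<open>The larger index is removed first, so that the smaller one still points to the same
  entry.\<close>

lemma nths_remove2:
  "i < j \<Longrightarrow> nths xs ({..<length xs} - {i, j}) = del i (del j xs)"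
proof (induction xs arbitrary: i j)
  case (Cons x xs)
  then obtain l where j: "j = Suc l" by (cases j) auto
  show ?case
  proof (cases i)
    case 0
    have "{j. Suc j \<in> {..<length (x # xs)} - {i, Suc l}} = {..<length xs} - {l}"
      using 0 by auto
    then show ?thesis using 0 j by (simp add: nths_Cons nths_remove1)
  next
    case (Suc k)
    have "{j. Suc j \<in> {..<length (x # xs)} - {i, Suc l}} = {..<length xs} - {k, l}"
      using Suc by auto
    then show ?thesis using Suc j Cons by (simp add: nths_Cons)
  qed
qed simp

lemma nths_append_lessThan: "A \<subseteq> {..<length xs} \<Longrightarrow> nths (xs @ ys) A = nths xs A"
proof -
  assume "A \<subseteq> {..<length xs}"
  then have "{j. j + length xs \<in> A} = {}" by auto
  then show ?thesis by (simp add: nths_append)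
qed

context pre_lie_algebra
begin

lemma diamond_linear:
  "(x + y) \<diamond> z = x \<diamond> z + y \<diamond> z" "z \<diamond> (x + y) = z \<diamond> x + z \<diamond> y"
  "(x - y) \<diamond> z = x \<diamond> z - y \<diamond> z" "z \<diamond> (x - y) = z \<diamond> x - z \<diamond> y"
  "scale c x \<diamond> z = scale c (x \<diamond> z)" "z \<diamond> scale c x = scale c (z \<diamond> x)"
  "0 \<diamond> z = 0" "z \<diamond> 0 = 0" "(- x) \<diamond> z = - (x \<diamond> z)" "z \<diamond> (- x) = - (z \<diamond> x)"
proof -
  interpret l: Vector_Spaces.linear scale scale "\<lambda>x. x \<diamond> z" by (rule linear_left)
  interpret r: Vector_Spaces.linear scale scale "\<lambda>x. z \<diamond> x" by (rule linear_right)
  show "(x + y) \<diamond> z = x \<diamond> z + y \<diamond> z" "z \<diamond> (x + y) = z \<diamond> x + z \<diamond> y"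
    "(x - y) \<diamond> z = x \<diamond> z - y \<diamond> z" "z \<diamond> (x - y) = z \<diamond> x - z \<diamond> y"
    "scale c x \<diamond> z = scale c (x \<diamond> z)" "z \<diamond> scale c x = scale c (z \<diamond> x)"
    "0 \<diamond> z = 0" "z \<diamond> 0 = 0" "(- x) \<diamond> z = - (x \<diamond> z)" "z \<diamond> (- x) = - (z \<diamond> x)"
    by (fact l.add r.add l.diff r.diff l.scale r.scale l.zero r.zero l.neg r.neg)+
qed

section \<open>The commutator Lie algebra and its Cartan calculus with coefficients in Hom(g,
  g)\<close>

definition bracket :: "'v \<Rightarrow> 'v \<Rightarrow> 'v" where
  "bracket x y = x \<diamond> y - y \<diamond> x"

lemma bracket_linear:
  "bracket (x + y) z = bracket x z + bracket y z" "bracket z (x + y) = bracket z x + bracket z y"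
  "bracket (scale c x) z = scale c (bracket x z)" "bracket z (scale c x) = scale c (bracket z x)"
  by (simp_all add: bracket_def diamond_linear scale_right_diff_distrib algebra_simps)

lemma bracket_self [simp]: "bracket x x = 0"
  by (simp add: bracket_def)

text \<open>The pre-Lie identity rearranged: left multiplication is a representation of the
  commutator bracket.\<close>

lemma bracket_diamond: "bracket x y \<diamond> z = x \<diamond> (y \<diamond> z) - y \<diamond> (x \<diamond> z)"
  using pre_lie[of x y z] by (simp add: bracket_def diamond_linear algebra_simps)

text \<open>Once the outer brackets are expanded, \<open>bracket_diamond\<close> turns every product
  whose left factor is a bracket into right-nested products, and all terms cancel.\<close>

lemma jacobi: "bracket x (bracket y z) - bracket y (bracket x z) = bracket (bracket x y) z"
proof -
  have "bracket x (bracket y z) - bracket y (bracket x z) - bracket (bracket x y) z =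
    - (bracket y z \<diamond> x) + bracket x z \<diamond> y - bracket x y \<diamond> z
    + x \<diamond> bracket y z - y \<diamond> bracket x z + z \<diamond> bracket x y"
    by (simp add: bracket_def[of x "bracket y z"] bracket_def[of y "bracket x z"]
        bracket_def[of "bracket x y" z] algebra_simps)
  also have "\<dots> = 0"
    unfolding bracket_diamond by (simp add: bracket_def diamond_linear algebra_simps)
  finally show ?thesis by simp
qed

text \<open>
  The Lie algebra \<open>\<gg>\<close> acts on \<open>Hom(\<gg>, \<gg>)\<close> by \<open>(x \<cdot> \<phi>)(z) = x \<diamond> \<phi>(z) + \<phi>(x) \<diamond> z - \<phi>(x \<diamond> z)\<close>, and the
  pre-Lie complex is the Chevalley--Eilenberg complex with these coefficients; the last entry of a
  list is the argument \<open>z\<close> of the coefficient. \<open>lie_deriv\<close> is the Lie derivative, and the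
  differential \<open>cobd\<close> is given by Cartan's formula, as a recursion on the number of arguments.
\<close>

fun lie_deriv :: "'v \<Rightarrow> ('v list \<Rightarrow> 'v) \<Rightarrow> 'v list \<Rightarrow> 'v" where
  "lie_deriv x f [] = 0"
| "lie_deriv x f [z] = x \<diamond> f [z] + f [x] \<diamond> z - f [x \<diamond> z]"
| "lie_deriv x f (y # z # zs) =
    lie_deriv x (\<lambda>ws. f (y # ws)) (z # zs) - f (bracket x y # z # zs)"

fun cobd :: "('v list \<Rightarrow> 'v) \<Rightarrow> 'v list \<Rightarrow> 'v" where
  "cobd f [] = 0"
| "cobd f [z] = 0"
| "cobd f (x # z # zs) = lie_deriv x f (z # zs) - cobd (\<lambda>ws. f (x # ws)) (z # zs)"

text \<open>The defining equation with a variable for the nonempty tail, so that it also applies to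
  tails such as \<open>as @ u # bs\<close>.\<close>

lemma lie_deriv_Cons:
  "ws \<noteq> [] \<Longrightarrow> lie_deriv x f (y # ws) = lie_deriv x (\<lambda>ws. f (y # ws)) ws - f (bracket x y # ws)"
  by (cases ws) auto

lemma cobd_Cons:
  "ws \<noteq> [] \<Longrightarrow> cobd f (x # ws) = lie_deriv x f ws - cobd (\<lambda>ws. f (x # ws)) ws"
  by (cases ws) auto

text \<open>The derivative evaluates \<open>f\<close> on nonempty lists of unchanged length only.
  This permits rewriting under the operator with \<open>lie_deriv_Cons\<close>, whose condition
  excludes the empty tail.\<close>

lemma lie_deriv_cong:
  "(\<And>ws. ws \<noteq> [] \<Longrightarrow> length ws = length xs \<Longrightarrow> f ws = g ws) \<Longrightarrow> lie_deriv x f xs = lie_deriv x g xs"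
proof (induction x f xs arbitrary: g rule: lie_deriv.induct)
  case (3 x f y z zs)
  have "lie_deriv x (\<lambda>ws. f (y # ws)) (z # zs) = lie_deriv x (\<lambda>ws. g (y # ws)) (z # zs)"
    by (rule 3) (simp add: 3)
  then show ?case by (simp add: 3)
qed auto

lemma cobd_cong:
  "(\<And>ws. ws \<noteq> [] \<Longrightarrow> Suc (length ws) = length xs \<Longrightarrow> f ws = g ws) \<Longrightarrow> cobd f xs = cobd g xs"
proof (induction f xs arbitrary: g rule: cobd.induct)
  case (3 f x z zs)
  have "cobd (\<lambda>ws. f (x # ws)) (z # zs) = cobd (\<lambda>ws. g (x # ws)) (z # zs)"
    by (rule 3) (simp add: 3)
  moreover have "lie_deriv x f (z # zs) = lie_deriv x g (z # zs)"
    by (rule lie_deriv_cong) (simp add: 3)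
  ultimately show ?case by simp
qed auto

lemma lie_deriv_fun:
  "lie_deriv x (\<lambda>ws. f ws + g ws) xs = lie_deriv x f xs + lie_deriv x g xs"
  "lie_deriv x (\<lambda>ws. f ws - g ws) xs = lie_deriv x f xs - lie_deriv x g xs"
  "lie_deriv x (\<lambda>ws. scale c (f ws)) xs = scale c (lie_deriv x f xs)"
  "lie_deriv x (\<lambda>ws. 0) xs = 0"
     apply (induction x f xs arbitrary: g rule: lie_deriv.induct)
               apply (simp_all add: diamond_linear scale_right_distrib scale_right_diff_distrib)
  done

lemma cobd_fun:
  "cobd (\<lambda>ws. f ws + g ws) xs = cobd f xs + cobd g xs"
  "cobd (\<lambda>ws. f ws - g ws) xs = cobd f xs - cobd g xs"
  "cobd (\<lambda>ws. scale c (f ws)) xs = scale c (cobd f xs)"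
  "cobd (\<lambda>ws. 0) xs = 0"
     apply (induction f xs arbitrary: g rule: cobd.induct)
               apply (simp_all add: lie_deriv_fun scale_right_diff_distrib)
  done

lemma lie_deriv_linear:
  assumes "multilin f"
  shows "lie_deriv (x + y) f xs = lie_deriv x f xs + lie_deriv y f xs"
    "lie_deriv (scale c x) f xs = scale c (lie_deriv x f xs)"
  using assms
  by (induction x f xs rule: lie_deriv.induct)
    (simp_all add: diamond_linear bracket_linear multilinD_hd multilin_Cons
      scale_right_distrib scale_right_diff_distrib algebra_simps)

lemma multilin_lie_deriv: "multilin f \<Longrightarrow> multilin (lie_deriv x f)"
proof -
  have "Vector_Spaces.linear scale scale (\<lambda>u. lie_deriv x f (as @ u # bs))" if "multilin f" for as bs
    using that
  proof (induction as arbitrary: f)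
    case Nil
    then show ?case
      by (cases bs; intro linearI)
        (simp_all add: multilinD_hd diamond_linear bracket_linear lie_deriv_fun
          scale_right_distrib scale_right_diff_distrib algebra_simps)
  next
    case (Cons a as)
    note IH = linearD[OF Cons.IH[OF multilin_Cons[OF Cons.prems]]]
    note m = multilinD[OF Cons.prems, where as = "_ # as", simplified]
    show ?case
      by (intro linearI) (simp_all add: lie_deriv_Cons IH m scale_right_diff_distrib algebra_simps)
  qed
  then show "multilin f \<Longrightarrow> multilin (lie_deriv x f)" by (simp add: multilin_def)
qed

lemma multilin_cobd: "multilin f \<Longrightarrow> multilin (cobd f)"
proof -
  have "Vector_Spaces.linear scale scale (\<lambda>u. cobd f (as @ u # bs))" if "multilin f" for as bs
    using that
  proof (induction as arbitrary: f)
    case Nil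
    then show ?case
      by (cases bs; intro linearI)
        (simp_all add: multilinD_hd lie_deriv_linear cobd_fun scale_right_diff_distrib algebra_simps)
  next
    case (Cons a as)
    note IH = linearD[OF Cons.IH[OF multilin_Cons[OF Cons.prems]]]
    note m = multilinD[OF multilin_lie_deriv[OF Cons.prems]]
    show ?case
      by (intro linearI) (simp_all add: cobd_Cons IH m scale_right_diff_distrib algebra_simps)
  qed
  then show "multilin f \<Longrightarrow> multilin (cobd f)" by (simp add: multilin_def)
qed

text \<open>On one argument this says that Hom(g, g) is a module over the commutator Lie algebra, by
  the pre-Lie identity; each further argument contributes a Jacobi identity.\<close>

lemma lie_deriv_commutator:
  "multilin f \<Longrightarrow>
    lie_deriv x (lie_deriv y f) xs - lie_deriv y (lie_deriv x f) xs = lie_deriv (bracket x y) f xs"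
proof (induction "bracket x y" f xs rule: lie_deriv.induct)
  case (2 f z)
  have *: "(x \<diamond> w) \<diamond> z - x \<diamond> (w \<diamond> z) = (w \<diamond> x) \<diamond> z - w \<diamond> (x \<diamond> z)" for x w
    by (rule pre_lie)
  note f = multilinD_hd[OF 2]
  have "f [x \<diamond> (y \<diamond> z)] - f [y \<diamond> (x \<diamond> z)] = f [bracket x y \<diamond> z]"
    unfolding bracket_diamond f ..
  moreover have "f [x \<diamond> y] - f [y \<diamond> x] = f [bracket x y]"
    by (simp add: bracket_def f)
  moreover have "x \<diamond> (y \<diamond> f [z]) - y \<diamond> (x \<diamond> f [z]) = bracket x y \<diamond> f [z]"
    by (simp add: bracket_diamond)
  \<comment> \<open>Here values of \<open>f\<close> themselves enter the pre-Lie identity: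
    \<open>f [y]\<close> paired with \<open>x\<close>, and \<open>f [x]\<close> paired with
    \<open>y\<close>.\<close>
  moreover have "f [y] \<diamond> (x \<diamond> z) + (x \<diamond> f [y]) \<diamond> z = x \<diamond> (f [y] \<diamond> z) + (f [y] \<diamond> x) \<diamond> z"
    "f [x] \<diamond> (y \<diamond> z) + (y \<diamond> f [x]) \<diamond> z = y \<diamond> (f [x] \<diamond> z) + (f [x] \<diamond> y) \<diamond> z"
    using *[of x "f [y]"] *[of y "f [x]"] by (simp_all add: algebra_simps)
  note arg_cong2[where f = "(+)", OF this(1)[symmetric] this(2)]
  ultimately show ?case
    by (simp add: diamond_linear algebra_simps flip: \<open>f [x \<diamond> y] - f [y \<diamond> x] = f [bracket x y]\<close>)
next
  case (3 f w z zs)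
  let ?f = "\<lambda>ws. f (w # ws)"
  \<comment> \<open>The two middle terms are exchanged by swapping \<open>x\<close> and
    \<open>y\<close>, so they cancel in the commutator.\<close>
  have L: "lie_deriv x (lie_deriv y f) (w # z # zs) =
      lie_deriv x (lie_deriv y ?f) (z # zs) - lie_deriv x (\<lambda>ws. f (bracket y w # ws)) (z # zs)
      - lie_deriv y (\<lambda>ws. f (bracket x w # ws)) (z # zs) + f (bracket y (bracket x w) # z # zs)" for x y
  proof -
    have "lie_deriv x (\<lambda>ws. lie_deriv y f (w # ws)) (z # zs) =
      lie_deriv x (\<lambda>ws. lie_deriv y ?f ws - f (bracket y w # ws)) (z # zs)"
      by (rule lie_deriv_cong) (simp add: lie_deriv_Cons)
    then show ?thesis by (simp add: lie_deriv_fun)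
  qed
  have "f (bracket x (bracket y w) # z # zs) - f (bracket y (bracket x w) # z # zs) =
    f (bracket (bracket x y) w # z # zs)"
    by (simp flip: jacobi add: multilinD_hd[OF 3(2)])
  with 3(1)[OF multilin_Cons[OF 3(2)]] show ?case
    unfolding L by (simp add: algebra_simps)
qed simp

text \<open>Inserting \<open>w\<close> on both sides leaves, besides the induction hypothesis for
  f(w, ...), exactly the commutator identity for L_x and L_w.\<close>

lemma lie_deriv_cobd:
  "multilin f \<Longrightarrow> lie_deriv x (cobd f) xs = cobd (lie_deriv x f) xs"
proof (induction f xs rule: cobd.induct)
  case (3 f w z zs)
  let ?f = "\<lambda>ws. f (w # ws)"
  have 1: "lie_deriv x (\<lambda>ws. cobd f (w # ws)) (z # zs) =
      lie_deriv x (lie_deriv w f) (z # zs) - lie_deriv x (cobd ?f) (z # zs)"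
  proof -
    have "lie_deriv x (\<lambda>ws. cobd f (w # ws)) (z # zs) =
      lie_deriv x (\<lambda>ws. lie_deriv w f ws - cobd ?f ws) (z # zs)"
      by (rule lie_deriv_cong) (simp add: cobd_Cons)
    then show ?thesis by (simp add: lie_deriv_fun)
  qed
  have 2: "cobd (\<lambda>ws. lie_deriv x f (w # ws)) (z # zs) =
      cobd (lie_deriv x ?f) (z # zs) - cobd (\<lambda>ws. f (bracket x w # ws)) (z # zs)"
  proof -
    have "cobd (\<lambda>ws. lie_deriv x f (w # ws)) (z # zs) =
      cobd (\<lambda>ws. lie_deriv x ?f ws - f (bracket x w # ws)) (z # zs)"
      by (rule cobd_cong) (simp add: lie_deriv_Cons)
    then show ?thesis by (simp add: cobd_fun)
  qed
  show ?case
    using 3(1)[OF multilin_Cons[OF 3(2)]] lie_deriv_commutator[OF 3(2), of x w "z # zs"]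
    by (simp add: 1 2 algebra_simps)
qed (simp_all add: diamond_linear)

text \<open>With i_x f = f(x, ...), inserting \<open>x\<close> gives L_x d f - d (L_x f - d i_x f).
  The Lie derivatives cancel by \<open>lie_deriv_cobd\<close>, and the rest is the induction
  hypothesis for i_x f.\<close>

lemma cobd_cobd: "multilin f \<Longrightarrow> cobd (cobd f) xs = 0"
proof (induction f xs rule: cobd.induct)
  case (3 f x z zs)
  let ?f = "\<lambda>ws. f (x # ws)"
  have "cobd (\<lambda>ws. cobd f (x # ws)) (z # zs) = cobd (\<lambda>ws. lie_deriv x f ws - cobd ?f ws) (z # zs)"
    by (rule cobd_cong) (simp add: cobd_Cons)
  then show ?case
    using 3 by (simp add: cobd_fun multilin_Cons lie_deriv_cobd)
qed simp_all

text \<open>At two equal leading entries \<open>u\<close> the derivative replaces each in turn by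
  \<open>bracket x u\<close>; these two terms differ by a swap and cancel, and what remains is the
  derivative of f(u, u, ...) = 0.\<close>

lemma alternating_lie_deriv:
  assumes "multilin f" "alternating f"
  shows "alternating (lie_deriv x f)"
proof -
  have "lie_deriv x f (as @ u # u # bs) = 0" if "bs \<noteq> []" "multilin f" "alternating f" for as u bs
    using that(2,3)
  proof (induction as arbitrary: f)
    case Nil
    have "lie_deriv x (\<lambda>ws. f (u # u # ws)) bs = lie_deriv x (\<lambda>ws. 0) bs"
      using Nil(2)[unfolded alternating_def, rule_format, of _ "[]" u]
      by (intro lie_deriv_cong) simp
    moreover have "f (bracket x u # u # bs) = - f (u # bracket x u # bs)"
      by (rule alternating_swap_hd[OF Nil that(1)])
    ultimately show ?case
      using that(1) by (simp add: lie_deriv_Cons lie_deriv_fun)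
  next
    case (Cons a as)
    then show ?case
      using Cons.prems(2)[unfolded alternating_def, rule_format, OF that(1), of "bracket x a # as"]
      by (simp add: lie_deriv_Cons multilin_Cons alternating_Cons)
  qed
  with assms show ?thesis by (simp add: alternating_def)
qed

text \<open>At two equal leading entries \<open>u\<close> the Lie derivative along \<open>u\<close>
  appears twice with opposite signs and \<open>bracket u u\<close> vanishes, leaving the coboundary
  of f(u, u, ...) = 0.\<close>

lemma alternating_cobd:
  assumes "multilin f" "alternating f"
  shows "alternating (cobd f)"
proof -
  have "cobd f (as @ u # u # bs) = 0" if "bs \<noteq> []" "multilin f" "alternating f" for as u bs
    using that(2,3)
  proof (induction as arbitrary: f)
    case Nil
    have "cobd (\<lambda>ws. f (u # u # ws)) bs = cobd (\<lambda>ws. 0) bs"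
      using Nil(2)[unfolded alternating_def, rule_format, of _ "[]" u]
      by (intro cobd_cong) simp
    then show ?case
      using that(1) by (simp add: cobd_Cons lie_deriv_Cons cobd_fun multilinD_hd[OF Nil(1)])
  next
    case (Cons a as)
    have "lie_deriv a f (as @ u # u # bs) = 0"
      using alternating_lie_deriv[OF Cons.prems] that(1) by (simp add: alternating_def)
    with Cons show ?case
      by (simp add: cobd_Cons multilin_Cons alternating_Cons)
  qed
  with assms show ?thesis by (simp add: alternating_def)
qed

text \<open>Unrolling leaves \<open>bracket x (ys ! j)\<close> at position j with a minus sign;
  moving it to the front past j entries costs (-1)^j.\<close>

lemma lie_deriv_snoc:
  "multilin f \<Longrightarrow> alternating f \<Longrightarrow> lie_deriv x f (ys @ [z]) =
    x \<diamond> f (ys @ [z]) + f (ys @ [x]) \<diamond> z - f (ys @ [x \<diamond> z]) +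
    (\<Sum>j<length ys. scale ((-1) ^ (j + 1)) (f (bracket x (ys ! j) # del j ys @ [z])))"
proof (induction ys arbitrary: f)
  case (Cons y ys)
  have "f (y # bracket x (ys ! j) # del j ys @ [z]) = - f (bracket x (ys ! j) # y # del j ys @ [z])" for j
    by (rule alternating_swap_hd[OF Cons.prems]) simp
  with Cons.IH[OF multilin_Cons[OF Cons.prems(1)] alternating_Cons[OF Cons.prems(2)], of y] show ?case
    by (simp add: lie_deriv_Cons sum.lessThan_Suc_shift sum_negf algebra_simps del: sum.lessThan_Suc)
qed simp

lemma cobd_snoc:
  "multilin f \<Longrightarrow> alternating f \<Longrightarrow> cobd f (ys @ [z]) =
    (\<Sum>i<length ys. scale ((-1) ^ i)
      (ys ! i \<diamond> f (del i ys @ [z]) + f (del i ys @ [ys ! i]) \<diamond> z - f (del i ys @ [ys ! i \<diamond> z]))) +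
    (\<Sum>j<length ys. \<Sum>i<j. scale ((-1) ^ (i + j)) (f (bracket (ys ! i) (ys ! j) # del i (del j ys) @ [z])))"
proof (induction ys arbitrary: f)
  case (Cons y ys)
  have "f (y # bracket u v # del i (del j ys) @ [z]) = - f (bracket u v # y # del i (del j ys) @ [z])" for u v i j
    by (rule alternating_swap_hd[OF Cons.prems]) simp
  with Cons.IH[OF multilin_Cons[OF Cons.prems(1)] alternating_Cons[OF Cons.prems(2)], of y] show ?case
    by (simp add: cobd_Cons lie_deriv_snoc Cons.prems sum.lessThan_Suc_shift sum.distrib sum_negf
        sum_subtractf del: sum.lessThan_Suc)
qed simp

lemma d_pLie_snoc:
  assumes "length ys = n"
  shows "d_pLie scale (\<diamond>) n f (ys @ [z]) =
    (\<Sum>i<n. scale ((-1) ^ i)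
      (ys ! i \<diamond> f (del i ys @ [z]) + f (del i ys @ [ys ! i]) \<diamond> z - f (del i ys @ [ys ! i \<diamond> z]))) +
    (\<Sum>j<n. \<Sum>i<j. scale ((-1) ^ (i + j)) (f (bracket (ys ! i) (ys ! j) # del i (del j ys) @ [z])))"
proof -
  have 1: "nths (ys @ [z]) ({..<n} - {i}) = del i ys" for i
    using assms nths_remove1[of ys i] by (simp add: nths_append_lessThan)
  have 2: "nths (ys @ [z]) ({..<n} - {i, j}) = del i (del j ys)" if "i < j" for i j
    using assms nths_remove2[OF that, of ys] by (simp add: nths_append_lessThan)
  show ?thesis
    using assms
    by (simp add: d_pLie_def 1 2 nth_append bracket_def sum.distrib sum_subtractf sum_negf
        scale_right_distrib scale_right_diff_distrib)
qed

lemma d_pLie_eq_cobd: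
  assumes "f \<in> pLie_cochains scale n" "n \<ge> 1"
  shows "d_pLie scale (\<diamond>) n f = cobd f"
proof
  fix xs
  from assms have f: "multilin f" "alternating f" "\<And>xs. length xs \<noteq> n \<Longrightarrow> f xs = 0"
    by (auto simp: pLie_cochains_iff multilinear_mapsD)
  show "d_pLie scale (\<diamond>) n f xs = cobd f xs"
  proof (cases "length xs = n + 1")
    case True
    then have "xs = butlast xs @ [last xs]" "length (butlast xs) = n" by (cases xs; auto)+
    then show ?thesis
      using cobd_snoc[OF f(1,2)] d_pLie_snoc by metis
  next
    case False
    \<comment> \<open>\<open>cobd f xs\<close> evaluates \<open>f\<close> only on lists one shorter
      than \<open>xs\<close>, where \<open>f\<close> is 0 by default.\<close>
    have "cobd f xs = cobd (\<lambda>_. 0) xs"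
      by (rule cobd_cong) (use False f(3) in auto)
    then show ?thesis using False by (simp add: cobd_fun d_pLie_def)
  qed
qed

lemma d_pLie_closed:
  assumes "f \<in> pLie_cochains scale n" "n \<ge> 1"
  shows "d_pLie scale (\<diamond>) n f \<in> pLie_cochains scale (n + 1)"
proof -
  have "d_pLie scale (\<diamond>) n f xs = 0" if "length xs \<noteq> n + 1" for xs
    using that by (simp add: d_pLie_def)
  with assms show ?thesis
    unfolding d_pLie_eq_cobd[OF assms]
    by (auto simp: pLie_cochains_iff intro!: multilinear_mapsI multilin_cobd alternating_cobd
        dest: multilinear_mapsD)
qed

lemma d_pLie_d_pLie:
  assumes "f \<in> pLie_cochains scale n" "n \<ge> 1"
  shows "d_pLie scale (\<diamond>) (n + 1) (d_pLie scale (\<diamond>) n f) = 0"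
proof -
  have "cobd (cobd f) xs = 0" for xs
    using assms by (intro cobd_cobd) (auto simp: pLie_cochains_iff dest: multilinear_mapsD(1))
  then show ?thesis
    using d_pLie_closed[OF assms] assms by (simp add: d_pLie_eq_cobd fun_eq_iff)
qed

lemma linear_on_d_pLie:
  assumes "n \<ge> 1"
  shows "linear_on (scale_fun scale) (scale_fun scale) (pLie_cochains scale n) (d_pLie scale (\<diamond>) n)"
proof -
  interpret F: vector_space "scale_fun scale :: _ \<Rightarrow> ('v list \<Rightarrow> 'v) \<Rightarrow> _" by (rule vector_space_fun)
  have "f + g \<in> pLie_cochains scale n" "scale_fun scale c f \<in> pLie_cochains scale n"
    if "f \<in> pLie_cochains scale n" "g \<in> pLie_cochains scale n" for f g c
    using that subspace_pLie_cochains[of n] by (auto simp: F.subspace_def)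
  with assms show ?thesis
    by (auto simp: linear_on_def d_pLie_eq_cobd scale_fun_def plus_fun_def cobd_fun)
qed

lemma cochain_complex_pLie:
  "cochain_complex (scale_fun scale) (pLie_cochains scale) (d_pLie scale (\<diamond>))"
  unfolding cochain_complex_def
  using vector_space_fun subspace_pLie_cochains linear_on_d_pLie d_pLie_closed d_pLie_d_pLie
  by blast

end

section \<open>Shuffles\<close>

text \<open>Its values are a, 0, ..., a-1, a+1, ...: increasing from position 1 on, so its inverse
  is in \<open>inv_shuffles 1 n\<close> when a is at most n.\<close>

definition to_front :: "nat \<Rightarrow> nat \<Rightarrow> nat" where
  "to_front a k = (if k = 0 then a else if k \<le> a then k - 1 else k)"

text \<open>Its values below \<open>n\<close> are 0, ..., i-1, i+1, ..., n-1, i: increasing up to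
  the last place, so its inverse is in \<open>inv_shuffles (n - 1) 1\<close>.\<close>

definition to_back :: "nat \<Rightarrow> nat \<Rightarrow> nat \<Rightarrow> nat" where
  "to_back n i k = (if k < i \<or> n \<le> k then k else if k = n - 1 then i else k + 1)"

lemma to_front_0: "to_front 0 = id"
  by (auto simp: to_front_def fun_eq_iff)

text \<open>Peels off one adjacent transposition, which yields both the permutation property and the
  sign by induction.\<close>

lemma to_front_Suc: "to_front (Suc a) = transpose a (Suc a) \<circ> to_front a"
  by (auto simp: to_front_def fun_eq_iff transpose_def)

lemma to_front_permutes: "a < n \<Longrightarrow> to_front a permutes {..<n}"
proof (induction a)
  case (Suc a)
  then show ?case
    unfolding to_front_Suc by (intro permutes_compose permutes_swap_id) simp_all
qed (simp add: to_front_0 permutes_id)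

lemma sign_to_front: "sign (to_front a) = (- 1) ^ a"
proof (induction a)
  case (Suc a)
  have "permutation (to_front a)"
    using to_front_permutes[of a "Suc a"] by (auto simp: permutation_permutes)
  with Suc show ?case
    unfolding to_front_Suc sign_compose[OF permutation_swap_id \<open>permutation (to_front a)\<close>]
    by (simp add: sign_swap_id)
qed (simp add: to_front_0)

lemma to_back_last: "to_back (Suc i) i = id"
  by (auto simp: to_back_def fun_eq_iff)

lemma to_back_step: "Suc i < n \<Longrightarrow> to_back n i = transpose i (Suc i) \<circ> to_back n (Suc i)"
  by (auto simp: to_back_def fun_eq_iff transpose_def)

text \<open>Descending induction from i = n - 1, where \<open>to_back n i\<close> is the identity;
  each step adds one adjacent transposition.\<close>

lemma to_back_permutes_sign:
  assumes "i < n"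
  shows "to_back n i permutes {..<n} \<and> sign (to_back n i) = (- 1) ^ (n - 1 - i)"
proof -
  have "i \<le> n - 1" using assms by simp
  then show ?thesis
  proof (induction i rule: inc_induct)
    case base
    have "to_back n (n - 1) = id" using to_back_last[of "n - 1"] assms by simp
    then show ?case by (simp only: permutes_id sign_id) simp
  next
    case (step i)
    then have p: "permutation (to_back n (Suc i))" by (auto simp: permutation_permutes)
    have "n - 1 - i = Suc (n - 1 - Suc i)" using step by simp
    with step show ?case
      unfolding to_back_step[of i n, OF less_diff_conv[THEN iffD1, OF step(2), simplified]]
        sign_compose[OF permutation_swap_id p]
      by (intro conjI permutes_compose permutes_swap_id) (simp_all add: sign_swap_id)
  qed
qed

lemmas to_back_permutes = to_back_permutes_sign[THEN conjunct1]
  and sign_to_back = to_back_permutes_sign[THEN conjunct2]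

section \<open>Shuffles as coset representatives\<close>

lemma strict_mono_on_image_eq:
  fixes p q :: "nat \<Rightarrow> nat"
  assumes "strict_mono_on {a..<b} p" "strict_mono_on {a..<b} q" "p ` {a..<b} = q ` {a..<b}" "k \<in> {a..<b}"
  shows "p k = q k"
proof -
  have "sorted (map f [a..<b]) \<and> distinct (map f [a..<b])" if "strict_mono_on {a..<b} f" for f :: "nat \<Rightarrow> nat"
  proof
    show "sorted (map f [a..<b])"
      using that strict_mono_on_leD[OF that] by (auto simp: sorted_iff_nth_mono)
    show "distinct (map f [a..<b])"
      using strict_mono_on_imp_inj_on[OF that] by (simp add: distinct_map)
  qed
  then have "map p [a..<b] = map q [a..<b]"
    using assms by (intro sorted_distinct_set_unique) auto
  then show ?thesis using assms(4) by (metis atLeastLessThan_upt map_eq_conv)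
qed

text \<open>On each block the inverse is the increasing enumeration of its image, and the second
  image is the complement of the first.\<close>

lemma inv_shuffles_eqI:
  assumes "\<sigma> \<in> inv_shuffles i j" "\<tau> \<in> inv_shuffles i j" "inv \<sigma> ` {..<i} = inv \<tau> ` {..<i}"
  shows "\<sigma> = \<tau>"
proof -
  have p: "inv \<sigma> permutes {..<i + j}" "inv \<tau> permutes {..<i + j}"
    using assms by (auto simp: inv_shuffles_def permutes_inv)
  have "f ` {i..<i + j} = {..<i + j} - f ` {..<i}" if "f permutes {..<i + j}" for f
  proof -
    have "{i..<i + j} = {..<i + j} - {..<i}" by auto
    then show ?thesis using that
      by (metis (no_types) image_set_diff permutes_image permutes_inj)
  qed
  with p assms(3) have "inv \<sigma> ` {i..<i + j} = inv \<tau> ` {i..<i + j}" by simp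
  with assms have "inv \<sigma> k = inv \<tau> k" if "k < i + j" for k
    using that strict_mono_on_image_eq[of 0 i "inv \<sigma>" "inv \<tau>" k]
      strict_mono_on_image_eq[of i "i + j" "inv \<sigma>" "inv \<tau>" k]
    by (cases "k < i") (auto simp: inv_shuffles_def atLeast0LessThan)
  moreover have "inv \<sigma> k = inv \<tau> k" if "\<not> k < i + j" for k
    using p that by (simp add: permutes_not_in)
  ultimately have "inv \<sigma> = inv \<tau>" by blast
  moreover have "inv (inv \<sigma>) = \<sigma>" "inv (inv \<tau>) = \<tau>"
    using assms by (auto simp: inv_shuffles_def permutes_inv_inv)
  ultimately show ?thesis by metis
qed

lemma inv_in_inv_shuffles:
  assumes "p permutes {..<i + j}" "strict_mono_on {..<i} p" "strict_mono_on {i..<i + j} p"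
  shows "inv p \<in> inv_shuffles i j"
  using assms by (simp add: inv_shuffles_def permutes_inv permutes_inv_inv)

text \<open>The inverse lists \<open>A\<close> and then its complement, each in increasing
  order.\<close>

lemma inv_shuffles_exists:
  assumes "A \<subseteq> {..<i + j}" "card A = i"
  obtains \<sigma> where "\<sigma> \<in> inv_shuffles i j" "inv \<sigma> ` {..<i} = A"
proof -
  let ?B = "{..<i + j} - A"
  let ?L = "sorted_list_of_set A @ sorted_list_of_set ?B"
  have fin: "finite A" using assms(1) finite_subset by blast
  have B: "card ?B = j" using assms fin by (simp add: card_Diff_subset)
  have "bij_betw ((!) ?L) {..<i + j} {..<i + j}"
    by (rule bij_betw_nth) (use assms fin B in auto)
  define p where "p k = (if k < i + j then ?L ! k else k)" for k
  have "bij_betw p {..<i + j} {..<i + j}"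
    using \<open>bij_betw ((!) ?L) _ _\<close> by (subst bij_betw_cong[where g = "(!) ?L"]) (auto simp: p_def)
  then have perm: "p permutes {..<i + j}"
    by (rule bij_imp_permutes) (simp add: p_def)
  have pA: "p k = sorted_list_of_set A ! k" if "k < i" for k
    using that assms fin by (simp add: p_def nth_append)
  have pB: "p k = sorted_list_of_set ?B ! (k - i)" if "i \<le> k" "k < i + j" for k
    using that assms fin by (simp add: p_def nth_append)
  have s: "sorted_list_of_set X ! a < sorted_list_of_set X ! b"
    if "a < b" "b < card X" for X :: "nat set" and a b
    using that sorted_wrt_nth_less[OF strict_sorted_list_of_set, of a b X] by simp
  have "strict_mono_on {..<i} p" "strict_mono_on {i..<i + j} p"
    unfolding strict_mono_on_def using s[of _ _ A] s[of _ _ ?B] assms(2) B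
    by (auto simp: pA pB)
  with perm have "inv p \<in> inv_shuffles i j" by (rule inv_in_inv_shuffles)
  moreover have "inv (inv p) ` {..<i} = A"
  proof -
    have "p ` {..<i} = (!) (sorted_list_of_set A) ` {..<i}" using pA by (intro image_cong) auto
    also have "\<dots> = set (sorted_list_of_set A)"
      using assms fin by (auto simp: set_conv_nth in_set_conv_nth simp del: set_sorted_list_of_set)
    also have "\<dots> = A" using fin by simp
    finally show ?thesis using perm by (simp add: permutes_inv_inv)
  qed
  ultimately show ?thesis by (rule that)
qed

lemma finite_inv_shuffles: "finite (inv_shuffles i j)"
  by (rule finite_subset[of _ "{p. p permutes {..<i + j}}"])
    (auto simp: inv_shuffles_def finite_permutations)

text \<open>
  The elements of \<open>Sh\<^sup>-\<^sup>1(i, j)\<close> represent the right cosets of \<open>S\<^sub>i \<times> S\<^sub>j\<close> in \<open>S\<^bsub>i+j\<^esub>\<close>, which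
  right translation permutes.
\<close>

lemma sum_inv_shuffles_translate:
  fixes \<phi> :: "(nat \<Rightarrow> nat) \<Rightarrow> 'a::comm_monoid_add"
  assumes inv: "\<And>\<sigma> a b. \<sigma> permutes {..<i + j} \<Longrightarrow> a < i \<and> b < i \<or> a \<in> {i..<i + j} \<and> b \<in> {i..<i + j} \<Longrightarrow>
      \<phi> (transpose a b \<circ> \<sigma>) = \<phi> \<sigma>"
    and \<tau>: "\<tau> permutes {..<i + j}"
  shows "(\<Sum>\<sigma>\<in>inv_shuffles i j. \<phi> (\<sigma> \<circ> \<tau>)) = (\<Sum>\<sigma>\<in>inv_shuffles i j. \<phi> \<sigma>)"
proof -
  let ?S = "{..<i + j}" and ?Sh = "inv_shuffles i j"
  \<comment> \<open>The hypothesis on transpositions extends to all permutations of one block, these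
    being products of transpositions.\<close>
  have block: "\<phi> (\<rho> \<circ> \<sigma>) = \<phi> \<sigma>" if "\<rho> permutes X" "X = {..<i} \<or> X = {i..<i + j}" "\<sigma> permutes ?S" for \<rho> \<sigma> X
  proof -
    have "finite X" using that by auto
    with that(1) show ?thesis
    proof (induction rule: permutes_induct[consumes 2])
      case (swap a b p)
      have "p permutes ?S" using swap(4) by (rule permutes_subset) (use that in auto)
      then have "p \<circ> \<sigma> permutes ?S" using that(3) by (intro permutes_compose)
      then have "\<phi> (transpose a b \<circ> (p \<circ> \<sigma>)) = \<phi> (p \<circ> \<sigma>)"
        using swap(1,2) that(2) by (intro inv) auto
      with swap show ?case by (simp only: comp_assoc)
    qed (use \<open>finite X\<close> in simp_all)
  qed
  \<comment> \<open>\<phi> depends only on the preimage of the first block: if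
    \<open>\<sigma>\<close> and \<open>\<sigma>'\<close> share it,
    \<open>\<sigma>' \<circ> inv \<sigma>\<close> preserves both blocks and is the product of its
    restrictions to them.\<close>
  have const: "\<phi> \<sigma> = \<phi> \<sigma>'"
    if s: "\<sigma> permutes ?S" "\<sigma>' permutes ?S" and eq: "inv \<sigma> ` {..<i} = inv \<sigma>' ` {..<i}" for \<sigma> \<sigma>'
  proof -
    let ?\<rho> = "\<sigma>' \<circ> inv \<sigma>"
    have \<rho>: "?\<rho> permutes ?S" using s by (intro permutes_compose permutes_inv)
    have 1: "?\<rho> ` {..<i} = {..<i}"
      unfolding image_comp[symmetric] eq by (simp add: image_comp permutes_inv_o[OF s(2)])
    have 2: "?\<rho> ` {i..<i + j} = {i..<i + j}"
    proof -
      have "{i..<i + j} = ?S - {..<i}" by auto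
      then show ?thesis
        using image_set_diff[OF permutes_inj[OF \<rho>], of ?S "{..<i}"]
        by (simp only: 1 permutes_image[OF \<rho>])
    qed
    define r where "r X k = (if k \<in> X then ?\<rho> k else k)" for X k
    have r: "r X permutes X" if "?\<rho> ` X = X" for X
    proof (rule bij_imp_permutes)
      show "bij_betw (r X) X X"
        using that permutes_inj[OF \<rho>] unfolding bij_betw_def r_def
        by (auto simp: inj_on_def image_def)
    qed (simp add: r_def)
    have "?\<rho> = r {..<i} \<circ> r {i..<i + j}"
    proof
      fix k
      show "?\<rho> k = (r {..<i} \<circ> r {i..<i + j}) k"
      proof (cases "k \<in> {i..<i + j}")
        case True
        then have "?\<rho> k \<in> {i..<i + j}" using 2 by blast
        with True show ?thesis by (simp add: r_def)
      next
        case False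
        then show ?thesis using permutes_not_in[OF \<rho>, of k] by (auto simp: r_def)
      qed
    qed
    moreover have "r {i..<i + j} \<circ> \<sigma> permutes ?S"
      by (rule permutes_compose[OF s(1) permutes_subset[OF r[OF 2]]]) auto
    ultimately have "\<phi> (?\<rho> \<circ> \<sigma>) = \<phi> \<sigma>"
      using block[OF r[OF 1] disjI1[OF refl]] block[OF r[OF 2] disjI2[OF refl] s(1)]
      by (simp add: comp_assoc)
    then show ?thesis by (simp add: comp_assoc permutes_inv_o[OF s(1)])
  qed
  \<comment> \<open>Choose the shuffle in the coset of \<open>\<sigma> \<circ> \<tau>\<close>. The
    choice turns out to be injective, hence it permutes the finite set of shuffles.\<close>
  have "\<exists>\<sigma>'. \<sigma>' \<in> ?Sh \<and> inv \<sigma>' ` {..<i} = inv (\<sigma> \<circ> \<tau>) ` {..<i}" if "\<sigma> \<in> ?Sh" for \<sigma>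
  proof -
    have "inv (\<sigma> \<circ> \<tau>) permutes ?S"
      using that \<tau> by (intro permutes_inv permutes_compose) (auto simp: inv_shuffles_def)
    then have "inv (\<sigma> \<circ> \<tau>) ` {..<i} \<subseteq> ?S" "card (inv (\<sigma> \<circ> \<tau>) ` {..<i}) = i"
      using image_mono[of "{..<i}" ?S "inv (\<sigma> \<circ> \<tau>)"]
      by (auto simp: permutes_image card_image permutes_inj_on)
    then show ?thesis by (metis inv_shuffles_exists)
  qed
  then obtain r where r: "\<And>\<sigma>. \<sigma> \<in> ?Sh \<Longrightarrow> r \<sigma> \<in> ?Sh"
    "\<And>\<sigma>. \<sigma> \<in> ?Sh \<Longrightarrow> inv (r \<sigma>) ` {..<i} = inv (\<sigma> \<circ> \<tau>) ` {..<i}"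
    by metis
  have inj: "inj_on r ?Sh"
  proof (rule inj_onI)
    fix \<sigma> \<sigma>'
    assume s: "\<sigma> \<in> ?Sh" "\<sigma>' \<in> ?Sh" "r \<sigma> = r \<sigma>'"
    then have "inv (\<sigma> \<circ> \<tau>) ` {..<i} = inv (\<sigma>' \<circ> \<tau>) ` {..<i}" using r(2) by metis
    moreover have "inv (\<sigma> \<circ> \<tau>) = inv \<tau> \<circ> inv \<sigma>" "inv (\<sigma>' \<circ> \<tau>) = inv \<tau> \<circ> inv \<sigma>'"
      using s \<tau> by (auto simp: inv_shuffles_def intro!: o_inv_distrib permutes_bij)
    ultimately have "inv \<tau> ` inv \<sigma> ` {..<i} = inv \<tau> ` inv \<sigma>' ` {..<i}"
      by (simp add: image_comp)
    then have "inv \<sigma> ` {..<i} = inv \<sigma>' ` {..<i}"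
      using permutes_inj[OF permutes_inv[OF \<tau>]] by (simp add: inj_image_eq_iff)
    with s show "\<sigma> = \<sigma>'" by (blast intro: inv_shuffles_eqI)
  qed
  have im: "r ` ?Sh = ?Sh"
    using r(1) inj finite_inv_shuffles by (intro endo_inj_surj) auto
  have "(\<Sum>\<sigma>\<in>?Sh. \<phi> (\<sigma> \<circ> \<tau>)) = (\<Sum>\<sigma>\<in>?Sh. \<phi> (r \<sigma>))"
  proof (rule sum.cong[OF refl])
    fix \<sigma> assume "\<sigma> \<in> ?Sh"
    with r[OF this] \<tau> show "\<phi> (\<sigma> \<circ> \<tau>) = \<phi> (r \<sigma>)"
      by (intro const permutes_compose) (auto simp: inv_shuffles_def)
  qed
  also have "\<dots> = (\<Sum>\<sigma>\<in>?Sh. \<phi> \<sigma>)"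
    using sum.reindex[OF inj, of \<phi>] by (simp add: im)
  finally show ?thesis .
qed

section \<open>Enumeration of the shuffles of types (1, n), (2, n-1) and (n-1, 1)\<close>

lemma sum_inv_shuffles_1:
  fixes \<phi> :: "(nat \<Rightarrow> nat) \<Rightarrow> 'a::comm_monoid_add"
  shows "(\<Sum>\<sigma>\<in>inv_shuffles 1 n. \<phi> \<sigma>) = (\<Sum>a<n + 1. \<phi> (inv (to_front a)))"
proof -
  have sh: "inv (to_front a) \<in> inv_shuffles 1 n" if "a < n + 1" for a
    using that to_front_permutes[of a "n + 1"]
    by (intro inv_in_inv_shuffles) (auto simp: strict_mono_on_def to_front_def)
  have ii: "inv (inv (to_front a)) = to_front a" if "a < n + 1" for a
    using to_front_permutes[OF that] by (rule permutes_inv_inv)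
  have "inv_shuffles 1 n = (\<lambda>a. inv (to_front a)) ` {..<n + 1}"
  proof (intro subset_antisym subsetI)
    fix \<sigma> assume s: "\<sigma> \<in> inv_shuffles 1 n"
    then have "inv \<sigma> permutes {..<n + 1}" by (auto simp: inv_shuffles_def permutes_inv)
    then have "inv \<sigma> 0 < n + 1" using permutes_in_image[of "inv \<sigma>" "{..<n + 1}" 0] by simp
    moreover from this have "\<sigma> = inv (to_front (inv \<sigma> 0))"
      by (intro inv_shuffles_eqI[OF s sh]) (simp_all add: ii to_front_def lessThan_Suc)
    ultimately show "\<sigma> \<in> (\<lambda>a. inv (to_front a)) ` {..<n + 1}" by blast
  qed (use sh in auto)
  moreover have "inj_on (\<lambda>a. inv (to_front a)) {..<n + 1}"
    by (rule inj_on_inverseI[of _ "\<lambda>\<sigma>. inv \<sigma> 0"]) (simp add: ii to_front_def)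
  ultimately show ?thesis by (simp add: sum.reindex)
qed

lemma sum_inv_shuffles_2:
  fixes \<phi> :: "(nat \<Rightarrow> nat) \<Rightarrow> 'a::comm_monoid_add"
  assumes "n \<ge> 1"
  shows "(\<Sum>\<sigma>\<in>inv_shuffles 2 (n - 1). \<phi> \<sigma>) =
    (\<Sum>b<n + 1. \<Sum>a<b. \<phi> (inv (to_front b \<circ> to_front (Suc a))))"
proof -
  \<comment> \<open>Once \<open>b\<close> has been brought to the front, a smaller \<open>a\<close>
    sits at position \<open>Suc a\<close>. Thus \<open>?p (b, a)\<close> sends 0 to \<open>a\<close>
    and 1 to \<open>b\<close>.\<close>
  let ?p = "\<lambda>(b, a). to_front b \<circ> to_front (Suc a)" and ?X = "SIGMA b:{..<n + 1}. {..<b}"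
  have perm: "?p x permutes {..<n + 1}" if "x \<in> ?X" for x
    using that by (auto intro!: permutes_compose to_front_permutes)
  have two: "2 + (n - 1) = n + 1" using assms by simp
  have sh: "inv (?p x) \<in> inv_shuffles 2 (n - 1)" if "x \<in> ?X" for x
    using perm[OF that] that assms two
    by (intro inv_in_inv_shuffles) (auto simp: strict_mono_on_def to_front_def)
  have ii: "inv (inv (?p x)) = ?p x" if "x \<in> ?X" for x
    using perm[OF that] by (rule permutes_inv_inv)
  have p01: "?p x 0 = snd x" "?p x 1 = fst x" if "x \<in> ?X" for x
    using that by (auto simp: to_front_def)
  have "inv_shuffles 2 (n - 1) = (\<lambda>x. inv (?p x)) ` ?X"
  proof (intro subset_antisym subsetI)
    fix \<sigma> assume s: "\<sigma> \<in> inv_shuffles 2 (n - 1)"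
    let ?x = "(inv \<sigma> 1, inv \<sigma> 0)"
    have "inv \<sigma> permutes {..<n + 1}" using s unfolding inv_shuffles_def two by (auto intro: permutes_inv)
    then have "inv \<sigma> 1 < n + 1" using permutes_in_image[of "inv \<sigma>" "{..<n + 1}" 1] assms by simp
    moreover have "inv \<sigma> 0 < inv \<sigma> 1" using s by (simp add: inv_shuffles_def strict_mono_on_def)
    ultimately have x: "?x \<in> ?X" by simp
    have "{..<2} = {0, 1::nat}" by auto
    then have "\<sigma> = inv (?p ?x)"
      using p01[OF x] by (intro inv_shuffles_eqI[OF s sh[OF x]], subst ii[OF x]) simp
    with x show "\<sigma> \<in> (\<lambda>x. inv (?p x)) ` ?X" by blast
  qed (use sh in auto)
  moreover have "inj_on (\<lambda>x. inv (?p x)) ?X"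
    by (rule inj_on_inverseI[of _ "\<lambda>\<sigma>. (inv \<sigma> 1, inv \<sigma> 0)"], subst (1 2) ii)
      (simp_all only: p01 prod.collapse)
  ultimately have "(\<Sum>\<sigma>\<in>inv_shuffles 2 (n - 1). \<phi> \<sigma>) = (\<Sum>x\<in>?X. \<phi> (inv (?p x)))"
    by (simp add: sum.reindex)
  also have "\<dots> = (\<Sum>b<n + 1. \<Sum>a<b. \<phi> (inv (to_front b \<circ> to_front (Suc a))))"
    by (subst sum.Sigma) (auto intro: sum.cong)
  finally show ?thesis .
qed

text \<open>The value of the inverse at \<open>n - 1\<close> determines the shuffle, since the first
  block is mapped onto the remaining numbers.\<close>

lemma inv_shuffles_last:
  assumes "n \<ge> 1"
  shows "bij_betw (\<lambda>i. inv (to_back n i)) {..<n} (inv_shuffles (n - 1) 1)"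
proof -
  have sh: "inv (to_back n i) \<in> inv_shuffles (n - 1) 1" if "i < n" for i
    using that to_back_permutes[of i n] assms
    by (intro inv_in_inv_shuffles) (auto simp: strict_mono_on_def to_back_def)
  have ii: "inv (inv (to_back n i)) = to_back n i" if "i < n" for i
    using to_back_permutes[OF that] by (rule permutes_inv_inv)
  have im: "p ` {..<n - 1} = {..<n} - {p (n - 1)}" if "p permutes {..<n}" for p
  proof -
    have "{..<n - 1} = {..<n} - {n - 1}" using assms by auto
    then have "p ` {..<n - 1} = p ` ({..<n} - {n - 1})" by simp
    also have "\<dots> = {..<n} - {p (n - 1)}"
      unfolding image_set_diff[OF permutes_inj[OF that]] by (simp add: permutes_image[OF that])
    finally show ?thesis .
  qed
  have "inv_shuffles (n - 1) 1 = (\<lambda>i. inv (to_back n i)) ` {..<n}"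
  proof (intro subset_antisym subsetI)
    fix \<sigma> assume s: "\<sigma> \<in> inv_shuffles (n - 1) 1"
    then have p: "inv \<sigma> permutes {..<n}" using assms by (auto simp: inv_shuffles_def permutes_inv)
    let ?i = "inv \<sigma> (n - 1)"
    have i: "?i < n" using permutes_in_image[OF p, of "n - 1"] assms by simp
    moreover have "to_back n ?i (n - 1) = ?i" using assms i by (auto simp: to_back_def)
    then have "\<sigma> = inv (to_back n ?i)"
      using im[OF p] im[OF to_back_permutes[OF i]]
      by (intro inv_shuffles_eqI[OF s sh[OF i]]) (simp only: ii[OF i])
    ultimately show "\<sigma> \<in> (\<lambda>i. inv (to_back n i)) ` {..<n}" by blast
  qed (use sh in auto)
  moreover have "inj_on (\<lambda>i. inv (to_back n i)) {..<n}"
    by (rule inj_on_inverseI[of _ "\<lambda>\<sigma>. inv \<sigma> (n - 1)"]) (auto simp: ii to_back_def)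
  ultimately show ?thesis by (simp add: bij_betw_def)
qed

lemma permute_to_front:
  assumes "a < length xs"
  shows "permute_list (to_front a) xs = xs ! a # del a xs"
proof (rule nth_equalityI)
  fix k assume "k < length (permute_list (to_front a) xs)"
  with assms show "permute_list (to_front a) xs ! k = (xs ! a # del a xs) ! k"
    by (auto simp: permute_list_def to_front_def del_def nth_Cons nth_append min_def split: nat.split)
qed (use assms in \<open>simp add: permute_list_def\<close>)

lemma permute_to_back:
  assumes "i < length xs"
  shows "permute_list (to_back (length xs) i) xs = del i xs @ [xs ! i]"
proof (rule nth_equalityI)
  fix k assume "k < length (permute_list (to_back (length xs) i) xs)"
  with assms show "permute_list (to_back (length xs) i) xs ! k = (del i xs @ [xs ! i]) ! k"
    by (auto simp: permute_list_def to_back_def del_def nth_append min_def)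
qed (use assms in \<open>simp add: permute_list_def\<close>)

lemma permute_list_update:
  assumes "p permutes {..<length xs}"
  shows "permute_list p (xs[i := v]) = (permute_list p xs)[inv p i := v]"
proof (rule nth_equalityI)
  fix k assume "k < length (permute_list p (xs[i := v]))"
  then have k: "k < length xs" by simp
  then have "p k < length xs" using permutes_in_image[OF assms, of k] by simp
  moreover have "p k = i \<longleftrightarrow> k = inv p i" using permutes_inv_eq[OF assms, of i k] by auto
  ultimately show "permute_list p (xs[i := v]) ! k = (permute_list p xs)[inv p i := v] ! k"
    using k assms by (auto simp: permute_list_nth nth_list_update)
qed simp

lemma transpose_Suc: "transpose (Suc a) (Suc b) (Suc i) = Suc (transpose a b i)"
  "transpose (Suc a) (Suc b) 0 = 0"
  by (auto simp: transpose_def)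

lemma permute_list_transpose_Cons:
  assumes "a < length xs" "b < length xs"
  shows "permute_list (transpose (Suc a) (Suc b)) (x # xs) = x # permute_list (transpose a b) xs"
proof (rule nth_equalityI)
  fix k assume "k < length (permute_list (transpose (Suc a) (Suc b)) (x # xs))"
  then show "permute_list (transpose (Suc a) (Suc b)) (x # xs) ! k = (x # permute_list (transpose a b) xs) ! k"
    by (cases k) (simp_all add: permute_list_def transpose_Suc del: upt_Suc)
qed simp

lemma permute_list_transpose_0_1: "permute_list (transpose 0 1) (x # y # zs) = y # x # zs"
proof (rule nth_equalityI)
  fix k assume "k < length (permute_list (transpose 0 1) (x # y # zs))"
  then show "permute_list (transpose 0 1) (x # y # zs) ! k = (y # x # zs) ! k"
    by (cases k; cases "k - 1") (simp_all add: permute_list_def del: upt_Suc)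
qed simp

section \<open>The operad of perm algebras\<close>

lemma offset_simps [simp]: "offset ks 0 = 0" "offset (k # ks) (Suc i) = k + offset ks i"
  by (simp_all add: offset_def)

lemma offset_length: "offset ks (length ks) = sum_list ks"
  by (simp add: offset_def)

lemma offset_Suc: "i < length ks \<Longrightarrow> offset ks (Suc i) = offset ks i + ks ! i"
  by (simp add: offset_def take_Suc_conv_app_nth)

lemma offset_mono: "i \<le> j \<Longrightarrow> offset ks i \<le> offset ks j"
  using take_add[of i "j - i" ks] by (simp add: offset_def)

lemma offset_block_le: "i < j \<Longrightarrow> i < length ks \<Longrightarrow> offset ks i + ks ! i \<le> offset ks j"
  using offset_mono[of "Suc i" j ks] by (simp add: offset_Suc)

lemma offset_block_exists:
  "l < sum_list ks \<Longrightarrow> \<exists>i<length ks. offset ks i \<le> l \<and> l < offset ks i + ks ! i"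
proof (induction ks arbitrary: l)
  case (Cons k ks)
  show ?case
  proof (cases "l < k")
    case True
    then show ?thesis by (intro exI[of _ 0]) simp
  next
    case False
    with Cons obtain i where "i < length ks" "offset ks i \<le> l - k" "l - k < offset ks i + ks ! i"
      by (metis add_less_cancel_left add_diff_inverse_nat sum_list.Cons)
    with False show ?thesis by (intro exI[of _ "Suc i"]) auto
  qed
qed simp

lemma UN_offset_blocks:
  "(\<Union>i<length ks. {offset ks i..<offset ks i + ks ! i}) = {..<sum_list ks}"
  using offset_block_exists[of _ ks] offset_block_le[of _ "length ks" ks]
  by (fastforce simp: offset_length)

text \<open>Substitution before passing to the quotient: here the letters, and in particular the
  last one, can be tracked.\<close>

primrec word_subst :: "(nat \<Rightarrow> word) \<Rightarrow> word \<Rightarrow> word" where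
  "word_subst \<tau> (Var i) = \<tau> i"
| "word_subst \<tau> (Mul s t) = Mul (word_subst \<tau> s) (word_subst \<tau> t)"

lemma letters_word_subst:
  "letters (word_subst \<tau> t) = concat (map (\<lambda>i. letters (\<tau> i)) (letters t))"
  by (induction t) simp_all

lemma letters_not_Nil [simp]: "letters t \<noteq> []"
  by (induction t) simp_all

lemma last_letters_word_subst:
  "last (letters (word_subst \<tau> t)) = last (letters (\<tau> (last (letters t))))"
  by (induction t) simp_all

lemma perm_word_Mul: "perm_word (Mul s t) = perm_mult (perm_word s) (perm_word t)"
proof -
  interpret vector_space "pm_scale :: 'a \<Rightarrow> (word \<Rightarrow>\<^sub>0 'a) \<Rightarrow> _" by (rule vector_space_pm_scale)
  show ?thesis
    by transfer (simp add: na_mult_def lin_ext_single[OF vector_space_pm_scale] perm_ideal.zero)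
qed

lemma word_eval_perm_word:
  "word_eval (\<lambda>i. perm_word (\<tau> i)) t = perm_word (word_subst \<tau> t)"
  by (induction t) (simp_all add: perm_word_Mul)

lemma word_eval_cong:
  "(\<And>i. i \<in> set (letters t) \<Longrightarrow> \<phi> i = \<psi> i) \<Longrightarrow> word_eval \<phi> t = word_eval \<psi> t"
  by (induction t) auto

abbreviation left_mults :: "nat list \<Rightarrow> 'k::field free_perm \<Rightarrow> 'k free_perm" where
  "left_mults \<equiv> foldr (\<lambda>i. perm_mult (perm_var i))"

lemma perm_mult_left_mults: "perm_mult (left_mults ls p) q = left_mults ls (perm_mult p q)"
  by (induction ls) (simp_all add: perm_mult_perm(2))

text \<open>Associativity moves all brackets to the right, so a word arises from its last letter by
  successive left multiplications.\<close>

lemma perm_word_left_mults: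
  "perm_word t = left_mults (butlast (letters t)) (perm_var (last (letters t)))"
proof (induction t)
  case (Mul s t)
  have "left_mults (letters s) p = left_mults (butlast (letters s)) (perm_mult (perm_var (last (letters s))) p)"
    for p :: "'a free_perm"
    by (subst append_butlast_last_id[OF letters_not_Nil, of s, symmetric]) (simp only: foldr_append foldr.simps o_apply id_apply)
  with Mul show ?case
    by (simp add: perm_word_Mul perm_mult_left_mults butlast_append)
qed simp

text \<open>Left multiplications commute: a(bc) = (ab)c = (ba)c = b(ac).\<close>

lemma left_mults_cong:
  assumes "mset ls = mset ls'"
  shows "left_mults ls p = left_mults ls' p"
proof -
  have "perm_mult a (perm_mult b c) = perm_mult b (perm_mult a c)" for a b c :: "'a free_perm"
    using perm_mult_perm[of a b c] perm_mult_perm(2)[of b a c] by simp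
  then have "fold (\<lambda>i. perm_mult (perm_var i :: 'a free_perm)) (rev ls) = fold (\<lambda>i. perm_mult (perm_var i)) (rev ls')"
    using assms by (intro fold_multiset_equiv) (auto simp: fun_eq_iff)
  then show ?thesis by (simp add: foldr_conv_fold)
qed

lemma perm_word_eqI:
  assumes "mset (letters s) = mset (letters t)" "last (letters s) = last (letters t)"
  shows "perm_word s = perm_word t"
proof -
  have "mset (letters u) = mset (butlast (letters u)) + {#last (letters u)#}" for u
  proof -
    have "mset (letters u) = mset (butlast (letters u) @ [last (letters u)])"
      by (simp only: append_butlast_last_id[OF letters_not_Nil])
    then show ?thesis by (simp del: append_butlast_last_id)
  qed
  with assms have "mset (butlast (letters s)) = mset (butlast (letters t))" by simp
  then show ?thesis
    unfolding perm_word_left_mults[of s] perm_word_left_mults[of t] assms(2) by (rule left_mults_cong)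
qed

definition monom_word :: "nat \<Rightarrow> nat \<Rightarrow> word" where
  "monom_word n i = foldr (\<lambda>j. Mul (Var j)) (filter (\<lambda>j. j \<noteq> i) [0..<n]) (Var i)"

abbreviation monomial :: "nat \<Rightarrow> nat \<Rightarrow> 'k::field free_perm" where
  "monomial n i \<equiv> perm_word (monom_word n i)"

lemma letters_monom_word: "letters (monom_word n i) = filter (\<lambda>j. j \<noteq> i) [0..<n] @ [i]"
proof -
  have "letters (foldr (\<lambda>j. Mul (Var j)) ls t) = ls @ letters t" for ls t
    by (induction ls) simp_all
  then show ?thesis by (simp add: monom_word_def)
qed

lemma monom_word_props:
  assumes "i < n"
  shows "distinct (letters (monom_word n i))" "set (letters (monom_word n i)) = {..<n}"
    "last (letters (monom_word n i)) = i" "length (letters (monom_word n i)) = n"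
proof -
  show d: "distinct (letters (monom_word n i))" and s: "set (letters (monom_word n i)) = {..<n}"
    and "last (letters (monom_word n i)) = i"
    using assms by (auto simp: letters_monom_word)
  show "length (letters (monom_word n i)) = n"
    using distinct_card[OF d] by (simp add: s)
qed

lemma perm_word_eq_monomial:
  assumes "distinct (letters t)" "set (letters t) = {..<n}"
  shows "perm_word t = monomial n (last (letters t))"
proof -
  have "last (letters t) < n" using assms(2) last_in_set[OF letters_not_Nil, of t] by simp
  note * = monom_word_props[OF this]
  show ?thesis
    by (rule perm_word_eqI) (use assms * in \<open>simp_all flip: set_eq_iff_mset_eq_distinct\<close>)
qed

text \<open>The product in \<open>xi\<close> is bracketed to the left and \<open>monom_word\<close>
  to the right; by \<open>perm_word_eq_monomial\<close> only the letters matter.\<close>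

lemma xi_eq_monomial:
  assumes "n \<ge> 1"
  shows "xi n = monomial n (n - 1)"
proof -
  have *: "foldl perm_mult (perm_word t) (map perm_var ls) = perm_word (foldl Mul t (map Var ls))" for t ls
    by (induction ls arbitrary: t) (simp_all flip: perm_word_Mul)
  have "letters (foldl Mul t (map Var ls)) = letters t @ ls" for t ls
    by (induction ls arbitrary: t) simp_all
  then have "letters (foldl Mul (Var 0) (map Var [1..<n])) = [0..<n]"
    using assms by (simp add: upt_conv_Cons)
  then show ?thesis
    unfolding xi_def * using assms by (subst perm_word_eq_monomial[of _ n]) auto
qed

interpretation perm: vector_space "perm_scale :: 'k::field \<Rightarrow> 'k free_perm \<Rightarrow> _"
  by (rule vector_space_perm_scale)

text \<open>The multilinear part for an arbitrary set of variables: composition shifts the arguments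
  to blocks that are not initial segments.\<close>

definition perm_span :: "nat set \<Rightarrow> 'k::field free_perm set" where
  "perm_span S = perm.span {perm_word t | t. distinct (letters t) \<and> set (letters t) = S}"

lemma perm_operad_simps [simp]:
  "smul perm_operad = perm_scale" "ops perm_operad n = perm_span {..<n}" "idop perm_operad = perm_var 0"
  by (simp_all add: perm_operad_def perm_span_def)

lemma act_perm_operad: "act perm_operad n \<sigma> p = perm_eval (\<lambda>i. perm_var (inv \<sigma> i)) p"
  by (simp add: perm_operad_def)

lemma ocomp_perm_operad: "ocomp perm_operad ks p qs =
    perm_eval (\<lambda>i. perm_eval (\<lambda>j. perm_var (offset ks i + j)) (qs ! i)) p"
  by (simp add: perm_operad_def)

lemma subspace_perm_span: "perm.subspace (perm_span S)"
  by (simp add: perm_span_def)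

lemma perm_span_word: "distinct (letters t) \<Longrightarrow> set (letters t) = S \<Longrightarrow> perm_word t \<in> perm_span S"
  by (auto simp: perm_span_def intro: perm.span_base)

lemma perm_span_monomial: "i < n \<Longrightarrow> monomial n i \<in> perm_span {..<n}"
  by (simp add: perm_span_word monom_word_props)

lemma perm_span_induct [consumes 1, case_names word add scale zero]:
  assumes "p \<in> perm_span S"
    and "\<And>t. distinct (letters t) \<Longrightarrow> set (letters t) = S \<Longrightarrow> P (perm_word t)"
    and "\<And>p q. P p \<Longrightarrow> P q \<Longrightarrow> P (p + q)" "\<And>c p. P p \<Longrightarrow> P (perm_scale c p)" "P 0"
  shows "P p"
  using assms(1) unfolding perm_span_def
  by (rule perm.span_induct) (use assms(2-5) in \<open>auto simp: perm.subspace_def\<close>)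

lemma perm_mult_0: "perm_mult 0 p = 0" "perm_mult p 0 = 0"
  using perm_mult_linear(1)[of 0 0 p] perm_mult_linear(2)[of p 0 0] by simp_all

lemma perm_eval_0: "perm_eval \<phi> 0 = 0"
  using perm_eval_add[of \<phi> 0 0] by simp

lemma perm_mult_span:
  assumes "p \<in> perm_span S" "q \<in> perm_span T" "S \<inter> T = {}"
  shows "perm_mult p q \<in> perm_span (S \<union> T)"
  using assms(1)
proof (induction rule: perm_span_induct)
  case (word s)
  show ?case
    using assms(2)
  proof (induction rule: perm_span_induct)
    case (word t)
    with \<open>distinct (letters s)\<close> \<open>set (letters s) = S\<close> assms(3) show ?case
      by (auto simp flip: perm_word_Mul intro: perm_span_word)
  qed (simp_all add: perm_mult_linear perm_mult_0 perm.subspace_add perm.subspace_scale perm.subspace_0 subspace_perm_span)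
qed (simp_all add: perm_mult_linear perm_mult_0 perm.subspace_add perm.subspace_scale perm.subspace_0 subspace_perm_span)

text \<open>Distinct letters are replaced by elements in disjoint sets of variables, so every
  product in the evaluation is again multilinear.\<close>

lemma word_eval_span:
  assumes "distinct (letters t)" "\<And>i. i \<in> set (letters t) \<Longrightarrow> \<phi> i \<in> perm_span (B i)"
    "\<And>i j. i \<in> set (letters t) \<Longrightarrow> j \<in> set (letters t) \<Longrightarrow> i \<noteq> j \<Longrightarrow> B i \<inter> B j = {}"
  shows "word_eval \<phi> t \<in> perm_span (\<Union>i\<in>set (letters t). B i)"
  using assms
proof (induction t)
  case (Mul s t)
  have "(\<Union>i\<in>set (letters s). B i) \<inter> (\<Union>i\<in>set (letters t). B i) = {}"
  proof (rule ccontr)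
    assume "\<not> ?thesis"
    then obtain i j where "i \<in> set (letters s)" "j \<in> set (letters t)" "B i \<inter> B j \<noteq> {}" by blast
    with Mul.prems(1) Mul.prems(3)[of i j] show False by auto
  qed
  with Mul show ?case by (auto simp: UN_Un intro!: perm_mult_span)
qed simp

lemma perm_eval_shift_span:
  assumes "q \<in> perm_span {..<k}"
  shows "perm_eval (\<lambda>j. perm_var (a + j)) q \<in> perm_span {a..<a + k}"
  using assms
proof (induction rule: perm_span_induct)
  case (word t)
  have "(+) a ` {..<k} = {a..<a + k}" by (simp add: lessThan_atLeast0 add.commute)
  with word show ?case
    by (auto simp: perm_eval_word word_eval_perm_word letters_word_subst distinct_map concat_map_singleton
        intro!: perm_span_word)
qed (simp_all add: perm_eval_add perm_eval_scale perm_eval_0 perm.subspace_add perm.subspace_scale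
    perm.subspace_0 subspace_perm_span)

lemma ocomp_perm_closed:
  assumes "p \<in> perm_span {..<length ks}" "fits perm_operad ks qs"
  shows "ocomp perm_operad ks p qs \<in> perm_span {..<sum_list ks}"
  using assms(1)
proof (induction rule: perm_span_induct)
  case (word t)
  let ?B = "\<lambda>i. {offset ks i..<offset ks i + ks ! i}"
  have "word_eval (\<lambda>i. perm_eval (\<lambda>j. perm_var (offset ks i + j)) (qs ! i)) t
      \<in> perm_span (\<Union>i\<in>set (letters t). ?B i)"
  proof (rule word_eval_span)
    fix i assume "i \<in> set (letters t)"
    with assms(2) word show "perm_eval (\<lambda>j. perm_var (offset ks i + j)) (qs ! i) \<in> perm_span (?B i)"
      by (intro perm_eval_shift_span) (simp add: fits_def list_all2_conv_all_nth)
  next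
    fix i j assume "i \<in> set (letters t)" "j \<in> set (letters t)" "i \<noteq> j"
    with word show "?B i \<inter> ?B j = {}"
      using offset_block_le[of i j ks] offset_block_le[of j i ks] by (cases "i < j") auto
  qed (use word in simp)
  with word show ?case by (simp add: ocomp_perm_operad perm_eval_word UN_offset_blocks)
qed (simp_all add: ocomp_perm_operad perm_eval_add perm_eval_scale perm_eval_0 perm.subspace_add
    perm.subspace_scale perm.subspace_0 subspace_perm_span)

text \<open>The variable x_l occurs exactly once, so in each product at most one factor depends on
  \<open>\<phi> l\<close>.\<close>

lemma word_eval_add_at:
  assumes "distinct (letters t)" "l \<in> set (letters t)"
    and "\<phi> l = \<phi>\<^sub>1 l + \<phi>\<^sub>2 l" "\<And>i. i \<noteq> l \<Longrightarrow> \<phi>\<^sub>1 i = \<phi> i" "\<And>i. i \<noteq> l \<Longrightarrow> \<phi>\<^sub>2 i = \<phi> i"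
  shows "word_eval \<phi> t = word_eval \<phi>\<^sub>1 t + word_eval \<phi>\<^sub>2 t"
  using assms(1,2)
proof (induction t)
  case (Mul s t)
  have cong: "word_eval \<phi>\<^sub>1 u = word_eval \<phi> u" "word_eval \<phi>\<^sub>2 u = word_eval \<phi> u" if "l \<notin> set (letters u)" for u
    by (rule word_eval_cong; use that assms(4,5) in metis)+
  from Mul.prems consider "l \<in> set (letters s)" "l \<notin> set (letters t)"
    | "l \<in> set (letters t)" "l \<notin> set (letters s)" by auto
  then show ?case
    using Mul by cases (simp_all add: perm_mult_linear cong)
qed (use assms in auto)

lemma word_eval_scale_at:
  assumes "distinct (letters t)" "l \<in> set (letters t)"
    and "\<phi> l = perm_scale c (\<phi>\<^sub>1 l)" "\<And>i. i \<noteq> l \<Longrightarrow> \<phi>\<^sub>1 i = \<phi> i"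
  shows "word_eval \<phi> t = perm_scale c (word_eval \<phi>\<^sub>1 t)"
  using assms(1,2)
proof (induction t)
  case (Mul s t)
  have cong: "word_eval \<phi>\<^sub>1 u = word_eval \<phi> u" if "l \<notin> set (letters u)" for u
    by (rule word_eval_cong; use that assms(4) in metis)
  from Mul.prems consider "l \<in> set (letters s)" "l \<notin> set (letters t)"
    | "l \<in> set (letters t)" "l \<notin> set (letters s)" by auto
  then show ?case
    using Mul by cases (simp_all add: perm_mult_linear cong)
qed (use assms in auto)

lemma multilinear_ocomp_perm: "multilinear_ocomp perm_operad ks"
proof -
  have "linear_on perm_scale perm_scale (perm_span {..<ks ! i}) (\<lambda>x. ocomp perm_operad ks p (ps[i := x]))"
    if p: "p \<in> perm_span {..<length ks}" and ps: "fits perm_operad ks ps" and i: "i < length ks" for p ps i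
  proof -
    have len: "length ps = length ks" using ps by (simp add: fits_def list_all2_lengthD)
    let ?\<phi> = "\<lambda>x k. perm_eval (\<lambda>j. perm_var (offset ks k + j)) (ps[i := x] ! k)"
    show ?thesis
      using p
    proof (induction rule: perm_span_induct)
      case (word t)
      have "word_eval (?\<phi> (x + y)) t = word_eval (?\<phi> x) t + word_eval (?\<phi> y) t" for x y
        by (rule word_eval_add_at[of t i]) (use word i len in \<open>auto simp: perm_eval_add\<close>)
      moreover have "word_eval (?\<phi> (perm_scale c x)) t = perm_scale c (word_eval (?\<phi> x) t)" for c x
        by (rule word_eval_scale_at[of t i]) (use word i len in \<open>auto simp: perm_eval_scale\<close>)
      ultimately show ?case
        by (simp add: linear_on_def ocomp_perm_operad perm_eval_word)
    qed (simp_all add: linear_on_def ocomp_perm_operad perm_eval_add perm_eval_scale perm_eval_0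
        perm.scale_right_distrib perm.scale_left_commute algebra_simps)
  qed
  then show ?thesis
    using vector_space_perm_scale ocomp_perm_closed[of _ ks]
    by (auto simp: multilinear_ocomp_def subspace_perm_span)
      (auto simp: linear_on_def ocomp_perm_operad perm_eval_add perm_eval_scale)
qed

lemma act_perm_monomial:
  assumes "\<sigma> permutes {..<n}" "i < n"
  shows "act perm_operad n \<sigma> (monomial n i) = monomial n (inv \<sigma> i)"
proof -
  let ?t = "word_subst (\<lambda>i. Var (inv \<sigma> i)) (monom_word n i)"
  have p: "inv \<sigma> permutes {..<n}" using assms(1) by (rule permutes_inv)
  have "letters ?t = map (inv \<sigma>) (letters (monom_word n i))"
    by (simp add: letters_word_subst concat_map_singleton)
  then have "distinct (letters ?t)" "set (letters ?t) = {..<n}" "last (letters ?t) = inv \<sigma> i"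
    using monom_word_props[OF assms(2)] p
    by (simp_all add: distinct_map permutes_inj_on permutes_image last_map)
  then show ?thesis
    by (simp add: act_perm_operad perm_eval_word word_eval_perm_word perm_word_eq_monomial)
qed

lemma linear_on_act_perm:
  "linear_on perm_scale perm_scale (perm_span {..<n}) (act perm_operad n \<sigma>)"
  by (simp add: linear_on_def act_perm_operad perm_eval_add perm_eval_scale)

lemma perm_span_monomials_induct [consumes 1, case_names monomial add scale zero]:
  assumes "p \<in> perm_span {..<n}"
    and "\<And>i. i < n \<Longrightarrow> P (monomial n i)"
    and "\<And>p q. P p \<Longrightarrow> P q \<Longrightarrow> P (p + q)" "\<And>c p. P p \<Longrightarrow> P (perm_scale c p)" "P 0"
  shows "P p"
  using assms(1)
proof (induction rule: perm_span_induct)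
  case (word t)
  then show ?case
    using assms(2)[of "last (letters t)"] last_in_set[OF letters_not_Nil, of t]
    by (simp add: perm_word_eq_monomial)
qed (use assms in auto)

lemma act_perm_closed:
  assumes "\<sigma> permutes {..<n}" "p \<in> perm_span {..<n}"
  shows "act perm_operad n \<sigma> p \<in> perm_span {..<n}"
  using assms(2)
proof (induction rule: perm_span_monomials_induct)
  case (monomial i)
  then show ?case
    using permutes_in_image[OF permutes_inv[OF assms(1)], of i]
    by (simp add: act_perm_monomial[OF assms(1)] perm_span_monomial)
qed (simp_all add: act_perm_operad perm_eval_add perm_eval_scale perm_eval_0 perm.subspace_add
    perm.subspace_scale perm.subspace_0 subspace_perm_span)

text \<open>A substituted word ends in the last letter of whatever replaces the outer last letter
  x_l, that is, in the variable \<open>js l\<close> shifted to the block \<open>l\<close>.\<close>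

lemma ocomp_perm_monomials:
  assumes l: "l < length ks" and js: "\<And>i. i < length ks \<Longrightarrow> js i < ks ! i"
    and qs: "\<And>i. i < length ks \<Longrightarrow> qs ! i = monomial (ks ! i) (js i)"
  shows "ocomp perm_operad ks (monomial (length ks) l) qs = monomial (sum_list ks) (offset ks l + js l)"
proof -
  let ?w = "monom_word (length ks) l"
  let ?\<tau> = "\<lambda>i. word_subst (\<lambda>j. Var (offset ks i + j)) (monom_word (ks ! i) (js i))"
  note w = monom_word_props[OF l]
  have \<tau>: "letters (?\<tau> i) = map ((+) (offset ks i)) (letters (monom_word (ks ! i) (js i)))" for i
    by (simp add: letters_word_subst concat_map_singleton)
  have "ocomp perm_operad ks (monomial (length ks) l) qs = word_eval (\<lambda>i. perm_word (?\<tau> i)) ?w"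
    unfolding ocomp_perm_operad perm_eval_word
    by (rule word_eval_cong) (use w(2) qs in \<open>simp add: perm_eval_word word_eval_perm_word\<close>)
  also have "\<dots> = perm_word (word_subst ?\<tau> ?w)"
    by (rule word_eval_perm_word)
  also have "\<dots> = monomial (sum_list ks) (last (letters (word_subst ?\<tau> ?w)))"
  proof (rule perm_word_eq_monomial)
    have "set (letters (?\<tau> i)) = {offset ks i..<offset ks i + ks ! i}" if "i < length ks" for i
    proof -
      have "(+) (offset ks i) ` {..<ks ! i} = {offset ks i..<offset ks i + ks ! i}"
        by (simp add: lessThan_atLeast0 add.commute)
      then show ?thesis using monom_word_props(2)[OF js[OF that]] by (simp add: \<tau>)
    qed
    then show s: "set (letters (word_subst ?\<tau> ?w)) = {..<sum_list ks}"
      unfolding letters_word_subst set_concat set_map image_image w(2)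
      by (simp flip: UN_offset_blocks)
    \<comment> \<open>Distinctness by counting: every variable occurs, and there are as many letters
      as variables.\<close>
    have "length (letters (word_subst ?\<tau> ?w)) = (\<Sum>i\<leftarrow>letters ?w. length (letters (?\<tau> i)))"
      by (simp only: letters_word_subst length_concat map_map o_def)
    also have "\<dots> = (\<Sum>i<length ks. ks ! i)"
      using monom_word_props(4)[OF js] by (simp add: sum_list_distinct_conv_sum_set[OF w(1)] w(2) \<tau>)
    also have "\<dots> = sum_list ks" by (simp add: sum_list_sum_nth lessThan_atLeast0)
    finally show "distinct (letters (word_subst ?\<tau> ?w))"
      by (intro card_distinct) (simp add: s)
  qed
  also have "last (letters (word_subst ?\<tau> ?w)) = offset ks l + js l"
    using monom_word_props(3)[OF js[OF l]]
    by (simp only: last_letters_word_subst w(3) \<tau> last_map[OF letters_not_Nil])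
  finally show ?thesis .
qed

lemma lin_ext_na_mult_times:
  fixes g g' h :: "word \<Rightarrow> 'k::field"
  assumes "\<And>s t. g (Mul s t) = h s * g' t"
  shows "lin_ext (*) g (na_mult p q) = lin_ext (*) h p * lin_ext (*) g' q"
proof -
  note vs = lin_ext_add[OF vector_space_times] lin_ext_scale[OF vector_space_times]
    lin_ext_single[OF vector_space_times]
  have 1: "lin_ext (*) g (lin_ext pm_scale G r) = lin_ext (*) (\<lambda>m. lin_ext (*) g (G m)) r"
    for G :: "word \<Rightarrow> word \<Rightarrow>\<^sub>0 'k" and r
    by (rule lin_ext_compose) (simp_all add: vs)
  have 2: "y * lin_ext (*) G r = lin_ext (*) (\<lambda>m. y * G m) r" for G :: "word \<Rightarrow> 'k" and r y
    by (rule lin_ext_compose) (simp_all add: algebra_simps)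
  have 3: "lin_ext (*) G r * y = lin_ext (*) (\<lambda>m. G m * y) r" for G :: "word \<Rightarrow> 'k" and r y
    by (rule lin_ext_compose) (simp_all add: algebra_simps)
  show ?thesis
    unfolding na_mult_def by (simp add: 1 3 vs assms) (simp add: 2)
qed

text \<open>The coefficient of m_i is the sum of the coefficients of all words that end in x_i. It
  respects the perm relations because c(ab) = e(a) c(b), where e, the sum of all coefficients, is
  multiplicative. It serves to prove the m_i linearly independent.\<close>

lift_definition perm_coeff :: "nat \<Rightarrow> 'k::field free_perm \<Rightarrow> 'k"
  is "\<lambda>i. lin_ext (*) (\<lambda>t. of_bool (last (letters t) = i))"
proof -
  fix i and p q :: "word \<Rightarrow>\<^sub>0 'k"
  let ?c = "lin_ext (*) (\<lambda>t. of_bool (last (letters t) = i)) :: (word \<Rightarrow>\<^sub>0 'k) \<Rightarrow> 'k"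
    and ?e = "lin_ext (*) (\<lambda>t. 1) :: (word \<Rightarrow>\<^sub>0 'k) \<Rightarrow> 'k"
  note vs = lin_ext_add[OF vector_space_times] lin_ext_scale[OF vector_space_times]
    lin_ext_diff[OF vector_space_times]
  have c: "?c (na_mult a b) = ?e a * ?c b" for a b by (rule lin_ext_na_mult_times) simp
  have e: "?e (na_mult a b) = ?e a * ?e b" for a b by (rule lin_ext_na_mult_times) simp
  assume "p - q \<in> perm_ideal"
  \<comment> \<open>Both are needed at once: for p in the ideal, c(pa) = e(p) c(a) vanishes through
    e(p) = 0.\<close>
  then have "?e (p - q) = 0 \<and> ?c (p - q) = 0"
    by (induction rule: perm_ideal.induct) (simp_all add: vs c e algebra_simps)
  then show "?c p = ?c q" by (simp add: vs)
qed

lemma perm_coeff_linear: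
  "perm_coeff i (p + q) = perm_coeff i p + perm_coeff i q"
  "perm_coeff i (perm_scale c p) = c * perm_coeff i p"
  by (transfer; simp add: lin_ext_add[OF vector_space_times] lin_ext_scale[OF vector_space_times])+

lemma perm_coeff_word: "perm_coeff i (perm_word t) = of_bool (last (letters t) = i)"
  by transfer (simp add: lin_ext_single[OF vector_space_times])

lemma perm_coeff_monomial: "j < n \<Longrightarrow> perm_coeff i (monomial n j) = of_bool (i = j)"
  by (auto simp: perm_coeff_word monom_word_props)

section \<open>The endomorphism operad\<close>

lemma end_operad_simps [simp]:
  "ops (end_operad scale) = multilinear_maps scale" "smul (end_operad scale) = scale_fun scale"
  by (simp_all add: end_operad_def)

lemma act_end_operad: "act (end_operad scale) n \<sigma> f xs = f (permute_list (inv \<sigma>) xs)"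
  by (simp add: end_operad_def)

lemma ocomp_end_operad: "ocomp (end_operad scale) ks f gs xs = (if length xs = sum_list ks
    then f (map (\<lambda>i. (gs ! i) (take (ks ! i) (drop (offset ks i) xs))) [0..<length ks]) else 0)"
  by (simp add: end_operad_def)

lemma idop_end_operad: "idop (end_operad scale) xs = (if length xs = 1 then hd xs else 0)"
  by (simp add: end_operad_def)

context multilinear_operations
begin

abbreviation "End_ops \<equiv> multilinear_maps scale"

lemma End_ops_linear:
  "f \<in> End_ops n \<Longrightarrow> length xs = n \<Longrightarrow> i < n \<Longrightarrow> Vector_Spaces.linear scale scale (\<lambda>v. f (xs[i := v]))"
  by (simp add: multilinear_maps_def)

lemma act_end_closed:
  assumes "\<sigma> permutes {..<n}" "f \<in> End_ops n"
  shows "act (end_operad scale) n \<sigma> f \<in> End_ops n"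
proof -
  have "Vector_Spaces.linear scale scale (\<lambda>v. f (permute_list (inv \<sigma>) (xs[i := v])))"
    if "length xs = n" "i < n" for xs i
  proof -
    have p: "inv \<sigma> permutes {..<length xs}" using assms(1) that permutes_inv by metis
    have "inv (inv \<sigma>) i < n" using permutes_in_image[OF permutes_inv[OF p], of i] that by simp
    then show ?thesis unfolding permute_list_update[OF p] using that assms(2) by (intro End_ops_linear) auto
  qed
  with assms(2) show ?thesis
    by (auto simp: multilinear_maps_def act_end_operad)
qed

lemma linear_on_act_end:
  "linear_on (scale_fun scale) (scale_fun scale) (End_ops n) (act (end_operad scale) n \<sigma>)"
  by (auto simp: linear_on_def act_end_operad scale_fun_def fun_eq_iff)

lemma idop_end_closed: "idop (end_operad scale) \<in> End_ops 1"
  by (rule multilinear_mapsI)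
    (auto simp: multilin_def idop_end_operad Cons_eq_append_conv hd_append intro!: linearI split: list.split)

text \<open>Changing one input affects only the block containing it; there the inner operation is
  linear, and the outer one is linear in the value of that block.\<close>

lemma ocomp_end_closed:
  assumes f: "f \<in> End_ops (length ks)" and gs: "fits (end_operad scale) ks gs"
  shows "ocomp (end_operad scale) ks f gs \<in> End_ops (sum_list ks)"
proof -
  let ?b = "\<lambda>xs j. take (ks ! j) (drop (offset ks j) xs)"
  let ?y = "\<lambda>xs. map (\<lambda>j. (gs ! j) (?b xs j)) [0..<length ks]"
  have "Vector_Spaces.linear scale scale (\<lambda>v. f (?y (xs[l := v])))"
    if len: "length xs = sum_list ks" and l: "l < sum_list ks" for xs l
  proof -
    obtain i where i: "i < length ks" "offset ks i \<le> l" "l < offset ks i + ks ! i"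
      using offset_block_exists[OF l] by blast
    have other: "?b (xs[l := v]) j = ?b xs j" if "j < length ks" "j \<noteq> i" for v j
    proof (cases "j < i")
      case True
      then have "offset ks j + ks ! j \<le> l" using offset_block_le[of j i ks] that i by simp
      then show ?thesis by (simp add: drop_update_swap take_update_cancel)
    next
      case False
      then have "l < offset ks j" using offset_block_le[of i j ks] that i by simp
      then show ?thesis by simp
    qed
    have same: "?b (xs[l := v]) i = (?b xs i)[l - offset ks i := v]" for v
      using i by (simp add: drop_update_swap take_update_swap)
    have y: "?y (xs[l := v]) = (?y xs)[i := (gs ! i) ((?b xs i)[l - offset ks i := v])]" for v
      by (rule nth_equalityI) (use i in \<open>auto simp: nth_list_update other same\<close>)
    have "offset ks i + ks ! i \<le> sum_list ks"
      using offset_block_le[of i "length ks" ks] i by (simp add: offset_length)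
    then have "Vector_Spaces.linear scale scale (\<lambda>v. (gs ! i) ((?b xs i)[l - offset ks i := v]))"
      using i gs len by (intro End_ops_linear[of _ "ks ! i"]) (auto simp: fits_def list_all2_conv_all_nth)
    note g = linearD[OF this]
    have "Vector_Spaces.linear scale scale (\<lambda>u. f ((?y xs)[i := u]))"
      using f i by (intro End_ops_linear) auto
    note h = linearD[OF this]
    show ?thesis unfolding y by (intro linearI) (simp_all only: g h)
  qed
  then show ?thesis by (simp add: multilinear_maps_def ocomp_end_operad)
qed

lemma multilinear_ocomp_end: "multilinear_ocomp (end_operad scale) ks"
proof -
  have "linear_on (scale_fun scale) (scale_fun scale) (End_ops (ks ! i))
      (\<lambda>x. ocomp (end_operad scale) ks f (gs[i := x]))"
    if f: "f \<in> End_ops (length ks)" and gs: "fits (end_operad scale) ks gs" and i: "i < length ks" for f gs i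
  proof -
    let ?b = "\<lambda>xs j. take (ks ! j) (drop (offset ks j) xs)"
    let ?y = "\<lambda>xs. map (\<lambda>j. (gs ! j) (?b xs j)) [0..<length ks]"
    have len: "length gs = length ks" using gs by (simp add: fits_def list_all2_lengthD)
    have y: "map (\<lambda>j. (gs[i := x] ! j) (?b xs j)) [0..<length ks] = (?y xs)[i := x (?b xs i)]" for x xs
      by (rule nth_equalityI) (use i len in \<open>auto simp: nth_list_update\<close>)
    have "Vector_Spaces.linear scale scale (\<lambda>u. f ((?y xs)[i := u]))" for xs
      using f i by (intro End_ops_linear) auto
    note h = linearD[OF this]
    show ?thesis
      by (auto simp: linear_on_def ocomp_end_operad y h scale_fun_def fun_eq_iff)
  qed
  then show ?thesis
    using vector_space_fun[where 'x = "'v list"] subspace_multilinear_maps ocomp_end_closed[of _ ks]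
    by (auto simp: multilinear_ocomp_def)
      (auto simp: linear_on_def ocomp_end_operad scale_fun_def fun_eq_iff)
qed

lemma idop_end_closed_1: "idop (end_operad scale) \<in> End_ops (Suc 0)"
  using idop_end_closed by simp

lemma fits_left:
  "g \<in> End_ops n \<Longrightarrow> fits (end_operad scale) [1, n] [idop (end_operad scale), g]"
  by (simp add: fits_def idop_end_closed_1)

lemma fits_units: "fits (end_operad scale) (replicate m 1) (replicate m (idop (end_operad scale)))"
  "fits perm_operad (replicate m 1) (replicate m (monomial 1 0))"
  by (simp_all add: fits_def list_all2_conv_all_nth idop_end_closed perm_span_monomial del: One_nat_def)

end

section \<open>Hadamard products\<close>

lemma sum_fun_apply: "(\<Sum>i\<in>A. F i) x = (\<Sum>i\<in>A. F i x)"
  by (induction A rule: infinite_finite_induct) auto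

lemma bilinear_forms_sum:
  assumes "vector_space s" "vector_space t" "\<And>i. i \<in> I \<Longrightarrow> \<beta> i \<in> bilinear_forms s t V W"
  shows "(\<lambda>v w. \<Sum>i\<in>I. \<beta> i v w) \<in> bilinear_forms s t V W"
  using assms(3) unfolding bilinear_forms_def linear_on_def
  by (auto simp: sum.distrib sum_distrib_left intro!: sum.cong)

lemma bilinear_forms_diff:
  assumes "\<beta> \<in> bilinear_forms s t V W" "\<gamma> \<in> bilinear_forms s t V W"
  shows "(\<lambda>v w. \<beta> v w - \<gamma> v w) \<in> bilinear_forms s t V W"
  using assms unfolding bilinear_forms_def linear_on_def by (simp add: algebra_simps)

lemma pure_tensor_apply:
  "\<beta> \<in> bilinear_forms (smul P) (smul Q) (ops P k) (ops Q k) \<Longrightarrow> pure_tensor P Q k p q \<beta> = \<beta> p q"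
  by (simp add: pure_tensor_def tensor_def)

lemma fits_update:
  "fits R ks rs \<Longrightarrow> i < length ks \<Longrightarrow> x \<in> ops R (ks ! i) \<Longrightarrow> fits R ks (rs[i := x])"
  by (auto simp: fits_def list_all2_conv_all_nth nth_list_update)

locale ocomp_pair =
  fixes P :: "('k::field, 'a::ab_group_add) operad" and Q :: "('k, 'b::ab_group_add) operad"
    and ks :: "nat list"
  assumes P: "multilinear_ocomp P ks" and Q: "multilinear_ocomp Q ks"

begin

abbreviation "forms k \<equiv> bilinear_forms (smul P) (smul Q) (ops P k) (ops Q k)"

abbreviation "pure k \<equiv> pure_tensor P Q k"

lemma ocomp_facts:
  "vector_space (smul P)" "vector_space (smul Q)"
  "module.subspace (smul P) (ops P k)" "module.subspace (smul Q) (ops Q k)"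
  "p \<in> ops P (length ks) \<Longrightarrow> fits P ks ps \<Longrightarrow> ocomp P ks p ps \<in> ops P (sum_list ks)"
  "q \<in> ops Q (length ks) \<Longrightarrow> fits Q ks qs \<Longrightarrow> ocomp Q ks q qs \<in> ops Q (sum_list ks)"
  using P Q by (auto simp: multilinear_ocomp_def)

lemma pure_cong:
  assumes "\<And>p q. p \<in> ops P k \<Longrightarrow> q \<in> ops Q k \<Longrightarrow> \<beta> p q = \<gamma> p q" "p \<in> ops P k" "q \<in> ops Q k"
  shows "pure k p q \<beta> = pure k p q \<gamma>"
  by (rule pure_tensor_cong) (use assms ocomp_facts in auto)

text \<open>A pure tensor returns 0 on forms that are not bilinear on the given subspaces, so this
  is needed before a slot of a composite can be evaluated.\<close>

lemma slot_form:
  assumes "p \<in> ops P (length ks)" "q \<in> ops Q (length ks)" "fits P ks ps" "fits Q ks qs" "i < length ks"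
    and "\<beta> \<in> forms (sum_list ks)"
  shows "(\<lambda>x y. \<beta> (ocomp P ks p (ps[i := x])) (ocomp Q ks q (qs[i := y]))) \<in> forms (ks ! i)"
proof -
  have "linear_on (smul P) (smul P) (ops P (ks ! i)) (\<lambda>x. ocomp P ks p (ps[i := x]))"
    "linear_on (smul Q) (smul Q) (ops Q (ks ! i)) (\<lambda>y. ocomp Q ks q (qs[i := y]))"
    using P Q assms unfolding multilinear_ocomp_def by blast+
  with assms(6) show ?thesis
    unfolding bilinear_forms_def linear_on_def
    by (simp add: ocomp_facts fits_update assms)
qed

lemma head_form:
  assumes "fits P ks ps" "fits Q ks qs" "\<beta> \<in> forms (sum_list ks)"
  shows "(\<lambda>p q. \<beta> (ocomp P ks p ps) (ocomp Q ks q qs)) \<in> forms (length ks)"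
proof -
  have "linear_on (smul P) (smul P) (ops P (length ks)) (\<lambda>p. ocomp P ks p ps)" if "p \<in> ops P (length ks)" for p
    using P that assms unfolding multilinear_ocomp_def by blast
  moreover have "linear_on (smul Q) (smul Q) (ops Q (length ks)) (\<lambda>q. ocomp Q ks q qs)" if "q \<in> ops Q (length ks)" for q
    using Q that assms unfolding multilinear_ocomp_def by blast
  ultimately show ?thesis
    using assms(3) unfolding bilinear_forms_def linear_on_def by (simp add: ocomp_facts assms)
qed

text \<open>The shape of F \<circ> (\<alpha>(\<nu>), id, ..., id) for a pure tensor F: the first
  input is a difference because \<open>alpha_nu\<close> is one.\<close>

lemma ocomp_hadamard_diff:
  assumes p: "p \<in> ops P (length ks)" "q \<in> ops Q (length ks)"
    and ks: "ks = k # ls"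
    and a: "a \<in> ops P k" "a' \<in> ops P k" "b \<in> ops Q k" "b' \<in> ops Q k"
    and fits: "fits P ls ps" "fits Q ls qs"
  shows "ocomp (hadamard P Q) ks (pure (length ks) p q)
      ((pure k a b - pure k a' b') # map (\<lambda>(k, p, q). pure k p q) (zip ls (zip ps qs))) =
    pure (sum_list ks) (ocomp P ks p (a # ps)) (ocomp Q ks q (b # qs)) -
    pure (sum_list ks) (ocomp P ks p (a' # ps)) (ocomp Q ks q (b' # qs))"
proof
  fix \<beta> :: "'a \<Rightarrow> 'b \<Rightarrow> 'k"
  let ?Gs = "map (\<lambda>(k, p, q). pure k p q) (zip ls (zip ps qs))"
  let ?X = "\<lambda>a b p q. \<beta> (ocomp P ks p (a # ps)) (ocomp Q ks q (b # qs))"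
  show "ocomp (hadamard P Q) ks (pure (length ks) p q) ((pure k a b - pure k a' b') # ?Gs) \<beta> =
    (pure (sum_list ks) (ocomp P ks p (a # ps)) (ocomp Q ks q (b # qs)) -
     pure (sum_list ks) (ocomp P ks p (a' # ps)) (ocomp Q ks q (b' # qs))) \<beta>"
  proof (cases "\<beta> \<in> forms (sum_list ks)")
    case False
    then show ?thesis by (simp add: hadamard_def Let_def pure_tensor_def tensor_def)
  next
    case True
    have fits': "fits P ks (x # ps)" "fits Q ks (y # qs)" if "x \<in> ops P k" "y \<in> ops Q k" for x y
      using that fits by (simp_all add: fits_def ks)
    have feed: "feed (pure k x y # ?Gs) (\<lambda>ps qs. \<beta> (ocomp P ks p ps) (ocomp Q ks q qs)) = ?X x y p q"
      if "x \<in> ops P k" "y \<in> ops Q k" "p \<in> ops P (length ks)" "q \<in> ops Q (length ks)" for x y p q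
      using feed_pure_tensors[OF ocomp_facts(1,3,2,4) fits'[OF that(1,2)],
          of "\<lambda>ps qs. \<beta> (ocomp P ks p ps) (ocomp Q ks q qs)"] slot_form[OF that(3,4) _ _ _ True]
      by (simp add: ks)
    have "ocomp (hadamard P Q) ks (pure (length ks) p q) ((pure k a b - pure k a' b') # ?Gs) \<beta> =
      pure (length ks) p q (\<lambda>p q. feed (pure k a b # ?Gs) (\<lambda>ps qs. \<beta> (ocomp P ks p ps) (ocomp Q ks q qs)) -
        feed (pure k a' b' # ?Gs) (\<lambda>ps qs. \<beta> (ocomp P ks p ps) (ocomp Q ks q qs)))"
      using True by (simp add: hadamard_def Let_def)
    also have "\<dots> = pure (length ks) p q (\<lambda>p q. ?X a b p q - ?X a' b' p q)"
      by (rule pure_cong) (simp_all only: feed a p)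
    also have "\<dots> = ?X a b p q - ?X a' b' p q"
      using a by (intro pure_tensor_apply bilinear_forms_diff head_form fits' True)
    also have "\<dots> = (pure (sum_list ks) (ocomp P ks p (a # ps)) (ocomp Q ks q (b # qs)) -
        pure (sum_list ks) (ocomp P ks p (a' # ps)) (ocomp Q ks q (b' # qs))) \<beta>"
      by (simp add: pure_tensor_apply True)
    finally show ?thesis .
  qed
qed

text \<open>The shape of \<alpha>(\<nu>) \<circ> (id, F) for one of the two pure tensors in
  \<alpha>(\<nu>), with F expanded over the monomials.\<close>

lemma ocomp_hadamard_sum:
  assumes ks: "ks = [k, l]" and p: "p \<in> ops P 2" "q \<in> ops Q 2" and a: "a \<in> ops P k" "b \<in> ops Q k"
    and c: "\<And>i. i \<in> I \<Longrightarrow> c i \<in> ops P l" "\<And>i. i \<in> I \<Longrightarrow> d i \<in> ops Q l"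
  shows "ocomp (hadamard P Q) ks (pure 2 p q) [pure k a b, \<Sum>i\<in>I. pure l (c i) (d i)] =
    (\<Sum>i\<in>I. pure (k + l) (ocomp P ks p [a, c i]) (ocomp Q ks q [b, d i]))"
proof
  fix \<beta> :: "'a \<Rightarrow> 'b \<Rightarrow> 'k"
  let ?X = "\<lambda>a b i p q. \<beta> (ocomp P ks p [a, c i]) (ocomp Q ks q [b, d i])"
  have sum: "sum_list ks = k + l" and len: "length ks = 2" by (simp_all add: ks)
  show "ocomp (hadamard P Q) ks (pure 2 p q) [pure k a b, \<Sum>i\<in>I. pure l (c i) (d i)] \<beta> =
    (\<Sum>i\<in>I. pure (k + l) (ocomp P ks p [a, c i]) (ocomp Q ks q [b, d i])) \<beta>"
  proof (cases "\<beta> \<in> forms (k + l)")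
    case False
    then show ?thesis by (simp add: hadamard_def Let_def pure_tensor_def tensor_def sum_fun_apply sum)
  next
    case True
    note \<beta> = True[folded sum]
    have fits: "fits P ks [x, z]" "fits Q ks [y, w]"
      if "x \<in> ops P k" "y \<in> ops Q k" "z \<in> ops P l" "w \<in> ops Q l" for x y z w
      using that by (simp_all add: fits_def ks)
    \<comment> \<open>A placeholder for the slot that \<open>slot_form\<close> overwrites.\<close>
    have zero: "0 \<in> ops P m" "0 \<in> ops Q m" for m
      using module.subspace_0[OF _ ocomp_facts(3)] module.subspace_0[OF _ ocomp_facts(4)]
        ocomp_facts(1,2) by (simp_all add: module_iff_vector_space)
    have inner: "(\<lambda>z w. \<beta> (ocomp P ks p [x, z]) (ocomp Q ks q [y, w])) \<in> forms l"
      if "x \<in> ops P k" "y \<in> ops Q k" "p \<in> ops P 2" "q \<in> ops Q 2" for x y p q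
      using slot_form[OF _ _ fits[OF that(1,2) zero] _ \<beta>, of p q 1] that by (simp add: ks numeral_2_eq_2)
    have middle: "(\<lambda>x y. ?X x y i p q) \<in> forms k" if "i \<in> I" "p \<in> ops P 2" "q \<in> ops Q 2" for i p q
      using slot_form[OF _ _ fits[OF a c[OF that(1)]] _ \<beta>, of p q 0] that by (simp add: ks numeral_2_eq_2)
    have outer: "(\<lambda>p q. ?X a b i p q) \<in> forms 2" if "i \<in> I" for i
      using head_form[OF fits[OF a c[OF that]] \<beta>] by (simp add: len)
    have "ocomp (hadamard P Q) ks (pure 2 p q) [pure k a b, \<Sum>i\<in>I. pure l (c i) (d i)] \<beta> =
      pure 2 p q (\<lambda>p q. pure k a b (\<lambda>x y. \<Sum>i\<in>I. pure l (c i) (d i)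
        (\<lambda>z w. \<beta> (ocomp P ks p [x, z]) (ocomp Q ks q [y, w]))))"
      using \<beta> by (simp add: hadamard_def Let_def sum_fun_apply)
    also have "\<dots> = pure 2 p q (\<lambda>p q. pure k a b (\<lambda>x y. \<Sum>i\<in>I. ?X x y i p q))"
      by (intro pure_cong p a sum.cong refl pure_tensor_apply inner)
    also have "\<dots> = pure 2 p q (\<lambda>p q. \<Sum>i\<in>I. ?X a b i p q)"
      by (intro pure_cong p pure_tensor_apply bilinear_forms_sum ocomp_facts middle)
    also have "\<dots> = (\<Sum>i\<in>I. ?X a b i p q)"
      by (intro pure_tensor_apply bilinear_forms_sum ocomp_facts outer)
    finally show ?thesis by (simp add: sum_fun_apply pure_tensor_apply True)
  qed
qed

end

lemma ocomp_hadamard_outer_sum: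
  "ocomp (hadamard P Q) ks (\<Sum>i\<in>I. F i) Gs = (\<Sum>i\<in>I. ocomp (hadamard P Q) ks (F i) Gs)"
  "ocomp (hadamard P Q) ks (F1 - F2) Gs = ocomp (hadamard P Q) ks F1 Gs - ocomp (hadamard P Q) ks F2 Gs"
  by (auto simp: hadamard_def Let_def fun_eq_iff sum_fun_apply)

context multilinear_operations
begin

section \<open>Components of elements of the Hadamard product\<close>

abbreviation pt :: "nat \<Rightarrow> 'k free_perm \<Rightarrow> ('v list \<Rightarrow> 'v) \<Rightarrow> ('k free_perm \<Rightarrow> ('v list \<Rightarrow> 'v) \<Rightarrow> 'k) \<Rightarrow> 'k" where
  "pt n \<equiv> pure_tensor perm_operad (end_operad scale) n"

abbreviation act_end :: "nat \<Rightarrow> (nat \<Rightarrow> nat) \<Rightarrow> ('v list \<Rightarrow> 'v) \<Rightarrow> 'v list \<Rightarrow> 'v" where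
  "act_end \<equiv> act (end_operad scale)"

definition tens :: "nat \<Rightarrow> (nat \<Rightarrow> 'v list \<Rightarrow> 'v) \<Rightarrow> ('k free_perm \<Rightarrow> ('v list \<Rightarrow> 'v) \<Rightarrow> 'k) \<Rightarrow> 'k" where
  "tens n G = (\<Sum>i<n. pt n (monomial n i) (G i))"

lemma smul_perm_end [simp]: "smul (perm_end scale) = scale_fun (*)"
  by (simp add: hadamard_def Let_def)

lemma ops_perm_end: "ops (perm_end scale) n = tensor_product perm_scale (scale_fun scale) (perm_span {..<n}) (End_ops n)"
  by (simp add: hadamard_def Let_def)

lemma idop_perm_end: "idop (perm_end scale) = pt 1 (perm_var 0) (idop (end_operad scale))"
  by (simp add: hadamard_def Let_def)

lemma vector_space_functionals: "vector_space (scale_fun (*) :: 'k \<Rightarrow> ('x \<Rightarrow> 'k) \<Rightarrow> _)"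
  by (intro vector_space_scale_fun vector_space_times)

lemma tens_apply: "tens n G \<beta> = (\<Sum>i<n. pt n (monomial n i) (G i) \<beta>)"
  by (simp add: tens_def sum_fun_apply)

lemma tens_cong: "(\<And>i. i < n \<Longrightarrow> G i = G' i) \<Longrightarrow> tens n G = tens n G'"
  by (simp add: tens_def)

lemma pt_linear_right:
  assumes "p \<in> perm_span {..<n}"
  shows "f \<in> End_ops n \<Longrightarrow> g \<in> End_ops n \<Longrightarrow> pt n p (f + g) = pt n p f + pt n p g"
    "f \<in> End_ops n \<Longrightarrow> pt n p (scale_fun scale c f) = scale_fun (*) c (pt n p f)"
  using linear_on_tensor(2)[OF assms, where s = perm_scale and t = "scale_fun scale" and W = "End_ops n"]
  by (simp_all add: linear_on_def pure_tensor_def)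

lemma pt_linear_left:
  assumes "f \<in> End_ops n"
  shows "p \<in> perm_span {..<n} \<Longrightarrow> q \<in> perm_span {..<n} \<Longrightarrow> pt n (p + q) f = pt n p f + pt n q f"
    "p \<in> perm_span {..<n} \<Longrightarrow> pt n (perm_scale c p) f = scale_fun (*) c (pt n p f)"
  using linear_on_tensor(1)[OF assms, where s = perm_scale and t = "scale_fun scale" and V = "perm_span {..<n}"]
  by (simp_all add: linear_on_def pure_tensor_def)

interpretation funs: vector_space "scale_fun scale :: 'k \<Rightarrow> ('v list \<Rightarrow> 'v) \<Rightarrow> _"
  by (rule vector_space_fun)

lemmas End_ops_add = funs.subspace_add[OF subspace_multilinear_maps]
  and End_ops_scale = funs.subspace_scale[OF subspace_multilinear_maps]
  and End_ops_zero = funs.subspace_0[OF subspace_multilinear_maps]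
  and End_ops_uminus = funs.subspace_neg[OF subspace_multilinear_maps]
  and End_ops_diff = funs.subspace_diff[OF subspace_multilinear_maps]
  and End_ops_sum = funs.subspace_sum[OF subspace_multilinear_maps]

interpretation functionals: vector_space "scale_fun (*) :: 'k \<Rightarrow> (('k free_perm \<Rightarrow> ('v list \<Rightarrow> 'v) \<Rightarrow> 'k) \<Rightarrow> 'k) \<Rightarrow> _"
  by (rule vector_space_functionals)

lemma tens_add:
  assumes "\<And>i. G i \<in> End_ops n" "\<And>i. G' i \<in> End_ops n"
  shows "tens n (\<lambda>i. G i + G' i) = tens n G + tens n G'"
  using assms unfolding tens_def sum.distrib[symmetric]
  by (intro sum.cong refl pt_linear_right(1) perm_span_monomial) auto

lemma tens_scale:
  assumes "\<And>i. G i \<in> End_ops n"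
  shows "tens n (\<lambda>i. scale_fun scale c (G i)) = scale_fun (*) c (tens n G)"
  using assms unfolding tens_def functionals.scale_sum_right
  by (intro sum.cong refl pt_linear_right(2) perm_span_monomial) auto

lemma tens_zero: "tens n (\<lambda>i. 0) = 0"
  using tens_add[of "\<lambda>i. 0" n "\<lambda>i. 0"] by (simp add: End_ops_zero)

lemma tens_diff:
  assumes "\<And>i. G i \<in> End_ops n" "\<And>i. G' i \<in> End_ops n"
  shows "tens n (\<lambda>i. G i - G' i) = tens n G - tens n G'"
  using tens_add[of "\<lambda>i. G i - G' i" n G'] assms by (simp add: End_ops_diff)

lemma tens_sum:
  assumes "\<And>i j. j \<in> J \<Longrightarrow> G j i \<in> End_ops n"
  shows "tens n (\<lambda>i. \<Sum>j\<in>J. G j i) = (\<Sum>j\<in>J. tens n (G j))"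
  using assms
  by (induction J rule: infinite_finite_induct) (auto simp: tens_zero tens_add End_ops_sum)

lemma pt_closed: "p \<in> perm_span {..<n} \<Longrightarrow> f \<in> End_ops n \<Longrightarrow> pt n p f \<in> ops (perm_end scale) n"
  unfolding ops_perm_end tensor_product_def pure_tensor_def
  by (rule module.span_base) (auto simp: module_iff_vector_space vector_space_functionals)

lemma subspace_ops_perm_end: "module.subspace (scale_fun (*)) (ops (perm_end scale) n)"
  unfolding ops_perm_end tensor_product_def
  by (rule module.subspace_span) (simp add: module_iff_vector_space vector_space_functionals)

lemma tens_closed: "(\<And>i. G i \<in> End_ops n) \<Longrightarrow> tens n G \<in> ops (perm_end scale) n"
  unfolding tens_def
  by (intro functionals.subspace_sum subspace_ops_perm_end pt_closed perm_span_monomial) auto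

text \<open>The elements \<open>tens n G\<close> form a subspace that contains all pure tensors,
  hence their span.\<close>

lemma tens_surj:
  assumes "F \<in> ops (perm_end scale) n"
  obtains G where "\<And>i. G i \<in> End_ops n" "F = tens n G"
proof -
  let ?R = "{tens n G | G. \<forall>i. G i \<in> End_ops n}"
  have R: "functionals.subspace ?R"
    unfolding functionals.subspace_def
  proof (intro conjI ballI allI)
    show "0 \<in> ?R" using tens_zero[of n] End_ops_zero by (auto intro!: exI[of _ "\<lambda>i. 0"])
    show "x + y \<in> ?R" if "x \<in> ?R" "y \<in> ?R" for x y
      using that tens_add[symmetric] End_ops_add by blast
    show "scale_fun (*) c x \<in> ?R" if "x \<in> ?R" for c x
      using that tens_scale[symmetric] End_ops_scale by blast
  qed
  have "pt n p f \<in> ?R" if "p \<in> perm_span {..<n}" "f \<in> End_ops n" for p f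
  proof -
    \<comment> \<open>Membership of \<open>p\<close> is carried along, because
      \<open>pt_linear_left\<close> gives additivity in \<open>p\<close> only within
      \<open>perm_span\<close>.\<close>
    have "p \<in> perm_span {..<n} \<and> pt n p f \<in> ?R"
      using that(1)
    proof (induction rule: perm_span_monomials_induct)
      case (monomial i)
      have zero: "pt n q 0 = 0" if "q \<in> perm_span {..<n}" for q
        using pt_linear_right(1)[OF that End_ops_zero End_ops_zero] by simp
      have "tens n (\<lambda>j. if j = i then f else 0) = (\<Sum>j<n. if j = i then pt n (monomial n i) f else 0)"
        unfolding tens_def by (rule sum.cong) (auto simp: zero perm_span_monomial)
      then have "pt n (monomial n i) f = tens n (\<lambda>j. if j = i then f else 0)"
        using monomial by simp
      then show ?case
        using that(2) monomial by (auto simp: perm_span_monomial End_ops_zero intro!: exI[of _ "\<lambda>j. if j = i then f else 0"])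
    next
      case (add p q)
      then have eq: "pt n (p + q) f = pt n p f + pt n q f" by (intro pt_linear_left that(2)) auto
      show ?case
        unfolding eq
        by (intro conjI functionals.subspace_add[OF R] perm.subspace_add[OF subspace_perm_span];
            (insert add, elim conjE, assumption))
    next
      case (scale c p)
      then have eq: "pt n (perm_scale c p) f = scale_fun (*) c (pt n p f)"
        by (intro pt_linear_left that(2)) auto
      show ?case
        unfolding eq
        by (intro conjI functionals.subspace_scale[OF R] perm.subspace_scale[OF subspace_perm_span];
            (insert scale, elim conjE, assumption))
    next
      case zero
      have pt0: "pt n 0 f = 0"
        using pt_linear_left(1)[OF that(2), of 0 0] perm.subspace_0[OF subspace_perm_span, of "{..<n}"] by simp
      show ?case
        unfolding pt0 by (intro conjI functionals.subspace_0[OF R] perm.subspace_0[OF subspace_perm_span])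
    qed
    then show ?thesis by simp
  qed
  then have "{tensor perm_scale (scale_fun scale) (perm_span {..<n}) (End_ops n) v w |v w.
      v \<in> perm_span {..<n} \<and> w \<in> End_ops n} \<subseteq> ?R"
    unfolding pure_tensor_def by auto
  then have "functionals.span {tensor perm_scale (scale_fun scale) (perm_span {..<n}) (End_ops n) v w |v w.
      v \<in> perm_span {..<n} \<and> w \<in> End_ops n} \<subseteq> ?R"
    by (rule functionals.span_minimal) (rule R)
  with assms have "F \<in> ?R" unfolding ops_perm_end tensor_product_def by blast
  then show ?thesis using that by blast
qed

text \<open>The universal property yields a linear map that sends p \<otimes> f to
  \<open>perm_coeff i p\<close> times f, and this reads off the component \<open>i\<close>.\<close>

lemma tens_inj:
  assumes "tens n G = tens n G'" "\<And>i. G i \<in> End_ops n" "\<And>i. G' i \<in> End_ops n" "i < n"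
  shows "G i = G' i"
proof -
  let ?h = "\<lambda>p f. scale_fun scale (perm_coeff i p) f"
  obtain L where L: "linear_on (scale_fun (*)) (scale_fun scale)
      (tensor_product perm_scale (scale_fun scale) (perm_span {..<n}) (End_ops n)) L"
    and Lt: "\<forall>p\<in>perm_span {..<n}. \<forall>f\<in>End_ops n.
      L (tensor perm_scale (scale_fun scale) (perm_span {..<n}) (End_ops n) p f) = ?h p f"
    using tensor_product_universal[OF vector_space_fun, of "End_ops n" perm_scale "perm_span {..<n}" ?h "scale_fun scale"]
    by (auto simp: linear_on_def perm_coeff_linear funs.scale_left_distrib funs.scale_right_distrib mult.commute)
  have L_add: "L (x + y) = L x + L y" if "x \<in> ops (perm_end scale) n" "y \<in> ops (perm_end scale) n" for x y
    using L that unfolding ops_perm_end linear_on_def by blast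
  have zero: "0 \<in> ops (perm_end scale) n" by (rule functionals.subspace_0[OF subspace_ops_perm_end])
  have L_sum: "L (\<Sum>j\<in>J. x j) = (\<Sum>j\<in>J. L (x j))" if "\<And>j. j \<in> J \<Longrightarrow> x j \<in> ops (perm_end scale) n"
    for x and J :: "nat set"
    using that
  proof (induction J rule: infinite_finite_induct)
    case (insert j J)
    have "L (x j + sum x J) = L (x j) + L (sum x J)"
      using insert.prems by (intro L_add functionals.subspace_sum[OF subspace_ops_perm_end]) auto
    moreover have "L (sum x J) = (\<Sum>j\<in>J. L (x j))" by (rule insert.IH) (use insert.prems in blast)
    ultimately show ?case by (simp only: sum.insert[OF insert.hyps])
  qed (use L_add[OF zero zero] in simp_all)
  have "L (tens n G) = G i" if "\<And>i. G i \<in> End_ops n" for G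
  proof -
    have "L (tens n G) = (\<Sum>j<n. L (pt n (monomial n j) (G j)))"
      unfolding tens_def by (rule L_sum) (simp add: pt_closed perm_span_monomial that)
    also have "\<dots> = (\<Sum>j<n. if j = i then G i else 0)"
      using Lt that
      by (intro sum.cong) (auto simp: pure_tensor_def perm_span_monomial perm_coeff_monomial)
    finally show ?thesis using assms(4) by simp
  qed
  with assms show ?thesis by metis
qed

text \<open>The monomial m_i becomes the one with last letter \<open>inv \<sigma> i\<close>;
  reindexing the sum by \<sigma> restores m_i.\<close>

lemma act_tens:
  assumes \<sigma>: "\<sigma> permutes {..<n}"
  shows "act (perm_end scale) n \<sigma> (tens n G) = tens n (\<lambda>i. act_end n \<sigma> (G (\<sigma> i)))"
proof -
  have "act (perm_end scale) n \<sigma> (tens n G) = (\<Sum>i<n. act (perm_end scale) n \<sigma> (pt n (monomial n i) (G i)))"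
    by (auto simp: hadamard_def Let_def fun_eq_iff sum_fun_apply tens_apply)
  also have "\<dots> = (\<Sum>i<n. pt n (monomial n (inv \<sigma> i)) (act_end n \<sigma> (G i)))"
    by (intro sum.cong refl, subst act_hadamard_pure_tensor)
      (auto simp: linear_on_act_perm linear_on_act_end act_perm_closed act_end_closed act_perm_monomial \<sigma>)
  also have "\<dots> = (\<Sum>i<n. pt n (monomial n (inv \<sigma> (\<sigma> i))) (act_end n \<sigma> (G (\<sigma> i))))"
    by (rule sum.permute[OF \<sigma>, unfolded o_def])
  finally show ?thesis by (simp add: tens_def permutes_inverses[OF \<sigma>])
qed

lemma pt_uminus_right:
  assumes "p \<in> perm_span {..<n}" "f \<in> End_ops n"
  shows "pt n p (- f) = - pt n p f"
proof -
  have "pt n p 0 = 0" using pt_linear_right(1)[OF assms(1) End_ops_zero End_ops_zero] by simp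
  with pt_linear_right(1)[OF assms End_ops_uminus[OF assms(2)]] show ?thesis
    by (simp add: eq_neg_iff_add_eq_0 add.commute)
qed

lemma pt_diff_right:
  assumes "p \<in> perm_span {..<n}" "f \<in> End_ops n" "g \<in> End_ops n"
  shows "pt n p (f - g) = pt n p f - pt n p g"
  using pt_linear_right(1)[OF assms(1,2) End_ops_uminus[OF assms(3)]] pt_uminus_right[OF assms(1,3)]
  by (simp only: diff_conv_add_uminus)

lemma perm_var_0: "perm_var 0 = monomial 1 0"
  by (simp add: monom_word_def)

end

section \<open>Skew-symmetric elements\<close>

context multilinear_operations
begin

definition sgn_scale :: "(nat \<Rightarrow> nat) \<Rightarrow> 'v \<Rightarrow> 'v" where
  "sgn_scale \<sigma> = scale (of_int (sign \<sigma>))"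

lemma sgn_scale_linear:
  "sgn_scale \<sigma> (x + y) = sgn_scale \<sigma> x + sgn_scale \<sigma> y"
  "sgn_scale \<sigma> (x - y) = sgn_scale \<sigma> x - sgn_scale \<sigma> y"
  "sgn_scale \<sigma> (- x) = - sgn_scale \<sigma> x"
  "sgn_scale \<sigma> (\<Sum>i\<in>I. f i) = (\<Sum>i\<in>I. sgn_scale \<sigma> (f i))"
  by (simp_all add: sgn_scale_def scale_right_distrib scale_right_diff_distrib scale_sum_right)

lemma sgn_scale_compose:
  assumes "permutation \<sigma>" "permutation \<tau>"
  shows "sgn_scale (\<sigma> \<circ> \<tau>) x = sgn_scale \<sigma> (sgn_scale \<tau> x)"
  unfolding sgn_scale_def sign_compose[OF assms] by simp

lemma sgn_scale_self [simp]: "sgn_scale \<sigma> (sgn_scale \<sigma> x) = x"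
  by (simp add: sgn_scale_def flip: of_int_mult)

lemma sgn_scale_inv: "permutation \<sigma> \<Longrightarrow> sgn_scale (inv \<sigma>) = sgn_scale \<sigma>"
  by (simp add: sgn_scale_def sign_inverse)

lemma sgn_scale_transpose: "a \<noteq> b \<Longrightarrow> sgn_scale (transpose a b) x = - x"
  by (simp add: sgn_scale_def sign_swap_id)

text \<open>F^\<sigma> = sgn(\<sigma>) F, read in components. On lists of other lengths the
  components are 0 anyway.\<close>

definition skew :: "nat \<Rightarrow> (nat \<Rightarrow> 'v list \<Rightarrow> 'v) \<Rightarrow> bool" where
  "skew n G \<longleftrightarrow> (\<forall>\<sigma>. \<sigma> permutes {..<n} \<longrightarrow> (\<forall>i xs. i < n \<longrightarrow> length xs = n \<longrightarrow>
     G (\<sigma> i) (permute_list (inv \<sigma>) xs) = sgn_scale \<sigma> (G i xs)))"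

lemma CE_tens_iff:
  assumes G: "\<And>i. G i \<in> End_ops n"
  shows "tens n G \<in> CE (perm_end scale) n \<longleftrightarrow> skew n G"
proof -
  have "act (perm_end scale) n \<sigma> (tens n G) = scale_fun (*) (of_int (sign \<sigma>)) (tens n G) \<longleftrightarrow>
      (\<forall>i xs. i < n \<longrightarrow> length xs = n \<longrightarrow> G (\<sigma> i) (permute_list (inv \<sigma>) xs) = sgn_scale \<sigma> (G i xs))"
    if \<sigma>: "\<sigma> permutes {..<n}" for \<sigma>
  proof -
    let ?A = "\<lambda>i. act_end n \<sigma> (G (\<sigma> i))" and ?B = "\<lambda>i. scale_fun scale (of_int (sign \<sigma>)) (G i)"
    have "act (perm_end scale) n \<sigma> (tens n G) = scale_fun (*) (of_int (sign \<sigma>)) (tens n G) \<longleftrightarrow>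
        tens n ?A = tens n ?B"
      using G by (simp only: act_tens[OF \<sigma>] tens_scale)
    also have "\<dots> \<longleftrightarrow> (\<forall>i<n. ?A i = ?B i)"
      using tens_inj[of n ?A ?B] tens_cong[of n ?A ?B] act_end_closed[OF \<sigma> G] End_ops_scale[OF G] by blast
    also have "\<dots> \<longleftrightarrow> (\<forall>i xs. i < n \<longrightarrow> length xs = n \<longrightarrow> ?A i xs = ?B i xs)"
    proof -
      have "?A i xs = ?B i xs" if "length xs \<noteq> n" for i xs
        using multilinear_mapsD(2)[OF G] that by (simp add: act_end_operad scale_fun_def)
      then show ?thesis by (metis ext)
    qed
    finally show ?thesis by (simp add: act_end_operad scale_fun_def sgn_scale_def)
  qed
  then show ?thesis using tens_closed[OF G] by (auto simp: CE_def skew_def)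
qed

lemma skew_transpose:
  assumes "skew n G" "a < n" "b < n" "a \<noteq> b" "i < n" "length xs = n"
  shows "G (transpose a b i) (permute_list (transpose a b) xs) = - G i xs"
proof -
  have "transpose a b permutes {..<n}" using assms by (intro permutes_swap_id) auto
  then have "G (transpose a b i) (permute_list (inv (transpose a b)) xs) = sgn_scale (transpose a b) (G i xs)"
    using assms unfolding skew_def by blast
  then show ?thesis using assms(4) by (simp add: sgn_scale_transpose)
qed

text \<open>The formula is forced by \<open>skew\<close> for the permutation that sends
  \<open>i\<close> to \<open>n - 1\<close> and keeps the order of the rest. The value 0 from
  \<open>n\<close> on makes every component multilinear.\<close>

definition from_cochain :: "nat \<Rightarrow> ('v list \<Rightarrow> 'v) \<Rightarrow> nat \<Rightarrow> 'v list \<Rightarrow> 'v" where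
  "from_cochain n f i =
     (if i < n then scale_fun scale (of_int (sign (to_back n i))) (act_end n (inv (to_back n i)) f) else 0)"

lemma from_cochain_closed: "f \<in> End_ops n \<Longrightarrow> from_cochain n f i \<in> End_ops n"
  unfolding from_cochain_def
  by (auto intro!: End_ops_scale act_end_closed permutes_inv to_back_permutes End_ops_zero)

lemma from_cochain_apply:
  "i < n \<Longrightarrow> from_cochain n f i xs = sgn_scale (to_back n i) (f (permute_list (to_back n i) xs))"
  by (simp add: from_cochain_def scale_fun_def act_end_operad sgn_scale_def
      permutes_inv_inv[OF to_back_permutes])

lemma from_cochain_last:
  assumes "n \<ge> 1"
  shows "from_cochain n f (n - 1) = f"
proof
  fix xs
  have "to_back n (n - 1) = id" "n - 1 < n" using to_back_last[of "n - 1"] assms by auto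
  then show "from_cochain n f (n - 1) xs = f xs"
    unfolding from_cochain_apply[OF \<open>n - 1 < n\<close>] \<open>to_back n (n - 1) = id\<close>
    by (simp add: sgn_scale_def)
qed

text \<open>Polarisation in the positions \<open>a\<close> and \<open>b\<close>, which need not be
  neighbours.\<close>

lemma pLie_cochain_transpose:
  assumes f: "f \<in> pLie_cochains scale n" and xs: "length xs = n" and ab: "a < n - 1" "b < n - 1" "a \<noteq> b"
  shows "f (permute_list (transpose a b) xs) = - f xs"
proof -
  have m: "f \<in> End_ops n" using f by (simp add: pLie_cochains_iff)
  define h where "h u v = f (xs[a := u, b := v])" for u v
  have "Vector_Spaces.linear scale scale (h u)" for u
    unfolding h_def using End_ops_linear[OF m, of "xs[a := u]" b] ab xs by simp
  note h2 = linearD(1)[OF this]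
  have "Vector_Spaces.linear scale scale (\<lambda>u. h u v)" for v
    unfolding h_def list_update_swap[OF ab(3)] using End_ops_linear[OF m, of "xs[b := v]" a] ab xs by simp
  note h1 = linearD(1)[OF this]
  have zero: "h u u = 0" for u
  proof -
    have "f ys = 0" if "length ys = n" "ys ! i = ys ! j" "i < j" "j < n - 1" for ys i j
      using f that by (auto simp: pLie_cochains_def)
    from this[of "xs[a := u, b := u]" "min a b" "max a b"] ab xs show ?thesis
      unfolding h_def by (auto simp: min_def max_def nth_list_update)
  qed
  have "h v u + h u v = 0" for u v
  proof -
    have "h (u + v) (u + v) = h u u + h v u + (h u v + h v v)" by (simp only: h1 h2)
    then show ?thesis unfolding zero by simp
  qed
  then have "h u v = - h v u" for u v
    by (rule eq_neg_iff_add_eq_0[THEN iffD2])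
  moreover have "permute_list (transpose a b) xs = xs[a := xs ! b, b := xs ! a]"
    by (rule nth_equalityI) (use ab xs in \<open>auto simp: permute_list_def transpose_def nth_list_update\<close>)
  moreover have "xs = xs[a := xs ! a, b := xs ! b]" by simp
  ultimately show ?thesis unfolding h_def by metis
qed

lemma pLie_cochain_permute:
  assumes f: "f \<in> pLie_cochains scale n" and p: "p permutes {..<n - 1}" and xs: "length xs = n"
  shows "f (permute_list p xs) = sgn_scale p (f xs)"
proof -
  have "finite {..<n - 1}" by simp
  with p show ?thesis using xs
  proof (induction arbitrary: xs rule: permutes_induct)
    case id
    then show ?case by (simp add: sgn_scale_def)
  next
    case (swap a b p)
    have "{..<n - 1} \<subseteq> {..<n}" by auto
    with swap.hyps(4) swap.prems have pn: "p permutes {..<length xs}" using permutes_subset by metis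
    have "f (permute_list (transpose a b \<circ> p) xs) = sgn_scale p (f (permute_list (transpose a b) xs))"
      unfolding permute_list_compose[OF pn] by (rule swap.IH) (simp add: swap.prems)
    also have "\<dots> = sgn_scale p (- f xs)"
      using swap.hyps swap.prems by (subst pLie_cochain_transpose[OF f]) auto
    also have "\<dots> = sgn_scale (transpose a b \<circ> p) (f xs)"
    proof -
      have "permutation p" using pn by (auto simp: permutation_permutes)
      then show ?thesis
        unfolding sgn_scale_compose[OF permutation_swap_id \<open>permutation p\<close>]
        by (simp add: sgn_scale_transpose[OF swap.hyps(3)] sgn_scale_linear)
    qed
    finally show ?case .
  qed
qed

text \<open>The two rearrangements that bring the distinguished argument to the end differ by a
  permutation of the first n - 1 arguments, under which \<open>f\<close> picks up the sign.\<close>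

lemma from_cochain_skew:
  assumes f: "f \<in> pLie_cochains scale n"
  shows "skew n (from_cochain n f)"
  unfolding skew_def
proof (intro allI impI)
  fix \<sigma> i and xs :: "'v list"
  assume \<sigma>: "\<sigma> permutes {..<n}" and i: "i < n" and xs: "length xs = n"
  let ?j = "\<sigma> i"
  have j: "?j < n" using permutes_in_image[OF \<sigma>, of i] i by simp
  note ei = to_back_permutes[OF i] and ej = to_back_permutes[OF j]
  have last: "to_back n k (n - 1) = k" if "k < n" for k
    using that by (auto simp: to_back_def)
  \<comment> \<open>Chosen so that \<open>to_back n i \<circ> ?\<rho> = inv \<sigma> \<circ> to_back
    n (\<sigma> i)\<close>. The right-hand side and \<open>to_back n i\<close> both send
    \<open>n - 1\<close> to \<open>i\<close>, so \<open>?\<rho>\<close> fixes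
    \<open>n - 1\<close>.\<close>
  let ?\<rho> = "inv (to_back n i) \<circ> (inv \<sigma> \<circ> to_back n ?j)"
  have q: "inv \<sigma> \<circ> to_back n ?j permutes {..<n}" by (intro permutes_compose ej permutes_inv \<sigma>)
  have \<rho>: "?\<rho> permutes {..<n}" by (intro permutes_compose q permutes_inv ei)
  have "?\<rho> (n - 1) = n - 1"
    using last[OF i] last[OF j] by (simp add: permutes_inverses[OF \<sigma>] permutes_inv_eq[OF ei])
  moreover have "x = n - 1" if "x \<in> {..<n} - {..<n - 1}" for x using that by auto
  ultimately have \<rho>': "?\<rho> permutes {..<n - 1}"
    by (intro permutes_superset[OF \<rho>]) metis
  have perm: "permutation p" if "p permutes {..<n}" for p
    using that by (auto simp: permutation_permutes)
  have eq: "to_back n i \<circ> ?\<rho> = inv \<sigma> \<circ> to_back n ?j"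
    by (simp only: comp_assoc[symmetric] permutes_inv_o(1)[OF ei] id_comp)
  have "permute_list (to_back n ?j) (permute_list (inv \<sigma>) xs) = permute_list (inv \<sigma> \<circ> to_back n ?j) xs"
    using permute_list_compose[of "to_back n ?j" xs] ej xs by simp
  also have "\<dots> = permute_list ?\<rho> (permute_list (to_back n i) xs)"
    using permute_list_compose[of ?\<rho> xs "to_back n i"] \<rho> xs unfolding eq by simp
  finally have "f (permute_list (to_back n ?j) (permute_list (inv \<sigma>) xs)) =
      sgn_scale ?\<rho> (f (permute_list (to_back n i) xs))"
    using pLie_cochain_permute[OF f \<rho>', of "permute_list (to_back n i) xs"] xs by simp
  then have "from_cochain n f ?j (permute_list (inv \<sigma>) xs) =
      sgn_scale (to_back n ?j) (sgn_scale ?\<rho> (f (permute_list (to_back n i) xs)))"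
    by (simp add: from_cochain_apply j)
  also have "\<dots> = sgn_scale \<sigma> (sgn_scale (to_back n i) (f (permute_list (to_back n i) xs)))"
  proof -
    have "sgn_scale ?\<rho> x = sgn_scale (to_back n i) (sgn_scale \<sigma> (sgn_scale (to_back n ?j) x))" for x
      by (simp only: sgn_scale_compose perm permutes_inv ei ej \<sigma> q sgn_scale_inv)
    moreover have "sgn_scale \<alpha> (sgn_scale \<beta> x) = sgn_scale \<beta> (sgn_scale \<alpha> x)" for \<alpha> \<beta> x
      by (simp add: sgn_scale_def mult.commute)
    ultimately show ?thesis by (metis sgn_scale_self)
  qed
  finally show "from_cochain n f ?j (permute_list (inv \<sigma>) xs) = sgn_scale \<sigma> (from_cochain n f i xs)"
    by (simp add: from_cochain_apply i)
qed

lemma skew_eq_from_cochain: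
  assumes "skew n G" "i < n" "length xs = n"
  shows "G i xs = from_cochain n (G (n - 1)) i xs"
proof -
  let ?\<sigma> = "inv (to_back n i)"
  note e = to_back_permutes[OF assms(2)]
  have "?\<sigma> i = n - 1" using assms(2) by (auto simp: permutes_inv_eq[OF e] to_back_def)
  moreover have "permutation (to_back n i)" using e by (auto simp: permutation_permutes)
  ultimately have "G (n - 1) (permute_list (to_back n i) xs) = sgn_scale (to_back n i) (G i xs)"
    using assms permutes_inv[OF e] unfolding skew_def
    by (metis permutes_inv_inv[OF e] sgn_scale_inv)
  then show ?thesis by (simp add: from_cochain_apply assms(2))
qed

lemma skew_apply:
  assumes "skew n G" "i < n" "length xs = n"
  shows "G i xs = scale ((- 1) ^ (n - 1 - i)) (G (n - 1) (del i xs @ [xs ! i]))"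
  using skew_eq_from_cochain[OF assms] permute_to_back[of i xs] assms
  by (simp add: from_cochain_apply sgn_scale_def sign_to_back)

text \<open>The shuffle \<sigma> is matched with the last letter of \<xi>_n^\<sigma>, whose index is
  \<open>inv \<sigma> (n - 1)\<close>.\<close>

lemma xi_sum_eq_tens:
  assumes "n \<ge> 1"
  shows "xi_sum scale n f = tens n (\<lambda>i. f (inv (to_back n i)))"
proof -
  have "xi_sum scale n f = (\<Sum>i<n. pt n (act perm_operad n (inv (to_back n i)) (xi n)) (f (inv (to_back n i))))"
    unfolding xi_sum_def by (rule sum.reindex_bij_betw[OF inv_shuffles_last[OF assms], symmetric])
  also have "\<dots> = tens n (\<lambda>i. f (inv (to_back n i)))"
    unfolding tens_def
  proof (rule sum.cong[OF refl])
    fix i assume "i \<in> {..<n}"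
    then have i: "i < n" by simp
    note e = to_back_permutes[OF i]
    have "act perm_operad n (inv (to_back n i)) (xi n) =
        (monomial n (inv (inv (to_back n i)) (n - 1)) :: 'k free_perm)"
      using assms by (simp add: xi_eq_monomial act_perm_monomial permutes_inv[OF e])
    also have "inv (inv (to_back n i)) (n - 1) = i"
      using i by (auto simp: permutes_inv_inv[OF e] to_back_def)
    finally show "pt n (act perm_operad n (inv (to_back n i)) (xi n)) (f (inv (to_back n i))) =
        pt n (monomial n i) (f (inv (to_back n i)))" by simp
  qed
  finally show ?thesis .
qed

lemma tens_eq_xi_sum:
  assumes "n \<ge> 1"
  shows "tens n G = xi_sum scale n (\<lambda>\<sigma>. G (inv \<sigma> (n - 1)))"
  unfolding xi_sum_eq_tens[OF assms]
  by (rule tens_cong) (auto simp: permutes_inv_inv[OF to_back_permutes] to_back_def)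

text \<open>By \<open>tens_inj\<close> two expansions of the same element have the same components,
  so the description in \<open>Omega\<close> has a unique solution.\<close>

lemma Omega_xi_sum:
  assumes n: "n \<ge> 1" and f: "\<forall>\<sigma>\<in>inv_shuffles (n - 1) 1. f \<sigma> \<in> End_ops n"
  shows "Omega scale n (xi_sum scale n f) = f id"
proof -
  have last: "inv (to_back n (n - 1)) = id" using to_back_last[of "n - 1"] n by simp
  have "g id = f id"
    if g: "\<forall>\<sigma>\<in>inv_shuffles (n - 1) 1. g \<sigma> \<in> End_ops n" "xi_sum scale n f = xi_sum scale n g" for g
  proof -
    \<comment> \<open>\<open>h\<close> is constrained on shuffles only; the cut-off makes every
      component multilinear, as \<open>tens_inj\<close> demands.\<close>
    let ?G = "\<lambda>h i. if i < n then h (inv (to_back n i)) else 0"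
    have G: "?G h i \<in> End_ops n" if "\<forall>\<sigma>\<in>inv_shuffles (n - 1) 1. h \<sigma> \<in> End_ops n" for h i
      using that bij_betwE[OF inv_shuffles_last[OF n]] by (auto simp: End_ops_zero)
    have "tens n (?G h) = xi_sum scale n h" for h
      unfolding xi_sum_eq_tens[OF n] by (rule tens_cong) simp
    then have "?G f (n - 1) = ?G g (n - 1)"
      using g n G[OF f] G[OF g(1)] by (intro tens_inj[of n]) auto
    then show ?thesis using n last by simp
  qed
  then show ?thesis
    unfolding Omega_def end_operad_simps
  proof (intro the_equality)
    show "\<exists>g. (\<forall>\<sigma>\<in>inv_shuffles (n - 1) 1. g \<sigma> \<in> End_ops n) \<and> xi_sum scale n f = xi_sum scale n g \<and> f id = g id"
      using f by (intro exI[of _ f]) simp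
  qed (elim exE conjE, simp)
qed

lemma Omega_tens:
  assumes "\<And>i. G i \<in> End_ops n" "n \<ge> 1"
  shows "Omega scale n (tens n G) = G (n - 1)"
  unfolding tens_eq_xi_sum[OF assms(2)] by (rule Omega_xi_sum[OF assms(2), THEN trans]) (simp_all add: assms(1))

end

section \<open>The Chevalley--Eilenberg differential\<close>

context pre_lie_algebra
begin

lemma omega_closed: "omega (\<diamond>) \<in> End_ops 2"
proof -
  have "omega (\<diamond>) (as @ u # bs) =
    (case (as, bs) of ([], [y]) \<Rightarrow> u \<diamond> y | ([x], []) \<Rightarrow> x \<diamond> u | _ \<Rightarrow> 0)" for as u bs
    by (auto simp: omega_def split: list.split)
  then have "multilin (omega (\<diamond>))"
    by (auto simp: multilin_def diamond_linear intro!: linearI split: list.split)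
  then show ?thesis by (rule multilinear_mapsI) (simp add: omega_def)
qed

abbreviation omega_op :: "'v list \<Rightarrow> 'v" where
  "omega_op \<equiv> act (end_operad scale) 2 (transpose 0 1) (omega (\<diamond>))"

lemma omega_op_closed: "omega_op \<in> End_ops 2"
  by (intro act_end_closed omega_closed permutes_swap_id) simp_all

lemma omega_pair: "omega (\<diamond>) [x, y] = x \<diamond> y" "omega_op [x, y] = y \<diamond> x"
  by (simp_all add: omega_def act_end_operad permute_list_def)

lemma ocomp_end_left:
  assumes "length ys = n"
  shows "ocomp (end_operad scale) [1, n] w [idop (end_operad scale), g] (x # ys) = w [x, g ys]"
  using assms by (simp add: ocomp_end_operad idop_end_operad)

lemma ocomp_end_right:
  assumes "length zs = n - 1" "n \<ge> 1"
  shows "ocomp (end_operad scale) (2 # replicate (n - 1) 1) g (w # replicate (n - 1) (idop (end_operad scale)))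
    (x # y # zs) = g (w [x, y] # zs)"
proof -
  have "offset (replicate m 1) i = i" if "i \<le> m" for i m
    using that by (simp add: offset_def sum_list_replicate)
  then have "map (\<lambda>i. ((w # replicate (n - 1) (idop (end_operad scale))) ! i)
      (take ((2 # replicate (n - 1) 1) ! i) (drop (offset (2 # replicate (n - 1) 1) i) (x # y # zs))))
      [0..<length (2 # replicate (n - 1) (1::nat))] = w [x, y] # zs"
    using assms by (intro nth_equalityI) (auto simp: idop_end_operad nth_Cons hd_drop_conv_nth take_Suc split: nat.split)
  then show ?thesis using assms by (simp add: ocomp_end_operad sum_list_replicate)
qed

text \<open>
  The components of \<open>\<alpha>(\<nu>) \<circ> (id, G)\<close> and \<open>G \<circ> (\<alpha>(\<nu>), id, \<dots>, id)\<close>. Multiplying a monomial by a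
  variable on the left keeps its last letter, whereas multiplying it on the right by \<open>x\<^sub>0\<close> gives \<open>m\<^sub>0\<close>
  for every monomial: hence the sum in \<open>left_comp n G 0\<close>.
\<close>

definition left_comp :: "nat \<Rightarrow> (nat \<Rightarrow> 'v list \<Rightarrow> 'v) \<Rightarrow> nat \<Rightarrow> 'v list \<Rightarrow> 'v" where
  "left_comp n G i = (let c = (\<lambda>w g. ocomp (end_operad scale) [1, n] w [idop (end_operad scale), g]) in
     if i = 0 then - (\<Sum>j<n. c omega_op (G j)) else c (omega (\<diamond>)) (G (i - 1)))"

definition right_comp :: "nat \<Rightarrow> (nat \<Rightarrow> 'v list \<Rightarrow> 'v) \<Rightarrow> nat \<Rightarrow> 'v list \<Rightarrow> 'v" where
  "right_comp n G i = (let c = (\<lambda>w g. ocomp (end_operad scale) (2 # replicate (n - 1) 1) g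
        (w # replicate (n - 1) (idop (end_operad scale)))) in
     if i = 0 then - c omega_op (G 0) else if i = 1 then c (omega (\<diamond>)) (G 0)
     else c (omega (\<diamond>)) (G (i - 1)) - c omega_op (G (i - 1)))"

lemma alpha_nu_eq: "alpha_nu scale (\<diamond>) = pt 2 (monomial 2 1) (omega (\<diamond>)) - pt 2 (monomial 2 0) omega_op"
proof -
  have "transpose 0 1 permutes {..<2::nat}" by (rule permutes_swap_id) simp_all
  then show ?thesis
    by (simp add: alpha_nu_def xi_eq_monomial act_perm_monomial)
qed

lemma left_comp_closed:
  assumes "\<And>i. G i \<in> End_ops n"
  shows "left_comp n G i \<in> End_ops (n + 1)"
proof -
  have "ocomp (end_operad scale) [1, n] w [idop (end_operad scale), G j] \<in> End_ops (n + 1)"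
    if "w \<in> End_ops 2" for w j
    using ocomp_end_closed[of w "[1, n]", OF _ fits_left[OF assms]] that by (simp add: numeral_2_eq_2)
  then show ?thesis
    using omega_closed omega_op_closed
    by (auto simp: left_comp_def Let_def intro!: End_ops_uminus End_ops_sum)
qed

lemma ocomp_alpha_left:
  assumes "\<And>i. G i \<in> End_ops n"
  shows "ocomp (perm_end scale) [1, n] (alpha_nu scale (\<diamond>)) [idop (perm_end scale), tens n G] =
    tens (n + 1) (left_comp n G)"
proof -
  interpret ocomp_pair perm_operad "end_operad scale" "[1, n]"
    by unfold_locales (rule multilinear_ocomp_perm multilinear_ocomp_end)+
  have id: "idop (perm_end scale) = pt 1 (monomial 1 0) (idop (end_operad scale))"
    by (simp only: idop_perm_end perm_var_0)
  let ?c = "\<lambda>w g. ocomp (end_operad scale) [1, n] w [idop (end_operad scale), g]"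
  have c: "?c w (G j) \<in> End_ops (n + 1)" if "w \<in> End_ops 2" for w j
    using ocomp_end_closed[of w "[1, n]", OF _ fits_left[OF assms]] that by (simp add: numeral_2_eq_2)
  \<comment> \<open>If the outer monomial ends in its first input, the composite ends in x_0;
    otherwise it ends in the last letter of the second block, which starts at 1.\<close>
  have mono: "ocomp perm_operad [1, n] (monomial 2 l) [monomial 1 0, monomial n j] =
    monomial (n + 1) (if l = 0 then 0 else j + 1)" if "l < 2" "j < n" for l j
  proof -
    let ?js = "\<lambda>i. if i = 0 then 0 else j"
    have "?js i < [1, n] ! i \<and> [monomial 1 0, monomial n j] ! i = monomial ([1, n] ! i) (?js i)"
      if "i < length [1, n]" for i
      using that \<open>j < n\<close> by (cases i) auto
    then have "ocomp perm_operad [1, n] (monomial (length [1, n]) l) [monomial 1 0, monomial n j] =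
        monomial (sum_list [1, n]) (offset [1, n] l + ?js l)"
      using that by (intro ocomp_perm_monomials) auto
    moreover have "offset [1, n] l + ?js l = (if l = 0 then 0 else j + 1)"
      using that by (cases l) auto
    ultimately show ?thesis by (simp add: numeral_2_eq_2)
  qed
  have "ocomp (perm_end scale) [1, n] (pt 2 (monomial 2 l) w) [idop (perm_end scale), tens n G] =
      (\<Sum>j<n. pt (n + 1) (monomial (n + 1) (if l = 0 then 0 else j + 1)) (?c w (G j)))"
    if "l < 2" "w \<in> End_ops 2" for l w
    unfolding id tens_def using that assms
    by (subst ocomp_hadamard_sum)
      (auto simp: perm_span_monomial perm_span_monomial[of 0 1, simplified] idop_end_closed mono add.commute[of 1]
        simp del: One_nat_def intro!: sum.cong)
  from this[OF _ omega_closed, of 1] this[OF _ omega_op_closed, of 0]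
  have "ocomp (perm_end scale) [1, n] (alpha_nu scale (\<diamond>)) [idop (perm_end scale), tens n G] =
      (\<Sum>j<n. pt (n + 1) (monomial (n + 1) (j + 1)) (?c (omega (\<diamond>)) (G j))) -
      (\<Sum>j<n. pt (n + 1) (monomial (n + 1) 0) (?c omega_op (G j)))"
    by (simp add: alpha_nu_eq ocomp_hadamard_outer_sum)
  also have "(\<Sum>j<n. pt (n + 1) (monomial (n + 1) 0) (?c omega_op (G j))) =
      - pt (n + 1) (monomial (n + 1) 0) (left_comp n G 0)"
  proof -
    have m: "monomial (n + 1) 0 \<in> perm_span {..<n + 1}" by (rule perm_span_monomial) simp
    have z: "pt (n + 1) (monomial (n + 1) 0) 0 = 0"
      using pt_linear_right(1)[OF m End_ops_zero End_ops_zero] by simp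
    have neg: "pt (n + 1) (monomial (n + 1) 0) (- f) = - pt (n + 1) (monomial (n + 1) 0) f"
      if "f \<in> End_ops (n + 1)" for f
      using pt_linear_right(1)[OF m that End_ops_uminus[OF that]] z by (simp add: eq_neg_iff_add_eq_0 add.commute)
    have "pt (n + 1) (monomial (n + 1) 0) (\<Sum>j\<in>J. f j) = (\<Sum>j\<in>J. pt (n + 1) (monomial (n + 1) 0) (f j))"
      if "\<And>j. f j \<in> End_ops (n + 1)" for f and J :: "nat set"
    proof (induction J rule: infinite_finite_induct)
      case (insert j J)
      have fJ: "sum f J \<in> End_ops (n + 1)" by (rule End_ops_sum) (rule that)
      show ?case
        unfolding sum.insert[OF insert.hyps] pt_linear_right(1)[OF m that fJ] insert.IH ..
    next
      case (infinite J)
      show ?case unfolding sum.infinite[OF infinite] by (rule z)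
    qed (simp only: sum.empty z)
    note sum = this[OF c[OF omega_op_closed]]
    have closed: "(\<Sum>j<n. ?c omega_op (G j)) \<in> End_ops (n + 1)"
      by (intro End_ops_sum c omega_op_closed)
    have "left_comp n G 0 = - (\<Sum>j<n. ?c omega_op (G j))" by (simp add: left_comp_def)
    then show ?thesis by (simp only: neg[OF closed] sum minus_minus)
  qed
  also have "(\<Sum>j<n. pt (n + 1) (monomial (n + 1) (j + 1)) (?c (omega (\<diamond>)) (G j))) -
      - pt (n + 1) (monomial (n + 1) 0) (left_comp n G 0) = tens (n + 1) (left_comp n G)"
    unfolding tens_def by (simp add: sum.lessThan_Suc_shift left_comp_def del: sum.lessThan_Suc)
  finally show ?thesis .
qed

lemma right_op_closed:
  assumes "g \<in> End_ops n" "w \<in> End_ops 2" "n \<ge> 1"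
  shows "ocomp (end_operad scale) (2 # replicate (n - 1) 1) g (w # replicate (n - 1) (idop (end_operad scale)))
    \<in> End_ops (n + 1)"
proof -
  have "fits (end_operad scale) (2 # replicate (n - 1) 1) (w # replicate (n - 1) (idop (end_operad scale)))"
    using assms(2) fits_units(1)[of "n - 1"] by (simp add: fits_def)
  with ocomp_end_closed[of g "2 # replicate (n - 1) 1"] assms show ?thesis
    by (simp add: sum_list_replicate)
qed

lemma right_comp_closed:
  assumes "\<And>i. G i \<in> End_ops n" "n \<ge> 1"
  shows "right_comp n G i \<in> End_ops (n + 1)"
  using right_op_closed[OF assms(1) omega_closed assms(2)] right_op_closed[OF assms(1) omega_op_closed assms(2)]
  by (simp add: right_comp_def Let_def End_ops_uminus End_ops_diff del: One_nat_def)

text \<open>Putting the binary monomial m_l into the first input of m_j gives last letter x_l for j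
  = 0 and x_(j+1) for j > 0. Hence \<open>G 0\<close> feeds the components 0 and 1, one through each
  half of \<alpha>(\<nu>), while \<open>G j\<close> with j > 0 feeds the component j + 1 through
  both halves.\<close>

lemma ocomp_alpha_right:
  assumes G: "\<And>i. G i \<in> End_ops n" and n: "n \<ge> 1"
  shows "ocomp (perm_end scale) (2 # replicate (n - 1) 1) (tens n G)
      (alpha_nu scale (\<diamond>) # replicate (n - 1) (idop (perm_end scale))) = tens (n + 1) (right_comp n G)"
proof -
  let ?ls = "replicate (n - 1) (1::nat)" and ?id = "idop (end_operad scale)"
  let ?ks = "2 # ?ls" and ?ps = "replicate (n - 1) (monomial 1 0)" and ?qs = "replicate (n - 1) ?id"
  interpret ocomp_pair perm_operad "end_operad scale" ?ks
    by unfold_locales (rule multilinear_ocomp_perm multilinear_ocomp_end)+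
  have len: "length ?ks = n" and sum: "sum_list ?ks = n + 1" using n by (simp_all add: sum_list_replicate)
  let ?c = "\<lambda>w g. ocomp (end_operad scale) ?ks g (w # ?qs)"
  have c: "?c w (G j) \<in> End_ops (n + 1)" if "w \<in> End_ops 2" for w j
    using right_op_closed[OF G that n] .
  have off: "offset (replicate m 1) i = i" if "i \<le> m" for i m
    using that by (simp add: offset_def sum_list_replicate)
  have mono: "ocomp perm_operad ?ks (monomial n j) (monomial 2 l # ?ps) =
      (monomial (n + 1) (if j = 0 then l else j + 1) :: 'k free_perm)" if "l < 2" "j < n" for l j
  proof -
    let ?js = "\<lambda>i. if i = 0 then l else 0"
    have "?js i < ?ks ! i \<and> (monomial 2 l # ?ps) ! i = (monomial (?ks ! i) (?js i) :: 'k free_perm)" if "i < length ?ks" for i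
      using that \<open>l < 2\<close> by (cases i) auto
    then have "ocomp perm_operad ?ks (monomial (length ?ks) j) (monomial 2 l # ?ps) =
        (monomial (sum_list ?ks) (offset ?ks j + ?js j) :: 'k free_perm)"
      using that len by (intro ocomp_perm_monomials) auto
    moreover have "offset ?ks j + ?js j = (if j = 0 then l else j + 1)"
      using that off by (cases j) auto
    ultimately show ?thesis by (simp only: len sum)
  qed
  have args: "alpha_nu scale (\<diamond>) # replicate (n - 1) (idop (perm_end scale)) =
    (pure 2 (monomial 2 1) (omega (\<diamond>)) - pure 2 (monomial 2 0) omega_op) #
      map (\<lambda>(k, p, q). pure k p q) (zip ?ls (zip ?ps ?qs))"
    by (simp only: alpha_nu_eq idop_perm_end perm_var_0 zip_replicate map_replicate min.idem case_prod_conv)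
  have step: "ocomp (perm_end scale) ?ks (pt n (monomial n j) (G j))
      (alpha_nu scale (\<diamond>) # replicate (n - 1) (idop (perm_end scale))) =
    pt (n + 1) (monomial (n + 1) (if j = 0 then 1 else j + 1)) (?c (omega (\<diamond>)) (G j)) -
    pt (n + 1) (monomial (n + 1) (if j = 0 then 0 else j + 1)) (?c omega_op (G j))" if "j < n" for j
  proof -
    have "ocomp (perm_end scale) ?ks (pure (length ?ks) (monomial n j) (G j))
      ((pure 2 (monomial 2 1) (omega (\<diamond>)) - pure 2 (monomial 2 0) omega_op) #
        map (\<lambda>(k, p, q). pure k p q) (zip ?ls (zip ?ps ?qs))) =
      pure (sum_list ?ks) (ocomp perm_operad ?ks (monomial n j) (monomial 2 1 # ?ps)) (?c (omega (\<diamond>)) (G j)) -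
      pure (sum_list ?ks) (ocomp perm_operad ?ks (monomial n j) (monomial 2 0 # ?ps)) (?c omega_op (G j))"
      by (rule ocomp_hadamard_diff)
        (use that G omega_closed omega_op_closed fits_units in \<open>simp_all add: len perm_span_monomial del: One_nat_def\<close>)
    then show ?thesis
      unfolding args len sum using mono[of 1 j] mono[of 0 j] that by (simp del: One_nat_def)
  qed
  have m: "monomial (n + 1) i \<in> perm_span {..<n + 1}" if "i < n + 1" for i
    using that by (rule perm_span_monomial)
  \<comment> \<open>The summands of the right-hand side, into which the terms of the composite are
    regrouped by last letter.\<close>
  define X where "X i = pt (n + 1) (monomial (n + 1) i) (right_comp n G i)" for i
  have X0: "pt (n + 1) (monomial (n + 1) 0) (?c omega_op (G 0)) = - X 0"
  proof -
    have "right_comp n G 0 = - ?c omega_op (G 0)" by (simp add: right_comp_def)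
    moreover have "0 < n + 1" by simp
    ultimately show ?thesis
      unfolding X_def by (simp only: pt_uminus_right[OF m c[OF omega_op_closed]] minus_minus)
  qed
  have X1: "pt (n + 1) (monomial (n + 1) 1) (?c (omega (\<diamond>)) (G 0)) = X 1"
    unfolding X_def right_comp_def Let_def by simp
  have XS: "pt (n + 1) (monomial (n + 1) (Suc j + 1)) (?c (omega (\<diamond>)) (G (Suc j))) -
      pt (n + 1) (monomial (n + 1) (Suc j + 1)) (?c omega_op (G (Suc j))) = X (Suc (Suc j))" if "Suc j < n" for j
  proof -
    have "right_comp n G (Suc (Suc j)) = ?c (omega (\<diamond>)) (G (Suc j)) - ?c omega_op (G (Suc j))"
      by (simp add: right_comp_def)
    moreover have "Suc (Suc j) < n + 1" using that by simp
    ultimately show ?thesis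
      unfolding X_def by (simp only: pt_diff_right[OF m c c] omega_closed omega_op_closed Suc_eq_plus1)
  qed
  obtain k where k: "n = Suc k" using n by (cases n) auto
  have "ocomp (perm_end scale) ?ks (tens n G)
      (alpha_nu scale (\<diamond>) # replicate (n - 1) (idop (perm_end scale))) =
    (\<Sum>j<Suc k. ocomp (perm_end scale) ?ks (pt n (monomial n j) (G j))
      (alpha_nu scale (\<diamond>) # replicate (n - 1) (idop (perm_end scale))))"
    unfolding tens_def ocomp_hadamard_outer_sum k ..
  also have "\<dots> = X 1 + X 0 + (\<Sum>j<k. X (Suc (Suc j)))"
  proof -
    have "ocomp (perm_end scale) ?ks (pt n (monomial n 0) (G 0))
      (alpha_nu scale (\<diamond>) # replicate (n - 1) (idop (perm_end scale))) = X 1 + X 0"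
      using step[of 0] X0 X1 n by (simp del: One_nat_def)
    moreover have "(\<Sum>j<k. ocomp (perm_end scale) ?ks (pt n (monomial n (Suc j)) (G (Suc j)))
      (alpha_nu scale (\<diamond>) # replicate (n - 1) (idop (perm_end scale)))) = (\<Sum>j<k. X (Suc (Suc j)))"
      by (rule sum.cong[OF refl], subst XS[symmetric]) (use step k in \<open>auto simp del: One_nat_def\<close>)
    ultimately show ?thesis by (simp only: sum.lessThan_Suc_shift)
  qed
  also have "\<dots> = tens (n + 1) (right_comp n G)"
    unfolding tens_def by (simp add: X_def k sum.lessThan_Suc_shift algebra_simps del: sum.lessThan_Suc)
  finally show ?thesis .
qed

text \<open>The differential d_CE in components; \<sigma> acts on them by (F^\<sigma>)_i =
  (G_(\<sigma> i))^\<sigma>, see \<open>act_tens\<close>.\<close>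

definition model_d :: "nat \<Rightarrow> (nat \<Rightarrow> 'v list \<Rightarrow> 'v) \<Rightarrow> nat \<Rightarrow> 'v list \<Rightarrow> 'v" where
  "model_d n G i = (\<lambda>xs.
     (\<Sum>\<sigma>\<in>inv_shuffles 1 n. sgn_scale \<sigma> (left_comp n G (\<sigma> i) (permute_list (inv \<sigma>) xs))) -
     (\<Sum>\<sigma>\<in>inv_shuffles 2 (n - 1). sgn_scale \<sigma> (right_comp n G (\<sigma> i) (permute_list (inv \<sigma>) xs))))"

lemma model_d_eq: "model_d n G i =
     (\<Sum>\<sigma>\<in>inv_shuffles 1 n. scale_fun scale (of_int (sign \<sigma>)) (act_end (n + 1) \<sigma> (left_comp n G (\<sigma> i)))) -
     (\<Sum>\<sigma>\<in>inv_shuffles 2 (n - 1). scale_fun scale (of_int (sign \<sigma>)) (act_end (n + 1) \<sigma> (right_comp n G (\<sigma> i))))"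
  by (simp add: fun_eq_iff model_d_def sum_fun_apply scale_fun_def act_end_operad sgn_scale_def)

lemma inv_shuffles_permutes:
  "\<sigma> \<in> inv_shuffles 1 n \<Longrightarrow> \<sigma> permutes {..<n + 1}"
  "n \<ge> 1 \<Longrightarrow> \<sigma> \<in> inv_shuffles 2 (n - 1) \<Longrightarrow> \<sigma> permutes {..<n + 1}"
proof -
  show "\<sigma> \<in> inv_shuffles 1 n \<Longrightarrow> \<sigma> permutes {..<n + 1}" by (simp add: inv_shuffles_def)
  have "n \<ge> 1 \<Longrightarrow> 2 + (n - 1) = n + 1" by simp
  then show "n \<ge> 1 \<Longrightarrow> \<sigma> \<in> inv_shuffles 2 (n - 1) \<Longrightarrow> \<sigma> permutes {..<n + 1}"
    unfolding inv_shuffles_def by auto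
qed

lemma model_d_closed:
  assumes "\<And>i. G i \<in> End_ops n" "n \<ge> 1"
  shows "model_d n G i \<in> End_ops (n + 1)"
  unfolding model_d_eq
  by (intro End_ops_diff End_ops_sum End_ops_scale act_end_closed left_comp_closed right_comp_closed assms
      inv_shuffles_permutes)

lemma d_CE_tens:
  assumes G: "\<And>i. G i \<in> End_ops n" and n: "n \<ge> 1"
  shows "d_CE (perm_end scale) (alpha_nu scale (\<diamond>)) n (tens n G) = tens (n + 1) (model_d n G)"
proof -
  let ?H = "\<lambda>\<sigma> i. scale_fun scale (of_int (sign \<sigma>)) (act_end (n + 1) \<sigma> (left_comp n G (\<sigma> i)))"
  let ?K = "\<lambda>\<sigma> i. scale_fun scale (of_int (sign \<sigma>)) (act_end (n + 1) \<sigma> (right_comp n G (\<sigma> i)))"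
  have H: "act_end (n + 1) \<sigma> (left_comp n G (\<sigma> i)) \<in> End_ops (n + 1)" if "\<sigma> \<in> inv_shuffles 1 n" for \<sigma> i
    by (intro act_end_closed inv_shuffles_permutes left_comp_closed that G)
  have K: "act_end (n + 1) \<sigma> (right_comp n G (\<sigma> i)) \<in> End_ops (n + 1)" if "\<sigma> \<in> inv_shuffles 2 (n - 1)" for \<sigma> i
    by (rule act_end_closed[OF inv_shuffles_permutes(2)[OF n that] right_comp_closed[OF G n]])
  have HT: "tens (n + 1) (?H \<sigma>) = scale_fun (*) (of_int (sign \<sigma>))
      (act (perm_end scale) (n + 1) \<sigma> (tens (n + 1) (left_comp n G)))" if "\<sigma> \<in> inv_shuffles 1 n" for \<sigma>
    unfolding act_tens[OF inv_shuffles_permutes(1)[OF that]] by (rule tens_scale) (rule H[OF that])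
  have KT: "tens (n + 1) (?K \<sigma>) = scale_fun (*) (of_int (sign \<sigma>))
      (act (perm_end scale) (n + 1) \<sigma> (tens (n + 1) (right_comp n G)))" if "\<sigma> \<in> inv_shuffles 2 (n - 1)" for \<sigma>
    unfolding act_tens[OF inv_shuffles_permutes(2)[OF n that]] by (rule tens_scale) (rule K[OF that])
  have "tens (n + 1) (model_d n G) =
      (\<Sum>\<sigma>\<in>inv_shuffles 1 n. tens (n + 1) (?H \<sigma>)) - (\<Sum>\<sigma>\<in>inv_shuffles 2 (n - 1). tens (n + 1) (?K \<sigma>))"
    unfolding model_d_eq using H K
    by (subst tens_diff) (auto simp del: add_Suc_right simp: tens_sum End_ops_scale intro!: End_ops_sum)
  also have "\<dots> = d_CE (perm_end scale) (alpha_nu scale (\<diamond>)) n (tens n G)"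
    unfolding d_CE_def ocomp_alpha_left[OF G] ocomp_alpha_right[OF G n] smul_perm_end
    by (intro arg_cong2[of _ _ _ _ minus] sum.cong refl HT KT)
  finally show ?thesis ..
qed

section \<open>Skew-symmetry of the differential\<close>

lemma left_comp_apply:
  assumes "length ys = n"
  shows "left_comp n G 0 (x # ys) = - (\<Sum>j<n. G j ys \<diamond> x)" "left_comp n G (Suc i) (x # ys) = x \<diamond> G i ys"
  unfolding left_comp_def
  by (simp_all add: ocomp_end_left[OF assms] omega_pair sum_fun_apply del: One_nat_def)

lemma right_comp_apply:
  assumes "length zs = n - 1" "n \<ge> 1"
  shows "right_comp n G 0 (x # y # zs) = - G 0 ((y \<diamond> x) # zs)"
    "right_comp n G 1 (x # y # zs) = G 0 ((x \<diamond> y) # zs)"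
    "right_comp n G (Suc (Suc i)) (x # y # zs) = G (Suc i) ((x \<diamond> y) # zs) - G (Suc i) ((y \<diamond> x) # zs)"
  unfolding right_comp_def
  by (simp_all add: ocomp_end_right[OF assms] omega_pair del: One_nat_def)

text \<open>The transposition moves inputs of \<open>G\<close> only. The component 0 sums over all
  components of \<open>G\<close>, which are permuted; every other component involves a single
  one.\<close>

lemma left_comp_skew:
  assumes G: "skew n G" and ab: "a \<in> {1..<1 + n}" "b \<in> {1..<1 + n}" "a \<noteq> b"
    and i: "i < 1 + n" and xs: "length xs = 1 + n"
  shows "left_comp n G (transpose a b i) (permute_list (transpose a b) xs) = - left_comp n G i xs"
proof -
  obtain a' b' where ab': "a = Suc a'" "b = Suc b'" "a' < n" "b' < n" "a' \<noteq> b'"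
    using ab by (cases a; cases b) auto
  obtain x ys where x: "xs = x # ys" "length ys = n" using xs by (cases xs) auto
  let ?t = "transpose a' b'"
  have perm: "permute_list (transpose a b) xs = x # permute_list ?t ys"
    using permute_list_transpose_Cons[of a' ys b' x] ab' x by simp
  have len: "length (permute_list ?t ys) = n" using x by simp
  note sk = skew_transpose[OF G ab'(3-5) _ x(2)]
  show ?thesis
  proof (cases i)
    case 0
    have "?t permutes {..<n}" using ab' by (intro permutes_swap_id) auto
    then have "(\<Sum>j<n. G j (permute_list ?t ys) \<diamond> x) = (\<Sum>j<n. G (?t j) (permute_list ?t ys) \<diamond> x)"
      by (rule sum.permute[unfolded o_def])
    also have "\<dots> = (\<Sum>j<n. - (G j ys \<diamond> x))"
      by (rule sum.cong) (simp_all add: sk diamond_linear)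
    finally show ?thesis
      unfolding perm unfolding x(1) ab'(1,2) 0 transpose_Suc
      by (simp add: left_comp_apply[OF len] left_comp_apply[OF x(2)] sum_negf)
  next
    case (Suc j)
    with i have "j < n" by simp
    then show ?thesis
      unfolding perm unfolding x(1) ab'(1,2) Suc transpose_Suc
      by (simp add: left_comp_apply[OF len] left_comp_apply[OF x(2)] sk diamond_linear)
  qed
qed

text \<open>Swapping the first two inputs exchanges the two halves of \<alpha>(\<nu>), and with them
  the components 0 and 1. The other inputs are the inputs 1, ..., n-1 of \<open>G\<close>, whose
  input 0 is the product and stays in place.\<close>

lemma right_comp_skew:
  assumes G: "skew n G" and n: "n \<ge> 1"
    and ab: "a < 2 \<and> b < 2 \<or> a \<in> {2..<2 + (n - 1)} \<and> b \<in> {2..<2 + (n - 1)}" "a \<noteq> b"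
    and i: "i < 2 + (n - 1)" and xs: "length xs = 2 + (n - 1)"
  shows "right_comp n G (transpose a b i) (permute_list (transpose a b) xs) = - right_comp n G i xs"
proof -
  obtain x y zs where x: "xs = x # y # zs" "length zs = n - 1"
    using xs by (cases xs; cases "tl xs") auto
  consider (0) "i = 0" | (1) "i = 1" | (2) j where "i = Suc (Suc j)"
    by (cases i; cases "i - 1") auto
  note i_cases = this
  note app = right_comp_apply[OF _ n]
  from ab(1) show ?thesis
  proof
    assume ab2: "a < 2 \<and> b < 2"
    have "a = 0 \<and> b = 1 \<or> a = 1 \<and> b = 0" using ab2 ab(2) by auto
    then have t: "transpose a b = transpose 0 1" by (auto simp: transpose_commute)
    have perm: "permute_list (transpose 0 1) xs = y # x # zs"
      unfolding x(1) by (rule permute_list_transpose_0_1)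
    show ?thesis
      using i_cases
    proof cases
      case 0
      then show ?thesis unfolding t perm unfolding x(1) by (simp add: app x(2) del: One_nat_def)
    next
      case 1
      then show ?thesis unfolding t perm unfolding x(1) by (simp add: app x(2) del: One_nat_def)
    next
      case (2 j)
      then have "transpose 0 1 i = i" by (simp add: transpose_def)
      then show ?thesis unfolding t perm unfolding x(1) using 2 by (simp add: app x(2))
    qed
  next
    assume ab2: "a \<in> {2..<2 + (n - 1)} \<and> b \<in> {2..<2 + (n - 1)}"
    then obtain a' b' where ab': "a = Suc (Suc a')" "b = Suc (Suc b')" "a' < n - 1" "b' < n - 1" "a' \<noteq> b'"
      using ab(2) by (cases a; cases "a - 1"; cases b; cases "b - 1") auto
    let ?t = "transpose a' b'"
    have perm: "permute_list (transpose a b) xs = x # y # permute_list ?t zs"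
      using ab' x by (simp add: permute_list_transpose_Cons)
    have len: "length (permute_list ?t zs) = n - 1" using x by simp
    have sk: "G (transpose (Suc a') (Suc b') k) (w # permute_list ?t zs) = - G k (w # zs)" if "k < n" for k w
      using skew_transpose[OF G, of "Suc a'" "Suc b'" k "w # zs"] that ab' x(2) n
      by (simp add: permute_list_transpose_Cons)
    have sk0: "G 0 (w # permute_list ?t zs) = - G 0 (w # zs)" for w
      using sk[of 0 w] n by (simp add: transpose_Suc)
    have skS: "G (Suc (?t j)) (w # permute_list ?t zs) = - G (Suc j) (w # zs)" if "Suc j < n" for w j
      using sk[OF that] by (simp add: transpose_Suc)
    show ?thesis
      using i_cases
    proof cases
      case 0
      then show ?thesis unfolding perm unfolding ab'(1,2) x(1) by (simp add: transpose_Suc app x(2) len sk0)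
    next
      case 1
      then have "transpose a b i = 1" by (simp add: ab' transpose_def)
      with 1 show ?thesis unfolding perm unfolding x(1) by (simp add: app x(2) len sk0 del: One_nat_def)
    next
      case (2 j)
      then have "transpose a b i = Suc (Suc (?t j))" by (simp add: ab' transpose_Suc)
      with 2 i n show ?thesis unfolding perm unfolding x(1) by (simp add: app x(2) len skS)
    qed
  qed
qed

text \<open>Skewness within the blocks makes the summand, sign included, constant on cosets;
  translating the sum by \<tau> then only produces the sign of \<tau>.\<close>

lemma shuffle_sum_skew:
  assumes L: "\<And>a b i xs. a < p \<and> b < p \<or> a \<in> {p..<p + q} \<and> b \<in> {p..<p + q} \<Longrightarrow> a \<noteq> b \<Longrightarrow> i < p + q \<Longrightarrow>
      length xs = p + q \<Longrightarrow> L (transpose a b i) (permute_list (transpose a b) xs) = - L i xs"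
    and \<tau>: "\<tau> permutes {..<p + q}" and k: "k < p + q" and xs: "length xs = p + q"
  shows "(\<Sum>\<sigma>\<in>inv_shuffles p q. sgn_scale \<sigma> (L (\<sigma> (\<tau> k)) (permute_list (inv \<sigma>) (permute_list (inv \<tau>) xs)))) =
    sgn_scale \<tau> (\<Sum>\<sigma>\<in>inv_shuffles p q. sgn_scale \<sigma> (L (\<sigma> k) (permute_list (inv \<sigma>) xs)))"
proof -
  define \<phi> where "\<phi> \<sigma> = sgn_scale \<sigma> (L (\<sigma> k) (permute_list (inv \<sigma>) xs))" for \<sigma>
  have perm: "permutation \<sigma>" if "\<sigma> permutes {..<p + q}" for \<sigma>
    using that by (auto simp: permutation_permutes)
  have inv_comp: "permute_list (inv (\<sigma> \<circ> \<sigma>')) xs = permute_list (inv \<sigma>) (permute_list (inv \<sigma>') xs)"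
    if "\<sigma> permutes {..<p + q}" "\<sigma>' permutes {..<p + q}" for \<sigma> \<sigma>'
  proof -
    have "inv (\<sigma> \<circ> \<sigma>') = inv \<sigma>' \<circ> inv \<sigma>"
      using that by (intro o_inv_distrib permutes_bij)
    then show ?thesis
      using permute_list_compose[of "inv \<sigma>" xs "inv \<sigma>'"] permutes_inv[OF that(1)] xs by simp
  qed
  have "(\<Sum>\<sigma>\<in>inv_shuffles p q. \<phi> (\<sigma> \<circ> \<tau>)) = (\<Sum>\<sigma>\<in>inv_shuffles p q. \<phi> \<sigma>)"
  proof (rule sum_inv_shuffles_translate[OF _ \<tau>])
    fix \<sigma> a b
    assume \<sigma>: "\<sigma> permutes {..<p + q}"
      and ab: "a < p \<and> b < p \<or> a \<in> {p..<p + q} \<and> b \<in> {p..<p + q}"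
    show "\<phi> (transpose a b \<circ> \<sigma>) = \<phi> \<sigma>"
    proof (cases "a = b")
      case False
      have t: "transpose a b permutes {..<p + q}" using ab by (intro permutes_swap_id) auto
      have "\<sigma> k < p + q" using permutes_in_image[OF \<sigma>, of k] k by simp
      then have "L ((transpose a b \<circ> \<sigma>) k) (permute_list (inv (transpose a b \<circ> \<sigma>)) xs) =
          - L (\<sigma> k) (permute_list (inv \<sigma>) xs)"
        unfolding inv_comp[OF t \<sigma>] using L[OF ab False, of "\<sigma> k" "permute_list (inv \<sigma>) xs"] xs by simp
      then show ?thesis
        unfolding \<phi>_def sgn_scale_compose[OF perm[OF t] perm[OF \<sigma>]]
        by (simp add: sgn_scale_transpose[OF False] sgn_scale_linear)
    qed simp
  qed
  then have "sgn_scale \<tau> (\<Sum>\<sigma>\<in>inv_shuffles p q. \<phi> \<sigma>) = sgn_scale \<tau> (\<Sum>\<sigma>\<in>inv_shuffles p q. \<phi> (\<sigma> \<circ> \<tau>))"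
    by simp
  also have "\<dots> = (\<Sum>\<sigma>\<in>inv_shuffles p q.
      sgn_scale \<sigma> (L (\<sigma> (\<tau> k)) (permute_list (inv \<sigma>) (permute_list (inv \<tau>) xs))))"
    unfolding sgn_scale_linear
  proof (rule sum.cong[OF refl])
    fix \<sigma> assume "\<sigma> \<in> inv_shuffles p q"
    then have \<sigma>: "\<sigma> permutes {..<p + q}" by (simp add: inv_shuffles_def)
    have "sgn_scale \<tau> (sgn_scale (\<sigma> \<circ> \<tau>) x) = sgn_scale \<sigma> x" for x
      unfolding sgn_scale_compose[OF perm[OF \<sigma>] perm[OF \<tau>]]
      by (simp add: sgn_scale_def mult.left_commute[of "sign \<tau>"] flip: of_int_mult)
    then show "sgn_scale \<tau> (\<phi> (\<sigma> \<circ> \<tau>)) =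
        sgn_scale \<sigma> (L (\<sigma> (\<tau> k)) (permute_list (inv \<sigma>) (permute_list (inv \<tau>) xs)))"
      unfolding \<phi>_def inv_comp[OF \<sigma> \<tau>] by simp
  qed
  finally show ?thesis by (simp only: \<phi>_def)
qed

lemma model_d_skew:
  assumes "skew n G" "n \<ge> 1"
  shows "skew (n + 1) (model_d n G)"
proof -
  have two: "2 + (n - 1) = n + 1" using assms(2) by simp
  show ?thesis
    unfolding skew_def
  proof (intro allI impI)
    fix \<tau> k and xs :: "'v list"
    assume \<tau>: "\<tau> permutes {..<n + 1}" and k: "k < n + 1" and xs: "length xs = n + 1"
    show "model_d n G (\<tau> k) (permute_list (inv \<tau>) xs) = sgn_scale \<tau> (model_d n G k xs)"
      unfolding model_d_def sgn_scale_linear(2)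
    proof (rule arg_cong2[of _ _ _ _ minus])
      show "(\<Sum>\<sigma>\<in>inv_shuffles 1 n. sgn_scale \<sigma> (left_comp n G (\<sigma> (\<tau> k)) (permute_list (inv \<sigma>) (permute_list (inv \<tau>) xs)))) =
          sgn_scale \<tau> (\<Sum>\<sigma>\<in>inv_shuffles 1 n. sgn_scale \<sigma> (left_comp n G (\<sigma> k) (permute_list (inv \<sigma>) xs)))"
      proof (rule shuffle_sum_skew)
        fix a b i and xs :: "'v list"
        assume "a < 1 \<and> b < 1 \<or> a \<in> {1..<1 + n} \<and> b \<in> {1..<1 + n}" "a \<noteq> b" "i < 1 + n" "length xs = 1 + n"
        then show "left_comp n G (transpose a b i) (permute_list (transpose a b) xs) = - left_comp n G i xs"
          by (intro left_comp_skew[OF assms(1)]) auto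
      qed (use \<tau> k xs in \<open>simp_all add: add.commute\<close>)
      show "(\<Sum>\<sigma>\<in>inv_shuffles 2 (n - 1). sgn_scale \<sigma> (right_comp n G (\<sigma> (\<tau> k)) (permute_list (inv \<sigma>) (permute_list (inv \<tau>) xs)))) =
          sgn_scale \<tau> (\<Sum>\<sigma>\<in>inv_shuffles 2 (n - 1). sgn_scale \<sigma> (right_comp n G (\<sigma> k) (permute_list (inv \<sigma>) xs)))"
        by (rule shuffle_sum_skew, rule right_comp_skew[OF assms]) (use \<tau> k xs two in simp_all)
    qed
  qed
qed

text \<open>Let z be the last argument. The (1, n)-shuffles that bring x_a to the front give x_a
  \<diamond> f(...; z), and the one that brings z to the front gives all f(...; x_j) \<diamond> z
  through the sum in \<open>left_comp\<close>. The (2, n-1)-shuffles give the bracket terms when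
  both chosen arguments precede z, and f(...; x_a \<diamond> z) when z is one of them.\<close>

lemma model_d_last:
  assumes G: "\<And>i. G i \<in> End_ops n" "skew n G" and n: "n \<ge> 1"
  shows "model_d n G n = d_pLie scale (\<diamond>) n (G (n - 1))"
proof
  fix xs
  let ?f = "G (n - 1)"
  show "model_d n G n xs = d_pLie scale (\<diamond>) n ?f xs"
  proof (cases "length xs = n + 1")
    case False
    then show ?thesis
      using multilinear_mapsD(2)[OF model_d_closed[OF G(1) n]] by (simp add: d_pLie_def)
  next
    case True
    then obtain ys z where xs: "xs = ys @ [z]" and ys: "length ys = n"
      by (cases xs rule: rev_cases) auto
    obtain m where m: "n = Suc m" using n by (cases n) auto
    have f_add: "?f ((u - v) # ws) = ?f (u # ws) - ?f (v # ws)" for u v ws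
      by (rule multilinD_hd) (rule multilinear_mapsD(1)[OF G(1)])
    have sgn_front: "sgn_scale (inv (to_front a)) = scale ((- 1) ^ a)" if "a < n + 1" for a
    proof -
      have "permutation (to_front a)" using to_front_permutes[OF that] by (auto simp: permutation_permutes)
      then show ?thesis by (simp add: sgn_scale_inv) (simp add: sgn_scale_def sign_to_front fun_eq_iff)
    qed
    \<comment> \<open>(-1)^n is the sign of the shuffle bringing z to the front, (-1)^(n-1-j) that
      of moving x_j to the end in \<open>skew_apply\<close>; the remaining minus cancels the one in
      the component 0 of \<open>left_comp\<close>.\<close>
    have sgn_cancel: "(- 1) ^ n * (- 1) ^ (n - 1 - j) = - ((- 1) ^ j :: 'k)" if "j < n" for j
    proof -
      obtain k where "n = Suc (j + k)" using \<open>j < n\<close> less_imp_Suc_add by blast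
      then show ?thesis by (simp add: power_add)
    qed
    have xa: "xs ! a = ys ! a" "del a xs = del a ys @ [z]" if "a < n" for a
      using that ys by (simp_all add: xs nth_append del_def)
    have xn: "xs ! n = z" "del n xs = ys" using ys by (simp_all add: xs nth_append del_def)
    have "(\<Sum>\<sigma>\<in>inv_shuffles 1 n. sgn_scale \<sigma> (left_comp n G (\<sigma> n) (permute_list (inv \<sigma>) xs))) =
        (\<Sum>a<n + 1. scale ((- 1) ^ a) (left_comp n G (inv (to_front a) n) (xs ! a # del a xs)))"
      unfolding sum_inv_shuffles_1
      using True by (intro sum.cong) (auto simp: sgn_front permutes_inv_inv[OF to_front_permutes] permute_to_front)
    also have "\<dots> = (\<Sum>a<n. scale ((- 1) ^ a) (left_comp n G n (ys ! a # del a ys @ [z]))) +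
        scale ((- 1) ^ n) (left_comp n G 0 (z # ys))"
    proof -
      \<comment> \<open>The last argument stays last, and the component is n, unless it is itself
        brought to the front; then the component is 0.\<close>
      have "inv (to_front a) n = n" if "a < n" for a
        using that by (subst permutes_inv_eq[OF to_front_permutes[of a "n + 1"]]) (auto simp: to_front_def)
      moreover have "inv (to_front n) n = 0"
        by (subst permutes_inv_eq[OF to_front_permutes[of n "n + 1"]]) (auto simp: to_front_def)
      ultimately show ?thesis using xa xn by simp
    qed
    also have "(\<Sum>a<n. scale ((- 1) ^ a) (left_comp n G n (ys ! a # del a ys @ [z]))) =
        (\<Sum>a<n. scale ((- 1) ^ a) (ys ! a \<diamond> ?f (del a ys @ [z])))"
      using ys m by (intro sum.cong) (simp_all add: left_comp_apply)
    also have "scale ((- 1) ^ n) (left_comp n G 0 (z # ys)) =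
        (\<Sum>j<n. scale ((- 1) ^ j) (?f (del j ys @ [ys ! j]) \<diamond> z))"
    proof -
      have "scale ((- 1) ^ n) (- (G j ys \<diamond> z)) = scale ((- 1) ^ j) (?f (del j ys @ [ys ! j]) \<diamond> z)"
        if "j < n" for j
        unfolding skew_apply[OF G(2) that ys]
        by (simp only: diamond_linear scale_minus_right scale_scale sgn_cancel[OF that] scale_minus_left minus_minus)
      then show ?thesis using ys by (simp add: left_comp_apply sum_negf[symmetric] scale_sum_right)
    qed
    finally have left: "(\<Sum>\<sigma>\<in>inv_shuffles 1 n. sgn_scale \<sigma> (left_comp n G (\<sigma> n) (permute_list (inv \<sigma>) xs))) =
      (\<Sum>a<n. scale ((- 1) ^ a) (ys ! a \<diamond> ?f (del a ys @ [z]))) +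
      (\<Sum>j<n. scale ((- 1) ^ j) (?f (del j ys @ [ys ! j]) \<diamond> z))" .
    define p where "p b a = to_front b \<circ> to_front (Suc a)" for b a
    have p: "p b a permutes {..<n + 1}" if "a < b" "b < n + 1" for a b
      unfolding p_def using that by (intro permutes_compose to_front_permutes) auto
    have sgn_p: "sgn_scale (inv (p b a)) = scale ((- 1) ^ (a + b + 1))" if "a < b" "b < n + 1" for a b
    proof -
      have "permutation (p b a)" "permutation (to_front b)" "permutation (to_front (Suc a))"
        using p[OF that] to_front_permutes[of b "n + 1"] to_front_permutes[of "Suc a" "n + 1"] that
        by (auto simp: permutation_permutes)
      then show ?thesis
        by (simp add: sgn_scale_inv) (simp add: sgn_scale_def p_def sign_compose sign_to_front fun_eq_iff power_add)
    qed
    have perm_p: "permute_list (p b a) xs = xs ! a # xs ! b # del a (del b xs)" if "a < b" "b < n + 1" for a b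
    proof -
      have "permute_list (p b a) xs = permute_list (to_front (Suc a)) (permute_list (to_front b) xs)"
        unfolding p_def using that True by (intro permute_list_compose to_front_permutes) auto
      also have "\<dots> = permute_list (to_front (Suc a)) (xs ! b # del b xs)"
        using that True by (subst permute_to_front) auto
      also have "\<dots> = del b xs ! a # xs ! b # del a (del b xs)"
        using that True by (subst permute_to_front) auto
      also have "del b xs ! a = xs ! a" using that True by (simp add: del_def nth_append)
      finally show ?thesis .
    qed
    have "(\<Sum>\<sigma>\<in>inv_shuffles 2 (n - 1). sgn_scale \<sigma> (right_comp n G (\<sigma> n) (permute_list (inv \<sigma>) xs))) =
        (\<Sum>b<n + 1. \<Sum>a<b. scale ((- 1) ^ (a + b + 1))
          (right_comp n G (inv (p b a) n) (xs ! a # xs ! b # del a (del b xs))))"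
      unfolding sum_inv_shuffles_2[OF n] p_def[symmetric]
      by (intro sum.cong refl) (simp add: sgn_p permutes_inv_inv[OF p] perm_p)
    also have "\<dots> = (\<Sum>b<n. \<Sum>a<b. scale ((- 1) ^ (a + b + 1))
          (?f (bracket (ys ! a) (ys ! b) # del a (del b ys) @ [z]))) +
        (\<Sum>a<n. scale ((- 1) ^ a) (?f (del a ys @ [ys ! a \<diamond> z])))"
    proof -
      have "right_comp n G (inv (p b a) n) (xs ! a # xs ! b # del a (del b xs)) =
          ?f (bracket (ys ! a) (ys ! b) # del a (del b ys) @ [z])" if "a < b" "b < n" for a b
      proof -
        have "inv (p b a) n = n"
          using that by (subst permutes_inv_eq[OF p]) (auto simp: p_def to_front_def)
        moreover have "2 \<le> n" using that by simp
        then obtain k where k: "n = Suc (Suc k)" using le_Suc_ex[of 2 n] by auto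
        moreover have "G (Suc k) ((u - v) # ws) = G (Suc k) (u # ws) - G (Suc k) (v # ws)" for u v ws
          using f_add[of u v ws] by (simp add: k)
        moreover have "del a (del b xs) = del a (del b ys) @ [z]"
          using that ys by (auto simp: xs del_def)
        moreover have "length (del a (del b ys) @ [z]) = n - 1" using that ys by simp
        ultimately show ?thesis
          using xa that by (simp add: right_comp_apply bracket_def)
      qed
      \<comment> \<open>Here z is the second factor of the product, hence the component 1, which
        involves \<open>G 0\<close>. Moving the product from the front to the end costs (-1)^(n-1),
        which reduces the sign to (-1)^a.\<close>
      moreover have "scale ((- 1) ^ (a + n + 1)) (right_comp n G (inv (p n a) n) (xs ! a # xs ! n # del a (del n xs))) =
          scale ((- 1) ^ a) (?f (del a ys @ [ys ! a \<diamond> z]))" if "a < n" for a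
      proof -
        have "inv (p n a) n = 1"
          using that by (subst permutes_inv_eq[OF p]) (auto simp: p_def to_front_def)
        moreover have "length (del a ys) = n - 1" using that ys by simp
        ultimately have "right_comp n G (inv (p n a) n) (xs ! a # xs ! n # del a (del n xs)) =
            G 0 ((ys ! a \<diamond> z) # del a ys)"
          using xa[OF that] xn n by (simp add: right_comp_apply del: One_nat_def)
        also have "\<dots> = scale ((- 1) ^ (n - 1)) (?f (del a ys @ [ys ! a \<diamond> z]))"
          using skew_apply[OF G(2), of 0 "(ys ! a \<diamond> z) # del a ys"] that ys by simp
        finally show ?thesis using m by (simp add: power_add)
      qed
      ultimately show ?thesis by simp
    qed
    finally have right: "(\<Sum>\<sigma>\<in>inv_shuffles 2 (n - 1). sgn_scale \<sigma> (right_comp n G (\<sigma> n) (permute_list (inv \<sigma>) xs))) =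
        (\<Sum>b<n. \<Sum>a<b. scale ((- 1) ^ (a + b + 1))
          (?f (bracket (ys ! a) (ys ! b) # del a (del b ys) @ [z]))) +
        (\<Sum>a<n. scale ((- 1) ^ a) (?f (del a ys @ [ys ! a \<diamond> z])))" .
    show ?thesis
      unfolding model_d_def left right unfolding xs d_pLie_snoc[OF ys]
      by (simp add: sum.distrib sum_subtractf sum_negf scale_right_distrib scale_right_diff_distrib)
  qed
qed

end

section \<open>The comparison map\<close>

text \<open>Linearity of \<open>d\<close> and d d = 0 hold after applying \<Phi>, because they hold
  for \<open>e\<close>, and injectivity of \<Phi> removes it again. Of \<open>d\<close> itself only
  the stability of \<open>C\<close> and compatibility with \<Phi> have to be supplied.\<close>

lemma cochain_isomorphism_transport:
  assumes s: "vector_space s" and D: "cochain_complex t D e"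
    and sub: "\<And>n. n \<ge> 1 \<Longrightarrow> module.subspace s (C n)"
    and lin: "\<And>n. n \<ge> 1 \<Longrightarrow> linear_on s t (C n) (\<Phi> n)"
    and bij: "\<And>n. n \<ge> 1 \<Longrightarrow> bij_betw (\<Phi> n) (C n) (D n)"
    and d: "\<And>n x. n \<ge> 1 \<Longrightarrow> x \<in> C n \<Longrightarrow> d n x \<in> C (n + 1)"
    and comm: "\<And>n x. n \<ge> 1 \<Longrightarrow> x \<in> C n \<Longrightarrow> \<Phi> (n + 1) (d n x) = e n (\<Phi> n x)"
  shows "cochain_isomorphism s C d t D e \<Phi>"
proof -
  interpret S: vector_space s by fact
  interpret T: vector_space t using D by (simp add: cochain_complex_def)
  have add: "u + v \<in> C n" and scl: "s c u \<in> C n" and zero: "0 \<in> C n"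
    if "n \<ge> 1" "u \<in> C n" "v \<in> C n" for n u v c
    using sub[OF that(1)] that by (auto simp: S.subspace_def)
  have \<Phi>: "\<Phi> n (u + v) = \<Phi> n u + \<Phi> n v" "\<Phi> n (s c u) = t c (\<Phi> n u)" "\<Phi> n u \<in> D n"
    if "n \<ge> 1" "u \<in> C n" "v \<in> C n" for n u v c
    using lin[OF that(1)] bij_betwE[OF bij[OF that(1)]] that by (auto simp: linear_on_def)
  have e: "e n (u + v) = e n u + e n v" "e n (t c u) = t c (e n u)" "e (n + 1) (e n u) = 0"
    if "n \<ge> 1" "u \<in> D n" "v \<in> D n" for n u v c
    using D that by (auto simp: cochain_complex_def linear_on_def)
  have inj: "x = y" if "\<Phi> n x = \<Phi> n y" "n \<ge> 1" "x \<in> C n" "y \<in> C n" for n x y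
    using bij_betw_imp_inj_on[OF bij[OF that(2)]] that by (auto dest: inj_onD)
  have "d n (u + v) = d n u + d n v" if "n \<ge> 1" "u \<in> C n" "v \<in> C n" for n u v
  proof (rule inj[of "n + 1"])
    show "\<Phi> (n + 1) (d n (u + v)) = \<Phi> (n + 1) (d n u + d n v)"
      using that by (subst \<Phi>(1)) (simp_all add: comm[unfolded Suc_eq_plus1[symmetric]] d[unfolded Suc_eq_plus1[symmetric]] add \<Phi> e)
  qed (use that d add in simp_all)
  moreover have "d n (s c u) = s c (d n u)" if "n \<ge> 1" "u \<in> C n" for n u c
  proof (rule inj[of "n + 1"])
    have "\<Phi> (n + 1) (d n (s c u)) = t c (e n (\<Phi> n u))"
      using that comm[OF that(1) scl[OF that that(2)]] \<Phi>(2)[OF that that(2)] e(2)[OF that(1) \<Phi>(3)[OF that that(2)] \<Phi>(3)[OF that that(2)]]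
      by simp
    also have "\<dots> = \<Phi> (n + 1) (s c (d n u))"
      using \<Phi>(2)[of "n + 1" "d n u" "d n u"] d[OF that] comm[OF that] by simp
    finally show "\<Phi> (n + 1) (d n (s c u)) = \<Phi> (n + 1) (s c (d n u))" .
    show "d n (s c u) \<in> C (n + 1)" "s c (d n u) \<in> C (n + 1)"
      using that d[OF that(1) scl[OF that that(2)]] scl[of "n + 1" "d n u" "d n u"] d[OF that] by simp_all
  qed (use that in simp)
  moreover have "d (n + 1) (d n x) = 0" if "n \<ge> 1" "x \<in> C n" for n x
  proof (rule inj[of "n + 1 + 1"])
    have dx: "d n x \<in> C (n + 1)" and n1: "n + 1 \<ge> 1" using d that by simp_all
    have "\<Phi> (n + 1 + 1) (d (n + 1) (d n x)) = e (n + 1) (e n (\<Phi> n x))"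
      using comm[OF n1 dx] comm[OF that] by simp
    also have "\<dots> = 0" using e(3)[OF that(1)] \<Phi>(3)[OF that that(2)] by blast
    \<comment> \<open>Linearity of \<Phi> is available on \<open>C\<close> only, so \<Phi> 0 = 0 is
      obtained by scaling an element of \<open>C\<close> by 0.\<close>
    also have "0 = \<Phi> (n + 1 + 1) 0"
      using \<Phi>(2)[of "n + 1 + 1" "d (n + 1) (d n x)" "d (n + 1) (d n x)" 0] d[OF n1 dx] by simp
    finally show "\<Phi> (n + 1 + 1) (d (n + 1) (d n x)) = \<Phi> (n + 1 + 1) 0" .
    show "d (n + 1) (d n x) \<in> C (n + 1 + 1)" by (rule d[OF n1 dx])
    then show "0 \<in> C (n + 1 + 1)" using zero[of "n + 1 + 1"] by simp
  qed simp
  ultimately have "cochain_complex s C d"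
    using s sub d by (simp add: cochain_complex_def linear_on_def)
  with D lin bij comm show ?thesis by (simp add: cochain_isomorphism_def)
qed

text \<open>The scalars are restricted to characteristic 0 for the division by 2 in
  \<open>skew_last_cochain\<close>.\<close>

locale pre_lie_algebra_char_0 = pre_lie_algebra scale dia
  for scale :: "'k::field_char_0 \<Rightarrow> 'v::ab_group_add \<Rightarrow> 'v" and dia (infixl \<open>\<diamond>\<close> 70)

begin

text \<open>Swapping two equal arguments before the last changes neither the list nor the component
  \<open>n - 1\<close>, so the value equals its own negative, and 2 is invertible.\<close>

lemma skew_last_cochain:
  assumes G: "\<And>i. G i \<in> End_ops n" "skew n G" and n: "n \<ge> 1"
  shows "G (n - 1) \<in> pLie_cochains scale n"
proof -
  have zero: "G (n - 1) xs = 0" if "length xs = n" "i < j" "j < n - 1" "xs ! i = xs ! j" for xs i j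
  proof -
    have "permute_list (transpose i j) xs = xs"
      by (rule nth_equalityI) (use that in \<open>auto simp: permute_list_def transpose_def\<close>)
    moreover have "transpose i j (n - 1) = n - 1" using that by (auto simp: transpose_def)
    ultimately have "G (n - 1) xs = - G (n - 1) xs"
      using skew_transpose[OF G(2), of i j "n - 1" xs] that by simp
    then have "scale 2 (G (n - 1) xs) = 0"
      by (simp only: eq_neg_iff_add_eq_0 scale_left_distrib scale_one flip: one_add_one)
    then show ?thesis by simp
  qed
  show ?thesis
    unfolding pLie_cochains_def mem_Collect_eq by (intro conjI allI impI G(1)) (rule zero)
qed

lemma CE_cases:
  assumes "F \<in> CE (perm_end scale) n"
  shows "\<exists>G. (\<forall>i. G i \<in> End_ops n) \<and> skew n G \<and> F = tens n G"
proof -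
  have "F \<in> ops (perm_end scale) n" using assms by (simp add: CE_def)
  then show ?thesis
  proof (rule tens_surj)
    fix G assume "\<And>i. G i \<in> End_ops n" "F = tens n G"
    with assms CE_tens_iff[of G n] show ?thesis by blast
  qed
qed

lemma subspace_CE: "module.subspace (scale_fun (*)) (CE (perm_end scale) n)"
proof -
  interpret V: vector_space "scale_fun (*) :: 'k \<Rightarrow> (('k free_perm \<Rightarrow> ('v list \<Rightarrow> 'v) \<Rightarrow> 'k) \<Rightarrow> 'k) \<Rightarrow> _"
    by (rule vector_space_functionals)
  have "act (perm_end scale) n \<sigma> 0 = 0"
    "act (perm_end scale) n \<sigma> (F + F') = act (perm_end scale) n \<sigma> F + act (perm_end scale) n \<sigma> F'"
    "act (perm_end scale) n \<sigma> (scale_fun (*) c F) = scale_fun (*) c (act (perm_end scale) n \<sigma> F)" for \<sigma> F F' c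
    by (auto simp: hadamard_def Let_def fun_eq_iff scale_fun_def)
  then show ?thesis
    using subspace_ops_perm_end[of n] unfolding V.subspace_def CE_def
    by (auto simp only: mem_Collect_eq V.scale_zero_right V.scale_right_distrib smul_perm_end V.scale_left_commute)
qed

lemma linear_on_Omega:
  assumes "n \<ge> 1"
  shows "linear_on (scale_fun (*)) (scale_fun scale) (CE (perm_end scale) n) (Omega scale n)"
  unfolding linear_on_def
proof (intro conjI ballI allI)
  fix F F' assume "F \<in> CE (perm_end scale) n" "F' \<in> CE (perm_end scale) n"
  then obtain G G' where G: "\<And>i. G i \<in> End_ops n" "\<And>i. G' i \<in> End_ops n" and F: "F = tens n G" "F' = tens n G'"
    using CE_cases by metis
  have "Omega scale n (tens n (\<lambda>i. G i + G' i)) = G (n - 1) + G' (n - 1)"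
    by (rule Omega_tens) (simp_all only: G End_ops_add assms)
  then show "Omega scale n (F + F') = Omega scale n F + Omega scale n F'"
    by (simp only: F Omega_tens G assms tens_add)
next
  fix F c assume "F \<in> CE (perm_end scale) n"
  then obtain G where G: "\<And>i. G i \<in> End_ops n" and F: "F = tens n G"
    using CE_cases by metis
  have "Omega scale n (tens n (\<lambda>i. scale_fun scale c (G i))) = scale_fun scale c (G (n - 1))"
    by (rule Omega_tens) (simp_all only: G End_ops_scale assms)
  then show "Omega scale n (scale_fun (*) c F) = scale_fun scale c (Omega scale n F)"
    by (simp only: F Omega_tens G assms tens_scale)
qed

lemma bij_betw_Omega:
  assumes n: "n \<ge> 1"
  shows "bij_betw (Omega scale n) (CE (perm_end scale) n) (pLie_cochains scale n)"
  unfolding bij_betw_def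
proof (intro conjI subset_antisym subsetI inj_onI)
  fix F F' assume F: "F \<in> CE (perm_end scale) n" "F' \<in> CE (perm_end scale) n" "Omega scale n F = Omega scale n F'"
  obtain G where G: "\<And>i. G i \<in> End_ops n" "skew n G" "F = tens n G" using CE_cases[OF F(1)] by blast
  obtain G' where G': "\<And>i. G' i \<in> End_ops n" "skew n G'" "F' = tens n G'" using CE_cases[OF F(2)] by blast
  have last: "G (n - 1) = G' (n - 1)" using F(3) by (simp only: G(3) G'(3) Omega_tens G(1) G'(1) n)
  have "G i = G' i" if "i < n" for i
  proof
    fix xs show "G i xs = G' i xs"
      using skew_eq_from_cochain[OF G(2) that, of xs] skew_eq_from_cochain[OF G'(2) that, of xs]
        multilinear_mapsD(2)[OF G(1), of xs] multilinear_mapsD(2)[OF G'(1), of xs] last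
      by (cases "length xs = n") auto
  qed
  then show "F = F'" unfolding G(3) G'(3) by (rule tens_cong)
next
  fix f assume "f \<in> Omega scale n ` CE (perm_end scale) n"
  then obtain F where F: "F \<in> CE (perm_end scale) n" "f = Omega scale n F" by blast
  obtain G where G: "\<And>i. G i \<in> End_ops n" "skew n G" "F = tens n G" using CE_cases[OF F(1)] by blast
  show "f \<in> pLie_cochains scale n"
    unfolding F(2) G(3) Omega_tens[of G, OF G(1) n] by (rule skew_last_cochain[of G, OF G(1,2) n])
next
  fix f assume f: "f \<in> pLie_cochains scale n"
  then have "f \<in> End_ops n" by (simp add: pLie_cochains_iff)
  note c = from_cochain_closed[OF this]
  have "tens n (from_cochain n f) \<in> CE (perm_end scale) n"
    by (rule CE_tens_iff[of "from_cochain n f", THEN iffD2]) (rule c, rule from_cochain_skew[OF f])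
  moreover have "Omega scale n (tens n (from_cochain n f)) = f"
    unfolding Omega_tens[of "from_cochain n f", OF c n] by (rule from_cochain_last[OF n])
  ultimately show "f \<in> Omega scale n ` CE (perm_end scale) n" by (metis imageI)
qed

lemma d_CE_Omega:
  assumes F: "F \<in> CE (perm_end scale) n" and n: "n \<ge> 1"
  shows "d_CE (perm_end scale) (alpha_nu scale (\<diamond>)) n F \<in> CE (perm_end scale) (n + 1)"
    "Omega scale (n + 1) (d_CE (perm_end scale) (alpha_nu scale (\<diamond>)) n F) =
      d_pLie scale (\<diamond>) n (Omega scale n F)"
proof -
  obtain G where G: "\<And>i. G i \<in> End_ops n" "skew n G" "F = tens n G" using CE_cases[OF F] by blast
  note c = model_d_closed[of G, OF G(1) n]
  show "d_CE (perm_end scale) (alpha_nu scale (\<diamond>)) n F \<in> CE (perm_end scale) (n + 1)"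
    unfolding G(3) d_CE_tens[of G, OF G(1) n]
    by (rule CE_tens_iff[of "model_d n G", THEN iffD2]) (rule c, rule model_d_skew[OF G(2) n])
  have "n + 1 \<ge> 1" by simp
  show "Omega scale (n + 1) (d_CE (perm_end scale) (alpha_nu scale (\<diamond>)) n F) =
      d_pLie scale (\<diamond>) n (Omega scale n F)"
    unfolding G(3) d_CE_tens[of G, OF G(1) n] Omega_tens[of "model_d n G", OF c \<open>n + 1 \<ge> 1\<close>]
      Omega_tens[of G, OF G(1) n] add_diff_cancel_right'
    by (rule model_d_last[of G, OF G(1,2) n])
qed

lemma cochain_isomorphism_Omega:
  "cochain_isomorphism
    (scale_fun (*)) (CE (perm_end scale)) (d_CE (perm_end scale) (alpha_nu scale (\<diamond>)))
    (scale_fun scale) (pLie_cochains scale) (d_pLie scale (\<diamond>)) (Omega scale)"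
proof (rule cochain_isomorphism_transport)
  show "cochain_complex (scale_fun scale) (pLie_cochains scale) (d_pLie scale (\<diamond>))"
    by (rule cochain_complex_pLie)
qed (simp_all only: vector_space_functionals subspace_CE linear_on_Omega bij_betw_Omega d_CE_Omega)

end

text \<open>The first two conjuncts pin down \<open>Omega\<close>, which is defined by a
  description: expansions over the \<xi>_n^\<sigma> exist, and the value does not depend on the one
  chosen. In the last conjunct \<open>inv_into\<close> is the inverse of \<Omega>_n.\<close>

theorem theorem2p12:
  fixes scale :: "'k::field_char_0 \<Rightarrow> 'v::ab_group_add \<Rightarrow> 'v"
    and dia :: "'v \<Rightarrow> 'v \<Rightarrow> 'v"
  assumes "pre_lie_algebra scale dia"
  shows "(\<forall>n\<ge>1. \<forall>F\<in>CE (perm_end scale) n. \<exists>f.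
      (\<forall>\<sigma>\<in>inv_shuffles (n - 1) 1. f \<sigma> \<in> ops (end_operad scale) n) \<and> F = xi_sum scale n f) \<and>
    (\<forall>n\<ge>1. \<forall>f. (\<forall>\<sigma>\<in>inv_shuffles (n - 1) 1. f \<sigma> \<in> ops (end_operad scale) n) \<longrightarrow>
      xi_sum scale n f \<in> CE (perm_end scale) n \<longrightarrow> Omega scale n (xi_sum scale n f) = f id) \<and>
    cochain_isomorphism
      (scale_fun (*)) (CE (perm_end scale)) (d_CE (perm_end scale) (alpha_nu scale dia))
      (scale_fun scale) (pLie_cochains scale) (d_pLie scale dia)
      (Omega scale) \<and>
    (\<forall>n\<ge>1. \<forall>g\<in>pLie_cochains scale n. d_pLie scale dia n g =
      Omega scale (n + 1) (d_CE (perm_end scale) (alpha_nu scale dia) n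
        (inv_into (CE (perm_end scale) n) (Omega scale n) g)))"
proof -
  interpret pre_lie_algebra scale dia by fact
  interpret pre_lie_algebra_char_0 scale dia by unfold_locales
  show ?thesis
  proof (intro conjI allI ballI impI)
    fix n :: nat and F
    assume n: "1 \<le> n" and "F \<in> CE (perm_end scale) n"
    then obtain G where G: "\<And>i. G i \<in> End_ops n" "F = tens n G" using CE_cases by blast
    then show "\<exists>f. (\<forall>\<sigma>\<in>inv_shuffles (n - 1) 1. f \<sigma> \<in> ops (end_operad scale) n) \<and> F = xi_sum scale n f"
      using tens_eq_xi_sum[OF n, of G] by (intro exI[of _ "\<lambda>\<sigma>. G (inv \<sigma> (n - 1))"]) simp
  next
    fix n :: nat and f
    assume "1 \<le> n" "\<forall>\<sigma>\<in>inv_shuffles (n - 1) 1. f \<sigma> \<in> ops (end_operad scale) n"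
    then show "Omega scale n (xi_sum scale n f) = f id"
      unfolding end_operad_simps by (rule Omega_xi_sum)
  next
    show "cochain_isomorphism (scale_fun (*)) (CE (perm_end scale)) (d_CE (perm_end scale) (alpha_nu scale dia))
        (scale_fun scale) (pLie_cochains scale) (d_pLie scale dia) (Omega scale)"
      by (rule cochain_isomorphism_Omega)
  next
    fix n :: nat and g
    assume n: "1 \<le> n" and g: "g \<in> pLie_cochains scale n"
    then have im: "g \<in> Omega scale n ` CE (perm_end scale) n"
      using bij_betw_imp_surj_on[OF bij_betw_Omega] by simp
    show "d_pLie scale dia n g = Omega scale (n + 1) (d_CE (perm_end scale) (alpha_nu scale dia) n
        (inv_into (CE (perm_end scale) n) (Omega scale n) g))"
      unfolding d_CE_Omega(2)[OF inv_into_into[OF im] n] f_inv_into_f[OF im] ..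
  qed
qed

end
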